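(* Let $(\Omega,\Omega_w,\Omega_h)$ be a Lipschitz interface triple in $\mathbb{R}$ and let $S\in L^\infty(\Omega_h,\mathbb{C})$ satisfy $\operatorname{ess\,inf}_{x\in\Omega_h}\operatorname{Re}(S(x))>0$. Then the semigroup $T_S^\perp$ of the coupled wave-heat system possesses polynomial decay with rate $1/d=1/2$, i.e., for every $k\in\mathbb{N}$ there exists $C_k>0$ such that $$\|T_S^\perp(t)x\|_{\mathbb{H}_1}\le\frac{C_k}{(1+t)^{k/2}}\,\|x\|_{(A_S^\perp)^k}\qquad\text{for all } t\ge 0,\ x\in\operatorname{dom}\big((A_S^\perp)^k\big).$$ Additionally, $T_S^\perp$ does not possess polynomial decay of rate $1/d>2$ for all $S\in L^\infty(\Omega_h,\mathbb{C})$ (with $\operatorname{ess\,inf}_{x\in\Omega_h}\operatorname{Re}(S(x))>0$), as was shown in earlier work of Batty, Paunonen and Seifert.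
   Context: A Lipschitz interface triple $(\Omega,\Omega_w,\Omega_h)$ in $\mathbb{R}$ consists of a bounded non-empty open interval $\Omega$ and two disjoint non-empty open intervals $\Omega_w,\Omega_h\subset\Omega$ with $\overline\Omega=\overline{\Omega_w\cup\Omega_h}$. One sets $\Gamma_w=\partial\Omega\setminus\partial\Omega_h$, $\Gamma_h=\partial\Omega\setminus\partial\Omega_w$, and the interface is $\gamma=\partial\Omega_w\setminus\overline{\Gamma_w}=\partial\Omega_h\setminus\overline{\Gamma_h}$ (so each of these is a single point). All spaces are complex; $H^1_{\Gamma}(U)$ denotes the functions in $H^1(U)$ vanishing on the boundary part $\Gamma$. For an interval $U$ with boundary point $\Gamma$, $\operatorname{tr}^\Gamma(f)$ is the value of $f\in H^1(U)$ at $\Gamma$, and $\operatorname{tr}^\Gamma_N(f)$ is this value multiplied by the outer normal ($+1$ at the right endpoint of $U$, $-1$ at the left endpoint). The coupled wave-heat system is $w_{tt}=w_{xx}$ on $\Omega_w$, $h_t=(Sh_x)_x$ on $\Omega_h$, with $w_t=0$ on $\Gamma_w$, $h=0$ on $\Gamma_h$, and, on $\gamma$, $w_t=h$ and $-w_x\nu_w=(Sh_x)\nu_h$, where $\nu_w,\nu_h$ are the outer normals of $\Omega_w,\Omega_h$. In the variables $(w_1,w_2,h_1)=(w_t,w_x,h)$ it is the abstract Cauchy problem for the following operator. Let $\mathbb{H}_1=L^2(\Omega_w)\times L^2(\Omega_w)\times L^2(\Omega_h)$ and let $A_S:\operatorname{dom}(A_S)\subset\mathbb{H}_1\to\mathbb{H}_1$,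 $A_S(w_1,w_2,h_1)=(w_2',\,w_1',\,(Sh_1')')$, with domain all $(w_1,w_2,h_1)\in H^1_{\Gamma_w}(\Omega_w)\times H^1(\Omega_w)\times H^1_{\Gamma_h}(\Omega_h)$ with $Sh_1'\in H^1(\Omega_h)$, $\operatorname{tr}^\gamma(w_1)=\operatorname{tr}^\gamma(h_1)$, $\operatorname{tr}^\gamma_N(w_2)=-\operatorname{tr}^\gamma_N(Sh_1')$ (normal traces taken from $\Omega_w$ and $\Omega_h$ respectively). $A_S$ generates a contractive $C_0$-semigroup $T_S$ on $\mathbb{H}_1$ leaving $\ker(A_S)^\perp$ invariant; $T_S^\perp$ and $A_S^\perp$ denote the restrictions of $T_S$ and $A_S$ to $\ker(A_S)^\perp$ (with $\operatorname{dom}(A_S^\perp)=\operatorname{dom}(A_S)\cap\ker(A_S)^\perp$), and $A_S^\perp$ generates $T_S^\perp$. $\|\cdot\|_B$ denotes the graph norm of an operator $B$. For $d>0$, a bounded semigroup $T$ with generator $A$ on a Hilbert space $H$ possesses polynomial decay with rate $1/d$ if for every $k\in\mathbb{N}$ there is $C_k>0$ with $\|T(t)x\|_H\le C_k(1+t)^{-k/d}\|x\|_{A^k}$ for all $t\ge0$ and $x\in\operatorname{dom}(A^k)$. *)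

theory Defs
  imports "HOL-Probability.Essential_Supremum"
begin

section \<open>Complex inner product spaces\<close>

text \<open>Complex scalars and the complex inner product (linear in the first argument) are added to
  \<^class>\<open>real_inner\<close>, whose real inner product is the real part of the complex one; norm and
  topology are those of \<^class>\<open>real_inner\<close>.\<close>

class complex_inner = real_inner +
  fixes scaleC :: "complex \<Rightarrow> 'a \<Rightarrow> 'a"
    and cinner :: "'a \<Rightarrow> 'a \<Rightarrow> complex"
  assumes scaleC_add_right: "scaleC c (x + y) = scaleC c x + scaleC c y"
    and scaleC_add_left: "scaleC (c + d) x = scaleC c x + scaleC d x"
    and scaleC_scaleC: "scaleC c (scaleC d x) = scaleC (c * d) x"
    and scaleC_of_real: "scaleC (complex_of_real r) x = scaleR r x"
    and cinner_commute: "cinner x y = cnj (cinner y x)"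
    and cinner_add_left: "cinner (x + y) z = cinner x z + cinner y z"
    and cinner_scaleC_left: "cinner (scaleC c x) y = c * cinner x y"
    and inner_eq_Re_cinner: "inner x y = Re (cinner x y)"

instantiation prod :: (complex_inner, complex_inner) complex_inner
begin

definition scaleC_prod :: "complex \<Rightarrow> 'a \<times> 'b \<Rightarrow> 'a \<times> 'b" where
  "scaleC_prod c x = (scaleC c (fst x), scaleC c (snd x))"

definition cinner_prod :: "'a \<times> 'b \<Rightarrow> 'a \<times> 'b \<Rightarrow> complex" where
  "cinner_prod x y = cinner (fst x) (fst y) + cinner (snd x) (snd y)"

instance
proof
  fix x y z :: "'a \<times> 'b" and c d :: complex and r :: real
  show "scaleC c (x + y) = scaleC c x + scaleC c y"
    by (simp add: scaleC_prod_def scaleC_add_right)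
  show "scaleC (c + d) x = scaleC c x + scaleC d x"
    by (simp add: scaleC_prod_def scaleC_add_left)
  show "scaleC c (scaleC d x) = scaleC (c * d) x"
    by (simp add: scaleC_prod_def scaleC_scaleC)
  show "scaleC (complex_of_real r) x = scaleR r x"
    by (simp add: scaleC_prod_def scaleC_of_real scaleR_prod_def)
  show "cinner x y = cnj (cinner y x)"
    by (simp add: cinner_prod_def flip: cinner_commute)
  show "cinner (x + y) z = cinner x z + cinner y z"
    by (simp add: cinner_prod_def cinner_add_left)
  show "cinner (scaleC c x) y = c * cinner x y"
    by (simp add: cinner_prod_def scaleC_prod_def cinner_scaleC_left distrib_left)
  show "inner x y = Re (cinner x y)"
    by (simp add: cinner_prod_def inner_prod_def inner_eq_Re_cinner)
qed

end

section \<open>The complex space L2 of the real line\<close>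

definition square_integrable :: "(real \<Rightarrow> complex) \<Rightarrow> bool" where
  "square_integrable f \<longleftrightarrow>
     f \<in> borel_measurable lebesgue \<and> integrable lebesgue (\<lambda>x. (cmod (f x))\<^sup>2)"

lemma square_integrableD [measurable_dest]: "square_integrable f \<Longrightarrow> f \<in> borel_measurable lebesgue"
  by (simp add: square_integrable_def)

lemma square_integrable_zero: "square_integrable (\<lambda>x. 0)"
  by (simp add: square_integrable_def)

lemma square_integrable_mult:
  assumes "square_integrable f" "square_integrable g"
  shows "integrable lebesgue (\<lambda>x. f x * cnj (g x))"
proof (rule Bochner_Integration.integrable_bound)
  show "integrable lebesgue (\<lambda>x. (cmod (f x))\<^sup>2 + (cmod (g x))\<^sup>2)"
    using assms by (simp add: square_integrable_def)
  have [measurable]: "f \<in> borel_measurable lebesgue" "g \<in> borel_measurable lebesgue"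
    using assms by (simp_all add: square_integrable_def)
  have [measurable]: "cnj \<in> borel_measurable borel"
    by (intro borel_measurable_continuous_onI continuous_intros)
  show "(\<lambda>x. f x * cnj (g x)) \<in> borel_measurable lebesgue"
    by measurable
  have "cmod (f x * cnj (g x)) \<le> (cmod (f x))\<^sup>2 + (cmod (g x))\<^sup>2" for x
  proof -
    have "2 * (cmod (f x) * cmod (g x)) \<le> (cmod (f x))\<^sup>2 + (cmod (g x))\<^sup>2"
      using sum_squares_bound[of "cmod (f x)" "cmod (g x)"] by simp
    moreover have "0 \<le> cmod (f x) * cmod (g x)" by simp
    ultimately show ?thesis unfolding norm_mult complex_mod_cnj by linarith
  qed
  then show "AE x in lebesgue. cmod (f x * cnj (g x)) \<le> norm ((cmod (f x))\<^sup>2 + (cmod (g x))\<^sup>2)"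
    by (intro AE_I2) (metis abs_of_nonneg add_nonneg_nonneg real_norm_def zero_le_power2)
qed

lemma square_integrable_add:
  assumes "square_integrable f" "square_integrable g"
  shows "square_integrable (\<lambda>x. f x + g x)"
  unfolding square_integrable_def
proof
  have [measurable]: "f \<in> borel_measurable lebesgue" "g \<in> borel_measurable lebesgue"
    using assms by (simp_all add: square_integrable_def)
  show "(\<lambda>x. f x + g x) \<in> borel_measurable lebesgue"
    by measurable
  show "integrable lebesgue (\<lambda>x. (cmod (f x + g x))\<^sup>2)"
  proof (rule Bochner_Integration.integrable_bound)
    show "integrable lebesgue (\<lambda>x. 2 * (cmod (f x))\<^sup>2 + 2 * (cmod (g x))\<^sup>2)"
      using assms by (simp add: square_integrable_def)
    show "(\<lambda>x. (cmod (f x + g x))\<^sup>2) \<in> borel_measurable lebesgue"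
      by measurable
    have "(cmod (f x + g x))\<^sup>2 \<le> 2 * (cmod (f x))\<^sup>2 + 2 * (cmod (g x))\<^sup>2" for x
    proof -
      have "(cmod (f x + g x))\<^sup>2 \<le> (cmod (f x) + cmod (g x))\<^sup>2"
        by (intro power_mono norm_triangle_ineq) simp
      also have "\<dots> \<le> 2 * (cmod (f x))\<^sup>2 + 2 * (cmod (g x))\<^sup>2"
        using sum_squares_bound[of "cmod (f x)" "cmod (g x)"] by (simp add: power2_sum)
      finally show ?thesis .
    qed
    then show "AE x in lebesgue.
        norm ((cmod (f x + g x))\<^sup>2) \<le> norm (2 * (cmod (f x))\<^sup>2 + 2 * (cmod (g x))\<^sup>2)"
      by (intro AE_I2) simp
  qed
qed

lemma square_integrable_scale:
  assumes "square_integrable f"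
  shows "square_integrable (\<lambda>x. c * f x)"
  using assms by (auto simp: square_integrable_def norm_mult power_mult_distrib)

definition L2_rel :: "(real \<Rightarrow> complex) \<Rightarrow> (real \<Rightarrow> complex) \<Rightarrow> bool" where
  "L2_rel f g \<longleftrightarrow> square_integrable f \<and> square_integrable g \<and> (AE x in lebesgue. f x = g x)"

lemma part_equivp_L2_rel: "part_equivp L2_rel"
proof (rule part_equivpI)
  show "\<exists>f. L2_rel f f"
    using square_integrable_zero by (auto simp: L2_rel_def)
  show "symp L2_rel"
    by (rule sympI) (auto simp: L2_rel_def elim: eventually_mono)
  show "transp L2_rel"
    by (rule transpI) (auto simp: L2_rel_def elim: eventually_elim2)
qed

quotient_type L2 = "real \<Rightarrow> complex" / partial: L2_rel
  by (rule part_equivp_L2_rel)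

lemma L2_rel_cinner:
  assumes "L2_rel f f'" "L2_rel g g'"
  shows "(LINT x|lebesgue. f x * cnj (g x)) = (LINT x|lebesgue. f' x * cnj (g' x))"
proof (rule integral_cong_AE)
  show "(\<lambda>x. f x * cnj (g x)) \<in> borel_measurable lebesgue"
       "(\<lambda>x. f' x * cnj (g' x)) \<in> borel_measurable lebesgue"
    using assms square_integrable_mult
    by (auto simp: L2_rel_def intro!: borel_measurable_integrable)
  show "AE x in lebesgue. f x * cnj (g x) = f' x * cnj (g' x)"
    using assms by (auto simp: L2_rel_def elim: eventually_elim2)
qed

instantiation L2 :: complex_inner
begin

lift_definition zero_L2 :: L2 is "\<lambda>x. 0"
  by (simp add: L2_rel_def square_integrable_zero)

lift_definition plus_L2 :: "L2 \<Rightarrow> L2 \<Rightarrow> L2" is "\<lambda>f g x. f x + g x"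
  by (auto simp: L2_rel_def square_integrable_add elim: eventually_elim2)

lift_definition scaleC_L2 :: "complex \<Rightarrow> L2 \<Rightarrow> L2" is "\<lambda>c f x. c * f x"
  by (auto simp: L2_rel_def square_integrable_scale elim: eventually_mono)

lift_definition cinner_L2 :: "L2 \<Rightarrow> L2 \<Rightarrow> complex"
  is "\<lambda>f g. LINT x|lebesgue. f x * cnj (g x)"
  by (rule L2_rel_cinner)

definition scaleR_L2 :: "real \<Rightarrow> L2 \<Rightarrow> L2" where
  "scaleR_L2 r f = scaleC (complex_of_real r) f"

definition uminus_L2 :: "L2 \<Rightarrow> L2" where
  "uminus_L2 f = scaleC (- 1) f"

definition minus_L2 :: "L2 \<Rightarrow> L2 \<Rightarrow> L2" where
  "minus_L2 f g = f + - g"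

definition inner_L2 :: "L2 \<Rightarrow> L2 \<Rightarrow> real" where
  "inner_L2 f g = Re (cinner f g)"

definition norm_L2 :: "L2 \<Rightarrow> real" where
  "norm_L2 f = sqrt (inner f f)"

definition sgn_L2 :: "L2 \<Rightarrow> L2" where
  "sgn_L2 f = scaleR (inverse (norm f)) f"

definition dist_L2 :: "L2 \<Rightarrow> L2 \<Rightarrow> real" where
  "dist_L2 f g = norm (f - g)"

definition uniformity_L2 :: "(L2 \<times> L2) filter" where
  "uniformity_L2 = (INF e\<in>{0 <..}. principal {(f, g). dist f g < e})"

definition open_L2 :: "L2 set \<Rightarrow> bool" where
  "open_L2 U \<longleftrightarrow> (\<forall>f\<in>U. eventually (\<lambda>(f', g). f' = f \<longrightarrow> g \<in> U) uniformity)"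

instance
proof
  fix f g h :: L2 and c d :: complex and r s :: real
  have self: "L2_rel k k \<longleftrightarrow> square_integrable k" for k
    by (auto simp: L2_rel_def)
  show add_assoc: "f + g + h = f + (g + h)"
    by transfer (auto simp: L2_rel_def add.assoc intro!: square_integrable_add)
  show "f + g = g + f"
    by transfer (auto simp: L2_rel_def add.commute intro!: square_integrable_add)
  show "0 + f = f"
    by transfer (auto simp: L2_rel_def)
  show "- f + f = 0"
    unfolding uminus_L2_def
    by transfer (auto simp: L2_rel_def square_integrable_zero)
  show "f - g = f + - g"
    by (rule minus_L2_def)
  show aR: "scaleC c (f + g) = scaleC c f + scaleC c g" for c and f g :: L2
    by transfer (auto simp: L2_rel_def distrib_left
        intro!: square_integrable_add square_integrable_scale)
  show aL: "scaleC (c + d) f = scaleC c f + scaleC d f" for c d and f :: L2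
    by transfer (auto simp: L2_rel_def distrib_right
        intro!: square_integrable_add square_integrable_scale)
  show sC: "scaleC c (scaleC d f) = scaleC (c * d) f" for c d and f :: L2
    by transfer (auto simp: L2_rel_def mult.assoc intro!: square_integrable_scale)
  have one: "scaleC 1 f = f" for f :: L2
    by transfer (auto simp: L2_rel_def)
  show "scaleC (complex_of_real r) f = scaleR r f"
    by (simp add: scaleR_L2_def)
  show "scaleR r (f + g) = scaleR r f + scaleR r g"
    by (simp add: scaleR_L2_def aR)
  show "scaleR (r + s) f = scaleR r f + scaleR s f"
    by (simp add: scaleR_L2_def aL)
  show "scaleR r (scaleR s f) = scaleR (r * s) f"
    by (simp add: scaleR_L2_def sC)
  show "scaleR 1 f = f"
    by (simp add: scaleR_L2_def one)
  show "sgn f = scaleR (inverse (norm f)) f"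
    by (rule sgn_L2_def)
  show "dist f g = norm (f - g)"
    by (rule dist_L2_def)
  show "uniformity = (INF e\<in>{0 <..}. principal {(f, g :: L2). dist f g < e})"
    by (rule uniformity_L2_def)
  show "open U \<longleftrightarrow> (\<forall>f\<in>U. eventually (\<lambda>(f', g). f' = f \<longrightarrow> g \<in> U) uniformity)" for U :: "L2 set"
    by (rule open_L2_def)
  show cc: "cinner f g = cnj (cinner g f)" for f g :: L2
    by transfer (subst Bochner_Integration.integral_cnj[symmetric], simp add: mult.commute)
  show cA: "cinner (f + g) h = cinner f h + cinner g h" for f g h :: L2
    by transfer (simp add: L2_rel_def distrib_right square_integrable_mult)
  show cS: "cinner (scaleC c f) g = c * cinner f g" for c and f g :: L2
    by transfer (simp add: mult.assoc)
  show "inner f g = Re (cinner f g)"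
    by (rule inner_L2_def)
  show "inner f g = inner g f"
    by (subst (1 2) inner_L2_def, subst cc) simp
  show "inner (f + g) h = inner f h + inner g h"
    by (simp add: inner_L2_def cA)
  show "inner (scaleR r f) g = r * inner f g"
    by (simp add: inner_L2_def scaleR_L2_def cS)
  have norm2: "Re (LINT x|lebesgue. k x * cnj (k x)) = (LINT x|lebesgue. (cmod (k x))\<^sup>2)" for k
    by (simp flip: complex_norm_square of_real_power)
  show "0 \<le> inner f f"
    unfolding inner_L2_def by transfer (simp add: norm2)
  show "inner f f = 0 \<longleftrightarrow> f = 0"
    unfolding inner_L2_def
  proof transfer
    fix k assume "L2_rel k k"
    then have k: "square_integrable k" by (simp add: self)
    have "(LINT x|lebesgue. (cmod (k x))\<^sup>2) = 0 \<longleftrightarrow> (AE x in lebesgue. (cmod (k x))\<^sup>2 = 0)"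
      using k by (intro integral_nonneg_eq_0_iff_AE) (auto simp: square_integrable_def)
    then show "Re (LINT x|lebesgue. k x * cnj (k x)) = 0 \<longleftrightarrow> L2_rel k (\<lambda>x. 0)"
      using k by (simp add: norm2 L2_rel_def square_integrable_zero)
  qed
  show "norm f = sqrt (inner f f)"
    by (rule norm_L2_def)
qed

end

text \<open>The space L2 of a measurable set \<open>U\<close> is identified, via extension by zero, with a closed
  subspace of \<^typ>\<open>L2\<close>.\<close>

definition L2_on :: "real set \<Rightarrow> L2 set" where
  "L2_on U = {f. AE x in lebesgue. x \<notin> U \<longrightarrow> rep_L2 f x = 0}"

section \<open>Sobolev spaces and traces on intervals\<close>

text \<open>Real-valued test functions suffice to determine complex-valued weak derivatives, since
  both sides of the defining identity are complex linear in the test function.\<close>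

definition test_function :: "real set \<Rightarrow> (real \<Rightarrow> real) \<Rightarrow> bool" where
  "test_function U \<phi> \<longleftrightarrow>
     (\<forall>n. (deriv ^^ n) \<phi> differentiable_on UNIV) \<and>
     compact (closure {x. \<phi> x \<noteq> 0}) \<and> closure {x. \<phi> x \<noteq> 0} \<subseteq> U"

definition has_weak_derivative_on :: "L2 \<Rightarrow> L2 \<Rightarrow> real set \<Rightarrow> bool" where
  "has_weak_derivative_on f g U \<longleftrightarrow>
     f \<in> L2_on U \<and> g \<in> L2_on U \<and>
     (\<forall>\<phi>. test_function U \<phi> \<longrightarrow>
        (LINT x:U|lebesgue. rep_L2 f x * complex_of_real (deriv \<phi> x)) =
        - (LINT x:U|lebesgue. rep_L2 g x * complex_of_real (\<phi> x)))"

definition H1 :: "real set \<Rightarrow> L2 set" where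
  "H1 U = {f. \<exists>g. has_weak_derivative_on f g U}"

text \<open>The value of \<open>f\<close> at a boundary point \<open>p\<close> of \<open>U\<close> is the value of the representative of \<open>f\<close>
  that is continuous up to the boundary.\<close>

definition trace_at :: "real set \<Rightarrow> real \<Rightarrow> L2 \<Rightarrow> complex" where
  "trace_at U p f = (THE v. \<exists>F. continuous_on (closure U) F \<and>
      (AE x in lebesgue_on U. rep_L2 f x = F x) \<and> v = F p)"

definition outer_normal :: "real set \<Rightarrow> real \<Rightarrow> complex" where
  "outer_normal U p = (if p = Sup U then 1 else if p = Inf U then - 1 else 0)"

definition normal_trace_at :: "real set \<Rightarrow> real \<Rightarrow> L2 \<Rightarrow> complex" where
  "normal_trace_at U p f = trace_at U p f * outer_normal U p"

definition H1_vanishing :: "real set \<Rightarrow> real set \<Rightarrow> L2 set" where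
  "H1_vanishing U \<Gamma> = {f \<in> H1 U. \<forall>p\<in>\<Gamma>. trace_at U p f = 0}"

section \<open>Semigroups on subspaces of a complex inner product space\<close>

text \<open>Unbounded operators are represented by their graphs, so that \<^term>\<open>Domain A\<close> is the domain
  of \<open>A\<close> and \<open>A ^^ k\<close> is, for \<open>k > 0\<close>, the graph of the \<open>k\<close>-th power on its natural domain. Only
  the values \<open>T t x\<close> with \<open>t \<ge> 0\<close> and \<open>x\<close> in the underlying space matter for a semigroup \<open>T\<close>.\<close>

definition C0_semigroup_on :: "'a::complex_inner set \<Rightarrow> (real \<Rightarrow> 'a \<Rightarrow> 'a) \<Rightarrow> bool" where
  "C0_semigroup_on X T \<longleftrightarrow>
     (\<forall>t\<ge>0. (\<forall>x\<in>X. T t x \<in> X) \<and>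
        (\<forall>x\<in>X. \<forall>y\<in>X. T t (x + y) = T t x + T t y) \<and>
        (\<forall>c. \<forall>x\<in>X. T t (scaleC c x) = scaleC c (T t x)) \<and>
        (\<exists>M. \<forall>x\<in>X. norm (T t x) \<le> M * norm x)) \<and>
     (\<forall>x\<in>X. T 0 x = x) \<and>
     (\<forall>s\<ge>0. \<forall>t\<ge>0. \<forall>x\<in>X. T (s + t) x = T s (T t x)) \<and>
     (\<forall>x\<in>X. ((\<lambda>t. T t x) \<longlongrightarrow> x) (at_right 0))"

definition generator_on :: "'a::complex_inner set \<Rightarrow> (real \<Rightarrow> 'a \<Rightarrow> 'a) \<Rightarrow> ('a \<times> 'a) set" where
  "generator_on X T =
     {(x, y). x \<in> X \<and> y \<in> X \<and> ((\<lambda>t. (T t x - x) /\<^sub>R t) \<longlongrightarrow> y) (at_right 0)}"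

definition generates_on ::
  "'a::complex_inner set \<Rightarrow> ('a \<times> 'a) set \<Rightarrow> (real \<Rightarrow> 'a \<Rightarrow> 'a) \<Rightarrow> bool" where
  "generates_on X A T \<longleftrightarrow> C0_semigroup_on X T \<and> generator_on X T = A"

text \<open>Decay with rate \<open>1 / d\<close> in the graph norm of \<open>A ^^ k\<close>, for the semigroup \<open>T\<close> with generator
  \<open>A\<close> on \<open>X\<close>. The condition \<open>x \<in> X\<close> is only needed for \<open>k = 0\<close>, where \<open>A ^^ 0\<close> is the identity on
  the whole type; this case expresses that \<open>T\<close> is bounded.\<close>

definition polynomial_decay ::
  "'a::complex_inner set \<Rightarrow> ('a \<times> 'a) set \<Rightarrow> (real \<Rightarrow> 'a \<Rightarrow> 'a) \<Rightarrow> real \<Rightarrow> bool" where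
  "polynomial_decay X A T d \<longleftrightarrow>
     (\<forall>k::nat. \<exists>C>0. \<forall>t\<ge>0. \<forall>x\<in>X. \<forall>y. (x, y) \<in> A ^^ k \<longrightarrow>
        norm (T t x) \<le> C / (1 + t) powr (real k / d) * sqrt ((norm x)\<^sup>2 + (norm y)\<^sup>2))"

section \<open>The coupled wave-heat system\<close>

definition lipschitz_interface_triple :: "real set \<Rightarrow> real set \<Rightarrow> real set \<Rightarrow> bool" where
  "lipschitz_interface_triple \<Omega> \<Omega>w \<Omega>h \<longleftrightarrow>
     open \<Omega> \<and> is_interval \<Omega> \<and> bounded \<Omega> \<and> \<Omega> \<noteq> {} \<and>
     open \<Omega>w \<and> is_interval \<Omega>w \<and> \<Omega>w \<noteq> {} \<and> \<Omega>w \<subseteq> \<Omega> \<and>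
     open \<Omega>h \<and> is_interval \<Omega>h \<and> \<Omega>h \<noteq> {} \<and> \<Omega>h \<subseteq> \<Omega> \<and>
     \<Omega>w \<inter> \<Omega>h = {} \<and> closure \<Omega> = closure (\<Omega>w \<union> \<Omega>h)"

definition outer_boundary :: "real set \<Rightarrow> real set \<Rightarrow> real set" where
  "outer_boundary \<Omega> \<Omega>' = frontier \<Omega> - frontier \<Omega>'"

definition interface :: "real set \<Rightarrow> real set \<Rightarrow> real set \<Rightarrow> real set" where
  "interface \<Omega> \<Omega>w \<Omega>h = frontier \<Omega>w - closure (outer_boundary \<Omega> \<Omega>h)"

definition essinf :: "'a measure \<Rightarrow> ('a \<Rightarrow> ereal) \<Rightarrow> ereal" where
  "essinf M f = - esssup M (\<lambda>x. - f x)"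

definition admissible_coefficient :: "real set \<Rightarrow> (real \<Rightarrow> complex) \<Rightarrow> bool" where
  "admissible_coefficient U S \<longleftrightarrow>
     S \<in> borel_measurable (lebesgue_on U) \<and>
     esssup (lebesgue_on U) (\<lambda>x. ereal (cmod (S x))) < \<infinity> \<and>
     essinf (lebesgue_on U) (\<lambda>x. ereal (Re (S x))) > 0"

definition state_space :: "real set \<Rightarrow> real set \<Rightarrow> (L2 \<times> L2 \<times> L2) set" where
  "state_space \<Omega>w \<Omega>h = L2_on \<Omega>w \<times> L2_on \<Omega>w \<times> L2_on \<Omega>h"

text \<open>Here \<open>g\<close> is the weak derivative of \<open>h1\<close> and \<open>q\<close> is the flux \<open>S g\<close>. Note that the boundary
  part on which \<open>w1\<close> vanishes is the boundary of \<open>\<Omega>\<close> minus that of \<open>\<Omega>h\<close>, and vice versa.\<close>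

definition wave_heat_operator ::
  "real set \<Rightarrow> real set \<Rightarrow> real set \<Rightarrow> (real \<Rightarrow> complex) \<Rightarrow>
    ((L2 \<times> L2 \<times> L2) \<times> (L2 \<times> L2 \<times> L2)) set" where
  "wave_heat_operator \<Omega> \<Omega>w \<Omega>h S =
     {((w1, w2, h1), (u1, u2, u3)).
        w1 \<in> H1_vanishing \<Omega>w (outer_boundary \<Omega> \<Omega>h) \<and>
        w2 \<in> H1 \<Omega>w \<and>
        h1 \<in> H1_vanishing \<Omega>h (outer_boundary \<Omega> \<Omega>w) \<and>
        (\<exists>g q. has_weak_derivative_on h1 g \<Omega>h \<and>
           (AE x in lebesgue_on \<Omega>h. rep_L2 q x = S x * rep_L2 g x) \<and>
           q \<in> H1 \<Omega>h \<and>
           (\<forall>p\<in>interface \<Omega> \<Omega>w \<Omega>h.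
              trace_at \<Omega>w p w1 = trace_at \<Omega>h p h1 \<and>
              normal_trace_at \<Omega>w p w2 = - normal_trace_at \<Omega>h p q) \<and>
           has_weak_derivative_on w2 u1 \<Omega>w \<and>
           has_weak_derivative_on w1 u2 \<Omega>w \<and>
           has_weak_derivative_on q u3 \<Omega>h)}"

definition op_kernel :: "('a::zero \<times> 'a) set \<Rightarrow> 'a set" where
  "op_kernel A = {x. (x, 0) \<in> A}"

definition kernel_perp :: "'a::complex_inner set \<Rightarrow> ('a \<times> 'a) set \<Rightarrow> 'a set" where
  "kernel_perp X A = {x \<in> X. \<forall>z\<in>op_kernel A. cinner x z = 0}"

definition op_restrict :: "('a \<times> 'a) set \<Rightarrow> 'a set \<Rightarrow> ('a \<times> 'a) set" where
  "op_restrict A Y = {(x, y) \<in> A. x \<in> Y}"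

text \<open>Polynomial decay of the restriction of \<open>T\<close> to the orthogonal complement of the kernel of
  the wave-heat operator with coefficient \<open>S\<close>, for the semigroup \<open>T\<close> generated by that operator.\<close>

definition wave_heat_perp_decay ::
  "real set \<Rightarrow> real set \<Rightarrow> real set \<Rightarrow> (real \<Rightarrow> complex) \<Rightarrow>
    (real \<Rightarrow> L2 \<times> L2 \<times> L2 \<Rightarrow> L2 \<times> L2 \<times> L2) \<Rightarrow> real \<Rightarrow> bool" where
  "wave_heat_perp_decay \<Omega> \<Omega>w \<Omega>h S T d \<longleftrightarrow>
     (let A = wave_heat_operator \<Omega> \<Omega>w \<Omega>h S;
          Y = kernel_perp (state_space \<Omega>w \<Omega>h) A
      in polynomial_decay Y (op_restrict A Y) T d)"

end

theory Submission
  imports Defs "HOL-Computational_Algebra.Polynomial"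
begin

text \<open>The heat part dissipates energy, and a single multiplier carries this dissipation over to the wave
part. Write \<open>e\<close>, \<open>p\<close>, \<open>h\<close> for the outer end of the wave interval, the interface, and the outer end
of the heat interval, \<open>A\<close> for the operator, and, for a state \<open>(w1, w2, h1)\<close> in its domain, \<open>g\<close> for the
weak derivative of \<open>h1\<close> and \<open>q = S g\<close> for the flux. Functions in H1 of an interval have a continuous
representative and can be integrated by parts (\<open>weak_derivative_imp_H1_rep\<close>,
\<open>H1_integration_by_parts\<close>); the transmission conditions then cancel all boundary terms in
\<open>Re \<langle>A x, x\<rangle>\<close> and leave at most \<open>- \<delta> \<parallel>g\<parallel>\<^sup>2\<close>.

Integrating by parts against the weight \<open>x - e\<close> (\<open>H1_multiplier_identity\<close>) shows that,
up to the time derivative of a bounded quadratic form, the wave energy equals the length of the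
wave interval times \<open>\<bar>w1(p)\<bar>\<^sup>2 + \<bar>w2(p)\<bar>\<^sup>2\<close>. Here \<open>w1(p) = h1(p)\<close> is controlled by \<open>\<parallel>g\<parallel>\<close>, while
\<open>w2(p) = q(p)\<close> satisfies \<open>\<bar>q(p)\<bar>\<^sup>2 \<le> C (\<parallel>q\<parallel>\<^sup>2 + \<parallel>q\<parallel> \<parallel>q'\<parallel>)\<close>. The derivative \<open>q'\<close> is the time derivative
of the heat component, so it is controlled by the dissipation along the orbit of \<open>A x\<close>. These
estimates are \<open>wave_heat_dissipation\<close>. Consequently, for \<open>x\<close> in the domain of the square of \<open>A\<close>, a
combination \<open>V\<close> of the quadratic form, \<open>\<parallel>T(t) x\<parallel>\<^sup>2\<close> and \<open>\<parallel>T(t) A x\<parallel>\<^sup>2\<close> has derivative at most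
\<open>- \<parallel>T(t) x\<parallel>\<^sup>2\<close>, and \<open>V + t \<parallel>T(t) x\<parallel>\<^sup>2\<close> decreases. This gives \<open>t \<parallel>T(t) x\<parallel>\<^sup>2 \<le> C (\<parallel>x\<parallel>\<^sup>2 + \<parallel>A x\<parallel>\<^sup>2)\<close>,
and time averages extend it to the whole domain of \<open>A\<close> (\<open>decay_on_domain\<close>). The same estimates
imply \<open>\<parallel>x\<parallel> \<le> C \<parallel>A x\<parallel>\<close>. In particular the kernel of \<open>A\<close> is zero, its orthogonal complement is the
whole state space, and the estimate can be iterated to powers of \<open>A\<close>.

Decay with rate above 2 already fails for the given coefficient. At frequencies \<open>s\<close> for
which the wave interval with \<open>w1 = 0\<close> at both ends resonates, the heat equation is solved exactly with
frequency \<open>s\<close>; its energy identity forces \<open>\<bar>h1(p)\<bar> \<le> C \<bar>q(p)\<bar> / sqrt s\<close> whenever \<open>S\<close> is bounded with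
real part bounded below (\<open>heat_mode\<close>). Gluing this solution to a resonant wave, corrected to match the small value \<open>h1(p)\<close>,
gives states with \<open>\<parallel>\<i> s x - A x\<parallel> \<le> c \<parallel>x\<parallel> / sqrt s\<close> (\<open>wave_heat_quasimodes\<close>). Up to time of order
\<open>sqrt s\<close> such a state keeps half of its norm. Its graph norm is only of order \<open>s \<parallel>x\<parallel>\<close>, so decay with
a rate above 2 would make it smaller than that when \<open>s\<close> is large (\<open>quasimodes_exclude_fast_decay\<close>).\<close>

section \<open>Complex inner products\<close>

lemma scaleC_zero_right [simp]: "scaleC c (0::'a::complex_inner) = 0"
  using scaleC_add_right[of c 0 "0::'a"] by simp

lemma scaleC_minus_right: "scaleC c (- x) = - scaleC c (x::'a::complex_inner)"
  using scaleC_add_right[of c x "-x"] by (simp add: eq_neg_iff_add_eq_0 add.commute)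

lemma scaleC_diff_right: "scaleC c (x - y) = scaleC c x - scaleC c (y::'a::complex_inner)"
  using scaleC_add_right[of c x "-y"] by (simp add: scaleC_minus_right)

lemma cinner_add_right: "cinner x (y + z) = cinner x y + cinner x (z::'a::complex_inner)"
  by (metis cinner_add_left cinner_commute complex_cnj_add)

lemma cinner_scaleC_right: "cinner x (scaleC c y) = cnj c * cinner x (y::'a::complex_inner)"
  by (metis cinner_scaleC_left cinner_commute complex_cnj_mult)

lemma cinner_diff_left: "cinner (x - y) z = cinner x z - cinner y (z::'a::complex_inner)"
  using cinner_add_left[of "x - y" y z] by (simp add: algebra_simps)

lemma cinner_diff_right: "cinner x (y - z) = cinner x y - cinner x (z::'a::complex_inner)"
  using cinner_add_right[of x "y - z" z] by (simp add: algebra_simps)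

lemma cinner_self: "cinner x x = of_real ((norm (x::'a::complex_inner))\<^sup>2)"
proof -
  have "Im (cinner x x) = 0" using cinner_commute[of x x] by (simp add: complex_eq_iff)
  then show ?thesis using inner_eq_Re_cinner[of x x]
    by (simp add: complex_eq_iff power2_norm_eq_inner)
qed

lemma norm_scaleC [simp]: "norm (scaleC c x) = cmod c * norm (x::'a::complex_inner)"
proof -
  have "of_real ((norm (scaleC c x))\<^sup>2) = (c * cnj c) * of_real ((norm x)\<^sup>2)"
    by (simp only: cinner_self[symmetric] cinner_scaleC_left cinner_scaleC_right mult.assoc mult.left_commute)
  also have "\<dots> = of_real ((cmod c * norm x)\<^sup>2)"
    by (simp only: complex_norm_square[symmetric] of_real_mult[symmetric] power_mult_distrib)
  finally have "(norm (scaleC c x))\<^sup>2 = (cmod c * norm x)\<^sup>2" unfolding of_real_eq_iff .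
  then show ?thesis by (simp add: power2_eq_iff_nonneg)
qed

text \<open>Rotating \<open>x\<close> by the phase of \<open>cinner x y\<close> makes the complex inner product real, which reduces the
  inequality to the real Cauchy-Schwarz inequality.\<close>

lemma cinner_Cauchy_Schwarz: "cmod (cinner x y) \<le> norm x * norm (y::'a::complex_inner)"
proof (cases "cinner x y = 0")
  case False
  define c where "c = cnj (cinner x y) / of_real (cmod (cinner x y))"
  have "cmod c = 1" using False by (simp add: c_def norm_divide)
  have "c * cinner x y = of_real (cmod (cinner x y))"
    using False by (simp add: c_def complex_norm_square[symmetric] mult.commute power2_eq_square)
  then have "cmod (cinner x y) = inner (scaleC c x) y"
    by (simp add: inner_eq_Re_cinner cinner_scaleC_left)
  also have "\<dots> \<le> norm (scaleC c x) * norm y" by (rule norm_cauchy_schwarz)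
  finally show ?thesis using \<open>cmod c = 1\<close> by simp
qed simp

lemma bounded_bilinear_scaleC: "bounded_bilinear (scaleC :: complex \<Rightarrow> 'a::complex_inner \<Rightarrow> 'a)"
proof
  fix a a' :: complex and b b' :: 'a and r :: real
  show "scaleC (a + a') b = scaleC a b + scaleC a' b" by (rule scaleC_add_left)
  show "scaleC a (b + b') = scaleC a b + scaleC a b'" by (rule scaleC_add_right)
  show "scaleC (scaleR r a) b = scaleR r (scaleC a b)"
    by (simp add: scaleC_scaleC scaleR_conv_of_real flip: scaleC_of_real)
  show "scaleC a (scaleR r b) = scaleR r (scaleC a b)"
    by (simp add: scaleC_scaleC mult.commute flip: scaleC_of_real)
  show "\<exists>K. \<forall>a (b::'a). norm (scaleC a b) \<le> norm a * norm b * K"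
    by (intro exI[of _ 1]) simp
qed

section \<open>Representatives of elements of L2\<close>

lemma L2_rel_refl: "L2_rel k k \<longleftrightarrow> square_integrable k"
  by (auto simp: L2_rel_def)

lemma square_integrable_rep [simp]: "square_integrable (rep_L2 f)"
  using Quotient3_rep_reflp[OF Quotient3_L2, of f] by (simp add: L2_rel_refl)

lemma rep_L2_measurable [measurable]: "rep_L2 f \<in> borel_measurable lebesgue"
  using square_integrable_rep square_integrable_def by blast

lemma rep_abs_L2: "square_integrable k \<Longrightarrow> AE x in lebesgue. rep_L2 (abs_L2 k) x = k x"
  using Quotient3_rep_abs[OF Quotient3_L2, of k] by (simp add: L2_rel_def)

lemma abs_rep_L2: "abs_L2 (rep_L2 f) = f"
  by (rule Quotient3_abs_rep[OF Quotient3_L2])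

lemma L2_eq_iff: "f = g \<longleftrightarrow> (AE x in lebesgue. rep_L2 f x = rep_L2 g x)"
  using Quotient3_rel_rep[OF Quotient3_L2, of f g] by (simp add: L2_rel_def)

lemma rep_L2_add: "AE x in lebesgue. rep_L2 (f + g) x = rep_L2 f x + rep_L2 g x"
  unfolding plus_L2_def by (simp add: rep_abs_L2 square_integrable_add)

lemma rep_L2_scaleC: "AE x in lebesgue. rep_L2 (scaleC c f) x = c * rep_L2 f x"
  unfolding scaleC_L2_def by (simp add: rep_abs_L2 square_integrable_scale)

lemma rep_L2_diff: "AE x in lebesgue. rep_L2 (f - g) x = rep_L2 f x - rep_L2 g x"
  unfolding minus_L2_def uminus_L2_def
  using rep_L2_add[of f "scaleC (-1) g"] rep_L2_scaleC[of "-1" g] by eventually_elim simp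

lemma cinner_L2_eq: "cinner f g = (LINT x|lebesgue. rep_L2 f x * cnj (rep_L2 g x))"
  by (simp add: cinner_L2_def)

lemma norm_L2_eq: "(norm f)\<^sup>2 = (LINT x|lebesgue. (cmod (rep_L2 f x))\<^sup>2)"
proof -
  have "complex_of_real ((norm f)\<^sup>2) = (LINT x|lebesgue. complex_of_real ((cmod (rep_L2 f x))\<^sup>2))"
    by (simp only: cinner_self[symmetric] cinner_L2_eq complex_norm_square)
  then show ?thesis unfolding integral_complex_of_real of_real_eq_iff .
qed

lemma norm_L2_eq_nn: "ennreal ((norm f)\<^sup>2) = (\<integral>\<^sup>+ x. ennreal ((cmod (rep_L2 f x))\<^sup>2) \<partial>lebesgue)"
  unfolding norm_L2_eq
  by (rule nn_integral_eq_integral[symmetric]) (use square_integrable_rep in \<open>auto simp: square_integrable_def\<close>)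

section \<open>Completeness of L2\<close>

lemma square_integrable_nnI:
  assumes "f \<in> borel_measurable lebesgue" "(\<integral>\<^sup>+ x. ennreal ((cmod (f x))\<^sup>2) \<partial>lebesgue) < \<infinity>"
  shows "square_integrable f"
  unfolding square_integrable_def using assms by (auto intro!: integrableI_bounded)

text \<open>The sum of the squared increments, weighted by powers of 2, has finite integral. So almost everywhere
  the increments are dominated by a geometric sequence and the representatives converge pointwise;
  Fatou's lemma turns this into convergence in norm.\<close>

lemma L2_rapid_Cauchy_convergent:
  fixes X :: "nat \<Rightarrow> L2"
  assumes X: "\<And>n m. n \<le> m \<Longrightarrow> norm (X m - X n) \<le> (1/2)^n"
  shows "convergent X"
proof -
  define f where "f = (\<lambda>n. rep_L2 (X n))"
  have [measurable]: "f n \<in> borel_measurable lebesgue" for n by (simp add: f_def)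
  have nd: "(\<integral>\<^sup>+ x. ennreal ((cmod (f m x - f n x))\<^sup>2) \<partial>lebesgue) = ennreal ((norm (X m - X n))\<^sup>2)" for m n
    unfolding norm_L2_eq_nn
    by (rule nn_integral_cong_AE) (use rep_L2_diff[of "X m" "X n"] in \<open>eventually_elim, simp add: f_def\<close>)
  define s where "s = (\<lambda>n x. ennreal (2^n * (cmod (f (Suc n) x - f n x))\<^sup>2))"
  have [measurable]: "s n \<in> borel_measurable lebesgue" for n unfolding s_def by measurable
  have "(\<integral>\<^sup>+ x. s n x \<partial>lebesgue) \<le> ennreal ((1/2)^n)" for n
  proof -
    have "(\<integral>\<^sup>+ x. s n x \<partial>lebesgue) = ennreal (2^n) * (\<integral>\<^sup>+ x. ennreal ((cmod (f (Suc n) x - f n x))\<^sup>2) \<partial>lebesgue)"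
      unfolding s_def by (subst nn_integral_cmult[symmetric]) (auto simp: ennreal_mult)
    also have "\<dots> = ennreal (2^n * (norm (X (Suc n) - X n))\<^sup>2)"
      unfolding nd by (simp add: ennreal_mult)
    also have "\<dots> \<le> ennreal (2^n * ((1/2)^n)\<^sup>2)"
      by (intro ennreal_leI mult_left_mono power_mono X) auto
    also have "(2::real)^n * ((1/2)^n)\<^sup>2 = (1/2)^n"
      by (simp add: power2_eq_square field_simps)
    finally show ?thesis .
  qed
  then have "(\<integral>\<^sup>+ x. (\<Sum>n. s n x) \<partial>lebesgue) \<le> (\<Sum>n. ennreal ((1/2)^n))"
    by (subst nn_integral_suminf) (auto intro!: suminf_le)
  also have "\<dots> = ennreal (\<Sum>n. (1/2)^n)" by (rule suminf_ennreal2) (auto intro: summable_geometric)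
  finally have "(\<integral>\<^sup>+ x. (\<Sum>n. s n x) \<partial>lebesgue) \<noteq> \<infinity>" using ennreal_less_top leD by (auto simp: top_unique)
  then have fin: "AE x in lebesgue. (\<Sum>n. s n x) \<noteq> \<infinity>" by (intro nn_integral_PInf_AE) auto
  have conv: "AE x in lebesgue. convergent (\<lambda>n. f n x)"
    using fin
  proof eventually_elim
    fix x assume fx: "(\<Sum>n. s n x) \<noteq> \<infinity>"
    then have "summable (\<lambda>n. 2^n * (cmod (f (Suc n) x - f n x))\<^sup>2)"
      unfolding s_def by (intro summable_suminf_not_top) (auto simp: top_unique)
    from summable_imp_bounded[OF this] obtain B
      where "\<forall>y\<in>range (\<lambda>n. 2^n * (cmod (f (Suc n) x - f n x))\<^sup>2). norm y \<le> B"
      unfolding bounded_iff by blast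
    then have B: "norm (2^n * (cmod (f (Suc n) x - f n x))\<^sup>2) \<le> B" for n by simp
    have "summable (\<lambda>n. f (Suc n) x - f n x)"
    proof (rule summable_comparison_test)
      show "\<exists>N. \<forall>n\<ge>N. norm (f (Suc n) x - f n x) \<le> sqrt B * (sqrt (1/2))^n"
      proof (intro exI allI impI)
        fix n
        have "(cmod (f (Suc n) x - f n x))\<^sup>2 \<le> B * (1/2)^n"
          using B[of n] by (simp add: field_simps)
        then have "cmod (f (Suc n) x - f n x) \<le> sqrt (B * (1/2)^n)" by (rule real_le_rsqrt)
        then show "norm (f (Suc n) x - f n x) \<le> sqrt B * (sqrt (1/2))^n"
          by (simp add: real_sqrt_mult real_sqrt_power)
      qed
      show "summable (\<lambda>n. sqrt B * (sqrt (1/2))^n)"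
        by (intro summable_mult summable_geometric) (simp add: real_sqrt_divide)
    qed
    then have "convergent (\<lambda>n. f n x - f 0 x)"
      by (simp add: summable_iff_convergent sum_lessThan_telescope[of "\<lambda>n. f n x"])
    from convergent_add[OF this convergent_const[of "f 0 x"]]
    show "convergent (\<lambda>n. f n x)" by simp
  qed
  define F where "F = (\<lambda>x. lim (\<lambda>n. f n x))"
  have [measurable]: "F \<in> borel_measurable lebesgue" unfolding F_def by measurable
  have close: "(\<integral>\<^sup>+ x. ennreal ((cmod (F x - f n x))\<^sup>2) \<partial>lebesgue) \<le> ennreal (((1/2)^n)\<^sup>2)" for n
  proof -
    have "(\<integral>\<^sup>+ x. ennreal ((cmod (F x - f n x))\<^sup>2) \<partial>lebesgue)
      = (\<integral>\<^sup>+ x. liminf (\<lambda>m. ennreal ((cmod (f m x - f n x))\<^sup>2)) \<partial>lebesgue)"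
    proof (rule nn_integral_cong_AE, use conv in eventually_elim)
      fix x assume "convergent (\<lambda>n. f n x)"
      then have "(\<lambda>m. f m x) \<longlonglongrightarrow> F x" by (simp add: F_def convergent_LIMSEQ_iff)
      then have "(\<lambda>m. ennreal ((cmod (f m x - f n x))\<^sup>2)) \<longlonglongrightarrow> ennreal ((cmod (F x - f n x))\<^sup>2)"
        by (intro tendsto_intros)
      then show "ennreal ((cmod (F x - f n x))\<^sup>2) = liminf (\<lambda>m. ennreal ((cmod (f m x - f n x))\<^sup>2))"
        using lim_imp_Liminf[OF sequentially_bot] by metis
    qed
    also have "\<dots> \<le> liminf (\<lambda>m. \<integral>\<^sup>+ x. ennreal ((cmod (f m x - f n x))\<^sup>2) \<partial>lebesgue)"
      by (rule nn_integral_liminf) measurable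
    also have "\<dots> \<le> liminf (\<lambda>m. ennreal (((1/2)^n)\<^sup>2))"
    proof (rule Liminf_mono)
      show "\<forall>\<^sub>F m in sequentially. (\<integral>\<^sup>+ x. ennreal ((cmod (f m x - f n x))\<^sup>2) \<partial>lebesgue) \<le> ennreal (((1/2)^n)\<^sup>2)"
        using eventually_ge_at_top[of n] unfolding nd
        by eventually_elim (intro ennreal_leI power_mono X, auto)
    qed
    also have "\<dots> = ennreal (((1/2)^n)\<^sup>2)" by (simp add: Liminf_const)
    finally show ?thesis .
  qed
  have "square_integrable (\<lambda>x. F x - f 0 x)"
    by (rule square_integrable_nnI) (use close[of 0] in \<open>auto intro: le_less_trans\<close>)
  from square_integrable_add[OF this square_integrable_rep[of "X 0"]]
  have F: "square_integrable F" by (simp add: f_def)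
  have "norm (abs_L2 F - X n) \<le> (1/2)^n" for n
  proof -
    have "ennreal ((norm (abs_L2 F - X n))\<^sup>2) = (\<integral>\<^sup>+ x. ennreal ((cmod (F x - f n x))\<^sup>2) \<partial>lebesgue)"
      unfolding norm_L2_eq_nn
      by (rule nn_integral_cong_AE)
        (use rep_L2_diff[of "abs_L2 F" "X n"] rep_abs_L2[OF F] in \<open>eventually_elim, simp add: f_def\<close>)
    also have "\<dots> \<le> ennreal (((1/2)^n)\<^sup>2)" by (rule close)
    finally have "(norm (abs_L2 F - X n))\<^sup>2 \<le> ((1/2)^n)\<^sup>2" by (simp add: ennreal_le_iff)
    then show ?thesis by (rule power2_le_imp_le) simp
  qed
  then have bd: "norm (X n - abs_L2 F) \<le> (1/2)^n" for n by (simp only: norm_minus_commute[of _ "abs_L2 F"])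
  have lim: "(\<lambda>n. (1/2::real)^n) \<longlonglongrightarrow> 0" by (intro LIMSEQ_power_zero) simp
  have "(\<lambda>n. X n - abs_L2 F) \<longlonglongrightarrow> 0"
    by (rule Lim_null_comparison[OF always_eventually lim]) (use bd in blast)
  then have "X \<longlonglongrightarrow> abs_L2 F" by (rule LIM_zero_cancel)
  then show ?thesis by (rule convergentI)
qed

instance L2 :: banach
proof
  fix X :: "nat \<Rightarrow> L2" assume X: "Cauchy X"
  have "\<forall>k. \<exists>N. \<forall>m\<ge>N. \<forall>n\<ge>N. norm (X m - X n) < (1/2)^k"
    using CauchyD[OF X] by simp
  then obtain N where N: "\<And>k m n. N k \<le> m \<Longrightarrow> N k \<le> n \<Longrightarrow> norm (X m - X n) < (1/2)^k" by metis
  \<comment> \<open>The summand \<open>k\<close> makes the subsequence strictly increasing even where \<open>N\<close> vanishes.\<close>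
  define r where "r = (\<lambda>k. k + (\<Sum>i\<le>k. N i))"
  have "strict_mono r" by (rule strict_monoI_Suc) (simp add: r_def)
  have rN: "N k \<le> r k" for k unfolding r_def by (simp add: trans_le_add2 member_le_sum)
  have "convergent (X \<circ> r)"
  proof (rule L2_rapid_Cauchy_convergent)
    fix n m :: nat assume "n \<le> m"
    then have "r n \<le> r m" using strict_mono_less_eq[OF \<open>strict_mono r\<close>] by simp
    then show "norm ((X \<circ> r) m - (X \<circ> r) n) \<le> (1/2)^n"
      using N[of n "r m" "r n"] rN[of n] by simp
  qed
  then obtain L where "(X \<circ> r) \<longlonglongrightarrow> L" by (auto simp: convergent_def)
  from Cauchy_converges_subseq[OF X \<open>strict_mono r\<close> this]
  show "convergent X" by (rule convergentI)
qed

section \<open>Multiplication by bounded functions\<close>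

text \<open>Meaningful when the product is square integrable, in particular for bounded measurable \<open>m\<close>.\<close>

definition mult_L2 :: "(real \<Rightarrow> complex) \<Rightarrow> L2 \<Rightarrow> L2" where
  "mult_L2 m f = abs_L2 (\<lambda>x. m x * rep_L2 f x)"

definition bounded_multiplier :: "(real \<Rightarrow> complex) \<Rightarrow> real \<Rightarrow> bool" where
  "bounded_multiplier m B \<longleftrightarrow> m \<in> borel_measurable lebesgue \<and> (\<forall>x. cmod (m x) \<le> B)"

lemma square_integrable_bounded_mult:
  assumes "bounded_multiplier m B" "square_integrable f"
  shows "square_integrable (\<lambda>x. m x * f x)"
proof -
  have [measurable]: "m \<in> borel_measurable lebesgue" "f \<in> borel_measurable lebesgue"
    using assms by (auto simp: bounded_multiplier_def square_integrable_def)
  have B: "cmod (m x) \<le> B" for x using assms by (auto simp: bounded_multiplier_def)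
  have "integrable lebesgue (\<lambda>x. (cmod (m x * f x))\<^sup>2)"
  proof (rule Bochner_Integration.integrable_bound)
    show "integrable lebesgue (\<lambda>x. B\<^sup>2 * (cmod (f x))\<^sup>2)"
      using assms by (auto simp: square_integrable_def)
    show "AE x in lebesgue. norm ((cmod (m x * f x))\<^sup>2) \<le> norm (B\<^sup>2 * (cmod (f x))\<^sup>2)"
      by (intro AE_I2) (auto simp: norm_mult power_mult_distrib intro!: mult_right_mono power_mono B)
  qed simp
  then show ?thesis by (simp add: square_integrable_def)
qed

lemma rep_mult_L2:
  assumes "bounded_multiplier m B"
  shows "AE x in lebesgue. rep_L2 (mult_L2 m f) x = m x * rep_L2 f x"
  unfolding mult_L2_def by (rule rep_abs_L2[OF square_integrable_bounded_mult[OF assms square_integrable_rep]])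

lemma norm_mult_L2_le:
  assumes m: "bounded_multiplier m B"
  shows "norm (mult_L2 m f) \<le> B * norm f"
proof -
  have B: "cmod (m x) \<le> B" for x using m by (auto simp: bounded_multiplier_def)
  have "0 \<le> B" using B[of 0] norm_ge_zero order_trans by blast
  have "(norm (mult_L2 m f))\<^sup>2 \<le> (LINT x|lebesgue. B\<^sup>2 * (cmod (rep_L2 f x))\<^sup>2)"
    unfolding norm_L2_eq
  proof (rule integral_mono_AE)
    show "AE x in lebesgue. (cmod (rep_L2 (mult_L2 m f) x))\<^sup>2 \<le> B\<^sup>2 * (cmod (rep_L2 f x))\<^sup>2"
      using rep_mult_L2[OF m, of f]
      by eventually_elim (auto simp: norm_mult power_mult_distrib intro!: mult_right_mono power_mono B)
  qed (use square_integrable_rep in \<open>auto simp: square_integrable_def\<close>)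
  also have "\<dots> = (B * norm f)\<^sup>2" by (simp add: norm_L2_eq power_mult_distrib)
  finally show ?thesis by (rule power2_le_imp_le) (use \<open>0 \<le> B\<close> in simp)
qed

lemma bounded_linear_mult_L2:
  assumes m: "bounded_multiplier m B"
  shows "bounded_linear (mult_L2 m)"
proof (rule bounded_linear_intro[where K=B])
  fix f g :: L2 and r :: real
  show "mult_L2 m (f + g) = mult_L2 m f + mult_L2 m g"
    unfolding L2_eq_iff
    using rep_mult_L2[OF m, of "f + g"] rep_mult_L2[OF m, of f] rep_mult_L2[OF m, of g]
      rep_L2_add[of f g] rep_L2_add[of "mult_L2 m f" "mult_L2 m g"]
    by eventually_elim (simp add: distrib_left)
  show "mult_L2 m (scaleR r f) = scaleR r (mult_L2 m f)"
    unfolding L2_eq_iff scaleR_L2_def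
    using rep_mult_L2[OF m, of "scaleC (of_real r) f"] rep_mult_L2[OF m, of f]
      rep_L2_scaleC[of "of_real r" f] rep_L2_scaleC[of "of_real r" "mult_L2 m f"]
    by eventually_elim simp
  show "norm (mult_L2 m f) \<le> norm f * B" using norm_mult_L2_le[OF m, of f] by (simp add: mult.commute)
qed

lemma cinner_mult_L2:
  assumes m: "bounded_multiplier m B"
  shows "cinner (mult_L2 m f) g = (LINT x|lebesgue. m x * rep_L2 f x * cnj (rep_L2 g x))"
  unfolding cinner_L2_eq
proof (rule integral_cong_AE)
  have cm: "cnj \<in> borel_measurable borel" by (intro borel_measurable_continuous_onI continuous_intros)
  note [measurable] = cm
  have [measurable]: "m \<in> borel_measurable lebesgue" using m by (simp add: bounded_multiplier_def)
  show "(\<lambda>x. rep_L2 (mult_L2 m f) x * cnj (rep_L2 g x)) \<in> borel_measurable lebesgue"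
    "(\<lambda>x. m x * rep_L2 f x * cnj (rep_L2 g x)) \<in> borel_measurable lebesgue" by measurable
  show "AE x in lebesgue. rep_L2 (mult_L2 m f) x * cnj (rep_L2 g x) = m x * rep_L2 f x * cnj (rep_L2 g x)"
    using rep_mult_L2[OF m, of f] by eventually_elim simp
qed

lemma bounded_multiplier_indicator: "U \<in> sets lebesgue \<Longrightarrow> bounded_multiplier (indicator U) 1"
  by (auto simp: bounded_multiplier_def indicator_def)

text \<open>Multiplication by the indicator function is the projection onto the subspace of functions supported
  in \<open>U\<close>.\<close>

lemma L2_on_iff:
  assumes U: "U \<in> sets lebesgue"
  shows "f \<in> L2_on U \<longleftrightarrow> mult_L2 (indicator U) f = f"
proof -
  note r = rep_mult_L2[OF bounded_multiplier_indicator[OF U], of f]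
  show ?thesis unfolding L2_on_def mem_Collect_eq L2_eq_iff
  proof
    assume "AE x in lebesgue. x \<notin> U \<longrightarrow> rep_L2 f x = 0"
    then show "AE x in lebesgue. rep_L2 (mult_L2 (indicator U) f) x = rep_L2 f x"
      using r by eventually_elim (auto simp: indicator_def)
  next
    assume "AE x in lebesgue. rep_L2 (mult_L2 (indicator U) f) x = rep_L2 f x"
    then show "AE x in lebesgue. x \<notin> U \<longrightarrow> rep_L2 f x = 0"
      using r by eventually_elim (auto simp: indicator_def)
  qed
qed

lemma mult_indicator_in_L2_on:
  assumes U: "U \<in> sets lebesgue"
  shows "mult_L2 (indicator U) f \<in> L2_on U"
  unfolding L2_on_def using rep_mult_L2[OF bounded_multiplier_indicator[OF U], of f] by auto

section \<open>Smooth bump functions\<close>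

definition smooth :: "(real \<Rightarrow> real) \<Rightarrow> bool" where
  "smooth f \<longleftrightarrow> (\<forall>n. (deriv ^^ n) f differentiable_on UNIV)"

text \<open>Smoothness is coinductive: a function is smooth as soon as it lies in some class of functions that is
  closed under differentiation.\<close>

lemma smooth_coinduct:
  assumes "f \<in> F" "\<And>g. g \<in> F \<Longrightarrow> \<exists>g'\<in>F. \<forall>x. (g has_real_derivative g' x) (at x)"
  shows "smooth f"
proof -
  have d: "deriv g \<in> F \<and> g differentiable_on UNIV" if g: "g \<in> F" for g
  proof -
    obtain g' where g': "g' \<in> F" "\<forall>x. (g has_real_derivative g' x) (at x)" using assms(2)[OF g] by blast
    have "deriv g = g'" using g'(2) by (auto intro: DERIV_imp_deriv)
    then show ?thesis using g'
      by (auto simp: differentiable_on_def real_differentiable_def)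
  qed
  have "(deriv ^^ n) f \<in> F" for n
    by (induction n) (use assms(1) d in auto)
  then show ?thesis using d by (auto simp: smooth_def)
qed

lemma smooth_deriv:
  assumes "smooth f"
  shows "smooth (deriv f)" "(f has_real_derivative deriv f x) (at x)"
proof -
  have "(deriv ^^ n) (deriv f) = (deriv ^^ (Suc n)) f" for n
    by (simp add: funpow_swap1)
  then show "smooth (deriv f)" using assms unfolding smooth_def by metis
  have "f differentiable_on UNIV" using assms[unfolded smooth_def, rule_format, of 0] by simp
  then have "f differentiable at x" by (auto simp: differentiable_on_def)
  then show "(f has_real_derivative deriv f x) (at x)"
    using DERIV_deriv_iff_real_differentiable by blast
qed

lemma smooth_continuous: "smooth f \<Longrightarrow> continuous_on A f"
  using smooth_deriv(2) DERIV_isCont continuous_at_imp_continuous_on by blast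

lemma smooth_antiderivative:
  assumes "\<And>x. (f has_real_derivative g x) (at x)" "smooth g"
  shows "smooth f"
proof (rule smooth_coinduct[of _ "insert f (Collect smooth)"])
  fix h assume "h \<in> insert f (Collect smooth)"
  then consider "h = f" | "smooth h" by blast
  then show "\<exists>h'\<in>insert f (Collect smooth). \<forall>x. (h has_real_derivative h' x) (at x)"
    by cases (use assms smooth_deriv[of h] in blast)+
qed simp

lemma smooth_affine:
  assumes "smooth f"
  shows "smooth (\<lambda>x. c * f (a * x + b))"
proof (rule smooth_coinduct[of _ "{\<lambda>x. c * f (a * x + b) | f c. smooth f}"])
  fix g assume "g \<in> {\<lambda>x. c * f (a * x + b) | f c. smooth f}"
  then obtain f c where f: "smooth f" and g: "g = (\<lambda>x. c * f (a * x + b))" by blast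
  have "((\<lambda>x. f (a * x + b)) has_real_derivative deriv f (a * x + b) * a) (at x)" for x
    by (rule DERIV_chain2[OF smooth_deriv(2)[OF f]]) (auto intro!: derivative_eq_intros)
  then have "(g has_real_derivative (c * a) * deriv f (a * x + b)) (at x)" for x
    unfolding g using DERIV_cmult[of _ _ x UNIV c] by (metis mult.assoc mult.commute)
  moreover have "(\<lambda>x. (c * a) * deriv f (a * x + b)) \<in> {\<lambda>x. c * f (a * x + b) | f c. smooth f}"
    using smooth_deriv(1)[OF f] by blast
  ultimately show "\<exists>g'\<in>{\<lambda>x. c * f (a * x + b) | f c. smooth f}. \<forall>x. (g has_real_derivative g' x) (at x)"
    by (intro bexI[of _ "\<lambda>x. (c * a) * deriv f (a * x + b)"] allI)
qed (use assms in blast)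

text \<open>The products of two smooth functions are not closed under differentiation, but by the Leibniz rule
  their finite sums are; this is the class to which \<open>smooth_coinduct\<close> is applied.\<close>

inductive_set smooth_products :: "(real \<Rightarrow> real) set" where
  prod: "smooth f \<Longrightarrow> smooth g \<Longrightarrow> (\<lambda>x. f x * g x) \<in> smooth_products"
| sum: "u \<in> smooth_products \<Longrightarrow> v \<in> smooth_products \<Longrightarrow> (\<lambda>x. u x + v x) \<in> smooth_products"

lemma smooth_productsD:
  assumes "u \<in> smooth_products" shows "smooth u"
proof (rule smooth_coinduct[OF assms])
  fix g assume "g \<in> smooth_products"
  then show "\<exists>g'\<in>smooth_products. \<forall>x. (g has_real_derivative g' x) (at x)"
  proof induction
    case (prod f g)
    have "((\<lambda>x. f x * g x) has_real_derivative (deriv f x * g x + f x * deriv g x)) (at x)" for x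
      using DERIV_mult[OF smooth_deriv(2)[OF prod(1)] smooth_deriv(2)[OF prod(2)]]
      by (simp add: add.commute mult.commute)
    moreover have "(\<lambda>x. deriv f x * g x + f x * deriv g x) \<in> smooth_products"
      by (intro smooth_products.intros smooth_deriv prod)
    ultimately show ?case by (intro bexI) auto
  next
    case (sum u v)
    then obtain u' v' where "u' \<in> smooth_products" "v' \<in> smooth_products"
      "\<forall>x. (u has_real_derivative u' x) (at x)" "\<forall>x. (v has_real_derivative v' x) (at x)" by blast
    then show ?case
      by (intro bexI[of _ "\<lambda>x. u' x + v' x"]) (auto intro!: DERIV_add smooth_products.intros)
  qed
qed

lemma smooth_const: "smooth (\<lambda>x. c)"
  by (rule smooth_coinduct[of _ "range (\<lambda>c x. c)"]) (auto intro!: derivative_eq_intros)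

lemma smooth_mult: "smooth f \<Longrightarrow> smooth g \<Longrightarrow> smooth (\<lambda>x. f x * g x)"
  by (rule smooth_productsD[OF smooth_products.prod])

lemma smooth_diff: "smooth f \<Longrightarrow> smooth g \<Longrightarrow> smooth (\<lambda>x. f x - c * g x)"
  using smooth_productsD[OF smooth_products.sum[OF smooth_products.prod[of f "\<lambda>x. 1"]
     smooth_products.prod[of g "\<lambda>x. - c"]]] smooth_const by (simp add: mult.commute)

text \<open>The classical functions \<open>P(1/x) exp(-1/x)\<close>, extended by zero to the left. Including all polynomials
  \<open>P\<close> makes the class closed under differentiation.\<close>

definition flat :: "real poly \<Rightarrow> real \<Rightarrow> real" where
  "flat p x = (if x > 0 then poly p (1 / x) * exp (- 1 / x) else 0)"

lemma poly_div_exp_tendsto_0: "((\<lambda>y. poly p y / exp y) \<longlongrightarrow> (0::real)) at_top"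
proof -
  have "((\<lambda>y. \<Sum>i\<le>degree p. coeff p i * (y ^ i / exp y)) \<longlongrightarrow> (\<Sum>i\<le>degree p. coeff p i * 0)) at_top"
    by (intro tendsto_intros tendsto_power_div_exp_0)
  then show ?thesis by (simp add: poly_altdef sum_divide_distrib)
qed

text \<open>Away from zero this is the product rule. At zero the difference quotient is again of the form
  \<open>P(y) / exp y\<close> with \<open>y = 1/x\<close>, which tends to zero.\<close>

lemma flat_deriv:
  "(flat p has_real_derivative flat ([:0, 0, 1:] * (p - pderiv p)) x) (at x)"
proof (cases x "0::real" rule: linorder_cases)
  case less
  have "((\<lambda>x. 0) has_real_derivative 0) (at x)" by simp
  then have "(flat p has_real_derivative 0) (at x)"
    by (rule has_field_derivative_transform_within_open[where S="{..<0}"]) (use less in \<open>auto simp: flat_def\<close>)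
  then show ?thesis using less by (simp add: flat_def)
next
  case greater
  have "((\<lambda>x. poly p (1 / x) * exp (- 1 / x)) has_real_derivative
      poly ([:0, 0, 1:] * (p - pderiv p)) (1/x) * exp (- 1 / x)) (at x)"
    using greater
    by (auto intro!: derivative_eq_intros DERIV_chain2[OF poly_DERIV]
      simp: field_simps power2_eq_square)
  then have "(flat p has_real_derivative poly ([:0, 0, 1:] * (p - pderiv p)) (1/x) * exp (- 1 / x)) (at x)"
    by (rule has_field_derivative_transform_within_open[where S="{0<..}"]) (use greater in \<open>auto simp: flat_def\<close>)
  then show ?thesis using greater by (simp add: flat_def)
next
  case equal
  have "((\<lambda>h. (flat p h - flat p 0) / (h - 0)) \<longlongrightarrow> 0) (at 0)"
  proof (rule filterlim_split_at)
    have "((\<lambda>h. poly ([:0,1:] * p) (inverse h) / exp (inverse h)) \<longlongrightarrow> 0) (at_right (0::real))"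
      by (rule filterlim_compose[OF poly_div_exp_tendsto_0 filterlim_inverse_at_top_right])
    then show "((\<lambda>h. (flat p h - flat p 0) / (h - 0)) \<longlongrightarrow> 0) (at_right 0)"
      by (rule Lim_transform_eventually)
        (auto simp: eventually_at_right_field flat_def exp_minus field_simps intro!: exI[of _ 1])
    show "((\<lambda>h. (flat p h - flat p 0) / (h - 0)) \<longlongrightarrow> 0) (at_left 0)"
      by (rule Lim_transform_eventually[OF tendsto_const])
        (auto simp: eventually_at_left_field flat_def intro!: exI[of _ "-1"])
  qed
  then have "(flat p has_real_derivative 0) (at 0)"
    by (simp add: has_field_derivative_iff)
  then show ?thesis using equal by (simp add: flat_def)
qed

lemma smooth_flat: "smooth (flat p)"
  by (rule smooth_coinduct[of _ "range flat"]) (use flat_deriv in blast)+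

abbreviation step :: "real \<Rightarrow> real" where "step \<equiv> flat 1"

lemma step_bounds: "0 \<le> step x" "step x \<le> 1"
  by (auto simp: flat_def)

lemma step_tendsto_1: "(step \<longlongrightarrow> 1) at_top"
proof -
  have "((\<lambda>x::real. exp (- inverse x)) \<longlongrightarrow> exp (- 0)) at_top"
    by (intro tendsto_intros tendsto_inverse_0_at_top filterlim_ident)
  then have "((\<lambda>x::real. exp (- 1 / x)) \<longlongrightarrow> 1) at_top" by (simp add: inverse_eq_divide)
  then show ?thesis
    by (rule Lim_transform_eventually) (auto simp: flat_def eventually_at_top_linorder intro!: exI[of _ 1])
qed

text \<open>Both factors tend to 1 inside \<open>(c, d)\<close> because \<open>exp(-1/y)\<close> tends to 1 as \<open>y\<close> tends to infinity. The
  shift by 1 moves the support away from the end points by \<open>1/n\<close>, so that each bump is a test function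
  on \<open>(c, d)\<close> although the limit is the indicator function of this interval.\<close>

definition bump :: "real \<Rightarrow> real \<Rightarrow> nat \<Rightarrow> real \<Rightarrow> real" where
  "bump c d n x = step (real n * (x - c) - 1) * step (real n * (d - x) - 1)"

lemma smooth_bump: "smooth (bump c d n)"
proof -
  have "smooth (\<lambda>x. (1 * step (real n * x + (- real n * c - 1))) * (1 * step ((- real n) * x + (real n * d - 1))))"
    by (intro smooth_mult smooth_affine smooth_flat)
  moreover have "real n * x + (- real n * c - 1) = real n * (x - c) - 1"
    "(- real n) * x + (real n * d - 1) = real n * (d - x) - 1" for x
    by (simp_all add: algebra_simps)
  ultimately show ?thesis unfolding bump_def[abs_def] by (simp only: mult_1)
qed

lemma bump_bounds: "0 \<le> bump c d n x" "bump c d n x \<le> 1"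
  unfolding bump_def by (intro mult_nonneg_nonneg mult_le_one step_bounds)+

lemma bump_support: "bump c d n x \<noteq> 0 \<Longrightarrow> 0 < n \<and> c + 1 / real n \<le> x \<and> x \<le> d - 1 / real n"
proof -
  assume "bump c d n x \<noteq> 0"
  then have "step (real n * (x - c) - 1) \<noteq> 0" "step (real n * (d - x) - 1) \<noteq> 0"
    unfolding bump_def by (metis mult_zero_left, metis mult_zero_right)
  then have *: "real n * (x - c) > 1" "real n * (d - x) > 1"
    by (metis flat_def diff_gt_0_iff_gt)+
  then have "n > 0" by (cases n) auto
  with * have "1 / real n < x - c" "1 / real n < d - x"
    by (simp_all add: divide_less_eq mult.commute)
  with \<open>n > 0\<close> show ?thesis by linarith
qed

lemma bump_tendsto: "(\<lambda>n. bump c d n x) \<longlonglongrightarrow> indicator {c<..<d} x"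
proof (cases "x \<in> {c<..<d}")
  case True
  have *: "(\<lambda>n. step (real n * y - 1)) \<longlonglongrightarrow> 1" if "y > 0" for y
  proof (rule filterlim_compose[OF step_tendsto_1])
    have "filterlim (\<lambda>n. -1 + real n * y) at_top sequentially"
      by (intro filterlim_tendsto_add_at_top[OF tendsto_const]
        filterlim_at_top_mult_tendsto_pos[OF tendsto_const that] filterlim_real_sequentially)
    then show "filterlim (\<lambda>n. real n * y - 1) at_top sequentially" by simp
  qed
  have "(\<lambda>n. bump c d n x) \<longlonglongrightarrow> 1 * 1"
    unfolding bump_def using True by (intro tendsto_mult *) auto
  then show ?thesis using True by simp
next
  case False
  have "bump c d n x = 0" for n
  proof (rule ccontr)
    assume "bump c d n x \<noteq> 0"
    from bump_support[OF this] have "0 < 1 / real n" "c + 1 / real n \<le> x" "x \<le> d - 1 / real n" by auto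
    with False show False by simp
  qed
  then show ?thesis using False by simp
qed

lemma test_functionI:
  assumes "smooth f" "\<And>x. f x \<noteq> 0 \<Longrightarrow> x \<in> {c..d}" "{c..d} \<subseteq> U"
  shows "test_function U f"
proof -
  have "closure {x. f x \<noteq> 0} \<subseteq> {c..d}"
    by (rule closure_minimal) (use assms(2) in auto)
  moreover from this have "bounded (closure {x. f x \<noteq> 0})"
    using bounded_subset[OF bounded_closed_interval] by blast
  ultimately show ?thesis
    using assms by (auto simp: test_function_def smooth_def compact_eq_bounded_closed)
qed

lemma test_function_bump: "test_function {c<..<d} (bump c d n)"
proof (cases "n = 0")
  case True
  then have "bump c d n x = 0" for x using bump_support by auto
  then show ?thesis by (intro test_functionI[of _ 1 0] smooth_bump) auto
next
  case False
  then have "c + 1 / real n > c" "d - 1 / real n < d" by simp_all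
  then have "{c + 1 / real n..d - 1 / real n} \<subseteq> {c<..<d}"
    by (intro subsetI) (simp only: atLeastAtMost_iff greaterThanLessThan_iff, linarith)
  then show ?thesis
    by (intro test_functionI[of _ "c + 1 / real n" "d - 1 / real n"] smooth_bump)
      (use bump_support[of c d n] in auto)
qed

lemma test_function_mono: "test_function U f \<Longrightarrow> U \<subseteq> V \<Longrightarrow> test_function V f"
  by (auto simp: test_function_def)

section \<open>The du Bois-Reymond lemma\<close>

lemma integrable_mult_bounded:
  fixes f g :: "'a \<Rightarrow> complex"
  assumes "integrable M f" "g \<in> borel_measurable M" "\<And>x. x \<in> space M \<Longrightarrow> cmod (g x) \<le> B"
  shows "integrable M (\<lambda>x. f x * g x)"
proof (rule Bochner_Integration.integrable_bound)
  show "integrable M (\<lambda>x. B * cmod (f x))" using assms(1) by simp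
  show "(\<lambda>x. f x * g x) \<in> borel_measurable M"
    using assms(1,2) by (intro borel_measurable_times) auto
  show "AE x in M. cmod (f x * g x) \<le> norm (B * cmod (f x))"
  proof (intro AE_I2)
    fix x assume "x \<in> space M"
    with assms(3) have "cmod (g x) * cmod (f x) \<le> B * cmod (f x)" by (intro mult_right_mono) auto
    then show "cmod (f x * g x) \<le> norm (B * cmod (f x))" by (simp add: norm_mult mult.commute)
  qed
qed

lemma set_integrable_mult_continuous:
  fixes f g :: "real \<Rightarrow> complex"
  assumes f: "set_integrable lebesgue U f" and U: "U \<in> sets lebesgue" "U \<subseteq> {l..r}"
    and g: "continuous_on {l..r} g"
  shows "set_integrable lebesgue U (\<lambda>x. f x * g x)"
proof -
  obtain B where B: "\<And>x. x \<in> {l..r} \<Longrightarrow> cmod (g x) \<le> B"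
    using compact_imp_bounded[OF compact_continuous_image[OF g compact_Icc]] unfolding bounded_iff
    by (meson image_eqI)
  define g' where "g' = (\<lambda>x. indicator {l..r} x *\<^sub>R g x)"
  have "g' \<in> borel_measurable borel"
    unfolding g'_def by (rule borel_measurable_continuous_on_indicator) (use g in auto)
  then have "g' \<in> borel_measurable lebesgue" by (simp add: measurable_completion)
  moreover have "cmod (g' x) \<le> max 0 B" for x
    using B[of x] by (auto simp: g'_def indicator_def)
  ultimately have "integrable lebesgue (\<lambda>x. (indicator U x *\<^sub>R f x) * g' x)"
    using f unfolding set_integrable_def by (intro integrable_mult_bounded[where B="max 0 B"])
  moreover have "(indicator U x *\<^sub>R f x) * g' x = indicator U x *\<^sub>R (f x * g x)" for x
    using U by (auto simp: g'_def indicator_def)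
  ultimately show ?thesis by (simp only: set_integrable_def)
qed

lemma sigma_finite_lebesgue: "sigma_finite_measure (lebesgue :: real measure)"
proof
  show "\<exists>A::real set set. countable A \<and> A \<subseteq> sets lebesgue \<and> \<Union> A = space lebesgue \<and> (\<forall>a\<in>A. emeasure lebesgue a \<noteq> \<infinity>)"
  proof (intro exI conjI)
    show "\<Union> (range (\<lambda>n::nat. {-real n..real n})) = space lebesgue"
    proof -
      have "\<exists>n::nat. x \<in> {-real n..real n}" for x
        using real_arch_simple[of "\<bar>x\<bar>"] unfolding atLeastAtMost_iff abs_le_iff by (metis minus_le_iff)
      then show ?thesis by auto
    qed
  qed auto
qed

text \<open>Open intervals form an intersection-stable generator of the Borel sets, and a Lebesgue set differs
  from a Borel set by a null set; so all set integrals vanish.\<close>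

lemma integral_zero_on_intervals_imp_AE_zero:
  fixes w :: "real \<Rightarrow> complex"
  assumes w: "integrable lebesgue w" and w0: "integral\<^sup>L lebesgue w = 0"
    and I: "\<And>c d. (LINT x:{c<..<d}|lebesgue. w x) = 0"
  shows "AE x in lebesgue. w x = 0"
proof (rule sigma_finite_measure.density_zero[OF sigma_finite_lebesgue w])
  have sub: "set_integrable lebesgue A w" if "A \<in> sets lebesgue" for A
    using integrable_mult_indicator[OF that w] by (simp add: set_integrable_def)
  have borel: "(LINT x:A|lebesgue. w x) = 0" if "A \<in> sets borel" for A
  proof -
    let ?G = "range (\<lambda>(a, b). {a<..<b::real})"
    have sig: "sigma_sets UNIV ?G = sets borel" by (subst borel_eq_box) (simp add: box_real[abs_def])
    have leb: "A \<in> sets lebesgue" if "A \<in> sigma_sets UNIV ?G" for A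
      using that unfolding sig by simp
    have "Int_stable ?G" by (auto simp: Int_stable_def)
    moreover have "?G \<subseteq> Pow UNIV" by simp
    moreover have "A \<in> sigma_sets UNIV ?G" using that sig by simp
    ultimately show ?thesis
    proof (induction rule: sigma_sets_induct_disjoint)
      case (basic A) then show ?case using I by auto
    next
      case empty then show ?case by (simp add: set_lebesgue_integral_def)
    next
      case (compl A)
      have "(LINT x:UNIV|lebesgue. w x) = (LINT x:A|lebesgue. w x) + (LINT x:UNIV - A|lebesgue. w x)"
        using set_integral_Un[of A "UNIV - A" lebesgue w] leb[OF compl(1)] sub by (simp add: Compl_in_sets_lebesgue flip: Compl_eq_Diff_UNIV)
      then show ?case using w0 compl by (simp add: set_lebesgue_integral_def)
    next
      case (union A)
      then have A: "A i \<in> sets lebesgue" for i using leb by blast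
      have "(LINT x:(\<Union>i. A i)|lebesgue. w x) = (\<Sum>i. (LINT x:(A i)|lebesgue. w x))"
        using union(1) A by (intro lebesgue_integral_countable_add sub) (auto simp: disjoint_family_on_def)
      then show ?case using union by simp
    qed
  qed
  fix A :: "real set" assume "A \<in> sets lebesgue"
  then obtain S N N' where S: "A = S \<union> N" "N \<subseteq> N'" "N' \<in> null_sets lborel" "S \<in> sets lborel"
    by (rule sets_completionE)
  have N: "AE x in lebesgue. x \<notin> N'" using S(3) by (intro AE_not_in null_sets_completionI)
  have "(LINT x:A|lebesgue. w x) = (LINT x:S|lebesgue. w x)"
    unfolding set_lebesgue_integral_def
  proof (rule integral_cong_AE)
    show "(\<lambda>x. indicat_real A x *\<^sub>R w x) \<in> borel_measurable lebesgue"
      "(\<lambda>x. indicat_real S x *\<^sub>R w x) \<in> borel_measurable lebesgue"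
      using sub[of A] sub[of S] S(4) \<open>A \<in> sets lebesgue\<close> unfolding set_integrable_def by auto
    show "AE x in lebesgue. indicat_real A x *\<^sub>R w x = indicat_real S x *\<^sub>R w x"
      using N S(1,2) by (elim eventually_mono) (auto simp: indicator_def)
  qed
  then show "(LINT x:A|lebesgue. w x) = 0" using borel S(4) by simp
qed

text \<open>The bumps converge boundedly to indicator functions of intervals, so \<open>v\<close> has vanishing integral over
  every interval.\<close>

lemma fundamental_lemma_variations:
  fixes v :: "real \<Rightarrow> complex"
  assumes v: "set_integrable lebesgue {l<..<r} v"
    and test: "\<And>\<phi>. test_function {l<..<r} \<phi> \<Longrightarrow> (LINT x:{l<..<r}|lebesgue. v x * complex_of_real (\<phi> x)) = 0"
  shows "AE x in lebesgue. x \<in> {l<..<r} \<longrightarrow> v x = 0"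
proof -
  define w where "w = (\<lambda>x. indicator {l<..<r} x *\<^sub>R v x)"
  have w: "integrable lebesgue w" using v by (simp add: w_def set_integrable_def)
  have I: "(LINT x:{c<..<d}|lebesgue. w x) = 0" for c d
  proof -
    define c' d' where "c' = max c l" and "d' = min d r"
    have b_meas: "(\<lambda>x. complex_of_real (bump c' d' n x)) \<in> borel_measurable lebesgue" for n
    proof -
      have "(\<lambda>x. complex_of_real (bump c' d' n x)) \<in> borel_measurable borel"
        by (intro borel_measurable_continuous_onI continuous_on_of_real smooth_continuous smooth_bump)
      then show ?thesis by (simp add: measurable_completion)
    qed
    have "(\<lambda>n. LINT x|lebesgue. w x * complex_of_real (bump c' d' n x)) \<longlonglongrightarrow>
        (LINT x|lebesgue. w x * complex_of_real (indicator {c'<..<d'} x))"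
    proof (rule integral_dominated_convergence[where w = "\<lambda>x. cmod (w x)"])
      show "AE x in lebesgue. (\<lambda>n. w x * complex_of_real (bump c' d' n x))
          \<longlonglongrightarrow> w x * complex_of_real (indicator {c'<..<d'} x)"
        by (intro AE_I2 tendsto_intros bump_tendsto)
      show "AE x in lebesgue. cmod (w x * complex_of_real (bump c' d' n x)) \<le> cmod (w x)" for n
        using bump_bounds by (intro AE_I2) (simp add: norm_mult mult_left_le)
      show "(\<lambda>x. w x * complex_of_real (bump c' d' n x)) \<in> borel_measurable lebesgue" for n
        using w b_meas by (intro borel_measurable_times) auto
      show "(\<lambda>x. w x * complex_of_real (indicator {c'<..<d'} x)) \<in> borel_measurable lebesgue"
      proof -
        have eq: "(\<lambda>x. w x * complex_of_real (indicat_real {c'<..<d'} x)) = (\<lambda>x. w x * indicator {c'<..<d'} x)"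
          by (auto simp: indicator_def)
        show ?thesis unfolding eq
          by (intro borel_measurable_times borel_measurable_integrable[OF w] borel_measurable_indicator) simp
      qed
    qed (use w in auto)
    moreover have "(LINT x|lebesgue. w x * complex_of_real (bump c' d' n x)) = 0" for n
    proof -
      have "test_function {l<..<r} (bump c' d' n)"
        by (rule test_function_mono[OF test_function_bump]) (auto simp: c'_def d'_def)
      from test[OF this] show ?thesis by (simp add: w_def set_lebesgue_integral_def)
    qed
    moreover have "w x * complex_of_real (indicator {c'<..<d'} x) = indicator {c<..<d} x *\<^sub>R w x" for x
      by (auto simp: w_def c'_def d'_def indicator_def)
    ultimately show ?thesis by (simp add: set_lebesgue_integral_def LIMSEQ_const_iff)
  qed
  have "indicator {l<..<r} x *\<^sub>R w x = w x" for x by (auto simp: w_def indicator_def)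
  then have "integral\<^sup>L lebesgue w = 0" using I[of l r] by (simp add: set_lebesgue_integral_def)
  from integral_zero_on_intervals_imp_AE_zero[OF w this I]
  show ?thesis by (elim eventually_mono) (auto simp: w_def)
qed

lemma test_functionE:
  assumes "test_function {l<..<r} f" "l < r"
  obtains c d where "smooth f" "l < c" "c \<le> d" "d < r" "\<And>x. x \<notin> {c..d} \<Longrightarrow> f x = 0"
proof -
  let ?K = "closure {x. f x \<noteq> 0}"
  have K: "smooth f" "compact ?K" "?K \<subseteq> {l<..<r}" using assms by (auto simp: test_function_def smooth_def)
  show ?thesis
  proof (cases "?K = {}")
    case True
    then show ?thesis using K(1) assms(2) by (intro that[of "(l+r)/2" "(l+r)/2"]) auto
  next
    case False
    obtain c where c: "c \<in> ?K" "\<forall>x\<in>?K. c \<le> x" using compact_attains_inf[OF K(2) False] by blast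
    obtain d where d: "d \<in> ?K" "\<forall>x\<in>?K. x \<le> d" using compact_attains_sup[OF K(2) False] by blast
    have "f x = 0" if "x \<notin> {c..d}" for x
    proof (rule ccontr)
      assume "f x \<noteq> 0"
      then have "x \<in> ?K" by (intro closure_subset[THEN subsetD]) simp
      then show False using c(2) d(2) that unfolding atLeastAtMost_iff by metis
    qed
    moreover have "l < c" "d < r" using c(1) d(1) subsetD[OF K(3)] unfolding greaterThanLessThan_iff by metis+
    moreover have "c \<le> d" using c d by metis
    ultimately show ?thesis using that[OF K(1)] by metis
  qed
qed

text \<open>The indefinite integral starts at zero to the left of the support and returns to zero to the right of
  it because the total integral vanishes.\<close>

lemma test_function_antiderivative:
  assumes \<theta>: "test_function {l<..<r} \<theta>" and lr: "l < r"
    and zero: "(LINT x:{l<..<r}|lebesgue. \<theta> x) = 0"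
  obtains \<phi> where "test_function {l<..<r} \<phi>" "deriv \<phi> = \<theta>"
proof -
  obtain c d where cd: "smooth \<theta>" "l < c" "c \<le> d" "d < r" "\<And>x. x \<notin> {c..d} \<Longrightarrow> \<theta> x = 0"
    using test_functionE[OF \<theta> lr] by metis
  have cont: "continuous_on A \<theta>" for A by (rule smooth_continuous[OF cd(1)])
  have int: "\<theta> integrable_on {a..b}" for a b by (rule integrable_continuous_interval[OF cont])
  have z: "integral {a..b} \<theta> = 0" if "b < c \<or> d < a" for a b
    by (rule integral_unique, rule has_integral_is_0) (use that cd(5) in auto)
  define \<phi> where "\<phi> = (\<lambda>x. integral {l..x} \<theta>)"
  have der: "(\<phi> has_real_derivative \<theta> x) (at x)" for x
  proof (cases "x < c")
    case True
    have "((\<lambda>x. 0) has_real_derivative \<theta> x) (at x)" using True cd(5) by simp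
    then show ?thesis
      by (rule has_field_derivative_transform_within_open[where S="{..<c}"]) (use True z in \<open>auto simp: \<phi>_def\<close>)
  next
    case False
    have "((\<lambda>u. integral {l..u} \<theta>) has_real_derivative \<theta> x) (at x within {l..x+1})"
      by (rule integral_has_real_derivative[OF cont]) (use False cd in auto)
    moreover have "at x within {l..x+1} = at x" by (rule at_within_Icc_at) (use False cd in auto)
    ultimately show ?thesis unfolding \<phi>_def by simp
  qed
  have "set_integrable lebesgue {l<..<r} \<theta>"
    by (rule set_integrable_subset[of _ "{l..r}"])
       (auto intro: absolutely_integrable_continuous_real cont)
  then have tot: "integral {l..r} \<theta> = 0"
    using zero by (simp add: set_lebesgue_integral_eq_integral integral_open_interval_real)
  have "\<phi> x = 0" if "x \<notin> {c..d}" for x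
  proof (cases "x < c")
    case False
    with that have x: "d < x" by auto
    define R where "R = max x r"
    have "integral {l..x} \<theta> + integral {x..R} \<theta> = integral {l..R} \<theta>"
      by (rule Henstock_Kurzweil_Integration.integral_combine) (use x cd int in \<open>auto simp: R_def\<close>)
    moreover have "integral {l..r} \<theta> + integral {r..R} \<theta> = integral {l..R} \<theta>"
      by (rule Henstock_Kurzweil_Integration.integral_combine) (use x cd int in \<open>auto simp: R_def\<close>)
    ultimately show ?thesis using z[where a=x and b=R] z[where a=r and b=R] x cd(4) tot by (simp add: \<phi>_def)
  qed (use z in \<open>auto simp: \<phi>_def\<close>)
  then have "test_function {l<..<r} \<phi>"
    by (intro test_functionI[of _ c d] smooth_antiderivative[OF der cd(1)]) (use cd in force)+
  moreover have "deriv \<phi> = \<theta>" using der DERIV_imp_deriv by blast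
  ultimately show ?thesis using that by blast
qed

text \<open>A test function minus the multiple of a fixed bump that has the same integral is the derivative of a
  test function. Hence \<open>u\<close> minus a suitable constant annihilates all test functions.\<close>

lemma du_Bois_Reymond:
  fixes u :: "real \<Rightarrow> complex"
  assumes lr: "l < r" and u: "set_integrable lebesgue {l<..<r} u"
    and test: "\<And>\<phi>. test_function {l<..<r} \<phi> \<Longrightarrow> (LINT x:{l<..<r}|lebesgue. u x * complex_of_real (deriv \<phi> x)) = 0"
  shows "\<exists>c. AE x in lebesgue. x \<in> {l<..<r} \<longrightarrow> u x = c"
proof -
  let ?U = "{l<..<r}"
  let ?I = "\<lambda>\<phi>::real \<Rightarrow> real. LINT x:?U|lebesgue. \<phi> x"
  have int: "set_integrable lebesgue ?U \<phi>" if "smooth \<phi>" for \<phi>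
    by (rule set_integrable_subset[of _ "{l..r}"])
       (auto intro: absolutely_integrable_continuous_real smooth_continuous that)
  have intu: "set_integrable lebesgue ?U (\<lambda>x. v x * complex_of_real (\<phi> x))"
    if "smooth \<phi>" "set_integrable lebesgue ?U v" for \<phi> v
    by (rule set_integrable_mult_continuous[where l=l and r=r])
      (use that in \<open>auto intro!: continuous_on_of_real smooth_continuous\<close>)
  have "\<exists>n. ?I (bump l r n) \<noteq> 0"
  proof (rule ccontr)
    assume "\<not> ?thesis"
    then have z: "?I (bump l r n) = 0" for n by simp
    have "(\<lambda>n. LINT x|lebesgue. indicator ?U x *\<^sub>R bump l r n x) \<longlonglongrightarrow> (LINT x|lebesgue. indicat_real ?U x *\<^sub>R indicat_real ?U x)"
    proof (rule integral_dominated_convergence[where w = "indicat_real ?U"])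
      show "AE x in lebesgue. (\<lambda>n. indicator ?U x *\<^sub>R bump l r n x) \<longlonglongrightarrow> indicator ?U x *\<^sub>R indicator ?U x"
        by (intro AE_I2 tendsto_intros bump_tendsto)
      show "AE x in lebesgue. norm (indicator ?U x *\<^sub>R bump l r n x) \<le> indicator ?U x" for n
        using bump_bounds by (intro AE_I2) (simp add: indicator_def)
      show "(\<lambda>x. indicator ?U x *\<^sub>R bump l r n x) \<in> borel_measurable lebesgue" for n
        using int[OF smooth_bump] by (auto simp: set_integrable_def)
      show "integrable lebesgue (indicat_real ?U)" by (simp add: integrable_indicator_iff emeasure_lborel_Ioo lr less_imp_le)
      show "(\<lambda>x. indicat_real ?U x *\<^sub>R indicat_real ?U x) \<in> borel_measurable lebesgue"
        by (intro borel_measurable_scaleR borel_measurable_indicator) auto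
    qed
    moreover have "(LINT x|lebesgue. indicator ?U x *\<^sub>R indicat_real ?U x) = r - l"
      using lr by (simp flip: indicator_inter_arith)
    ultimately show False using z lr by (simp add: set_lebesgue_integral_def LIMSEQ_const_iff)
  qed
  then obtain n where n: "?I (bump l r n) \<noteq> 0" by blast
  define \<psi> where "\<psi> = bump l r n"
  define K where "K = ?I \<psi>"
  have K: "K \<noteq> 0" and \<psi>: "test_function ?U \<psi>" "smooth \<psi>"
    using n test_function_bump smooth_bump by (auto simp: K_def \<psi>_def)
  \<comment> \<open>The constant is the average of \<open>u\<close> against the normalised bump.\<close>
  define c where "c = (LINT x:?U|lebesgue. u x * complex_of_real (\<psi> x)) / complex_of_real K"
  have cint: "set_integrable lebesgue ?U (\<lambda>x. c)"
    by (rule set_integrable_subset[of _ "{l..r}"])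
       (auto intro: absolutely_integrable_continuous_real)
  have "AE x in lebesgue. x \<in> ?U \<longrightarrow> u x - c = 0"
  proof (rule fundamental_lemma_variations)
    show "set_integrable lebesgue ?U (\<lambda>x. u x - c)"
      by (rule set_integral_diff(1)[OF u cint])
    fix \<eta> assume \<eta>: "test_function ?U \<eta>"
    obtain a b where ab: "smooth \<eta>" "l < a" "a \<le> b" "b < r" "\<And>x. x \<notin> {a..b} \<Longrightarrow> \<eta> x = 0"
      using test_functionE[OF \<eta> lr] by metis
    obtain a' b' where ab': "l < a'" "a' \<le> b'" "b' < r" "\<And>x. x \<notin> {a'..b'} \<Longrightarrow> \<psi> x = 0"
      using test_functionE[OF \<psi>(1) lr] by metis
    define k where "k = ?I \<eta> / K"
    define \<theta> where "\<theta> = (\<lambda>x. \<eta> x - k * \<psi> x)"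
    have sm: "smooth \<theta>" unfolding \<theta>_def by (rule smooth_diff[OF ab(1) \<psi>(2)])
    have "test_function ?U \<theta>"
    proof (rule test_functionI[of _ "min a a'" "max b b'"])
      show "x \<in> {min a a'..max b b'}" if "\<theta> x \<noteq> 0" for x
      proof (cases "\<eta> x = 0")
        case True
        then have "x \<in> {a'..b'}" using that ab'(4)[of x] by (auto simp: \<theta>_def)
        then show ?thesis by (simp add: min_le_iff_disj le_max_iff_disj)
      next
        case False
        then have "x \<in> {a..b}" using ab(5)[of x] by auto
        then show ?thesis by (simp add: min_le_iff_disj le_max_iff_disj)
      qed
    qed (use sm ab ab' in auto)
    moreover have "?I \<theta> = 0"
    proof -
      have "?I \<theta> = ?I \<eta> - (LINT x:?U|lebesgue. k * \<psi> x)"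
        unfolding \<theta>_def by (intro set_integral_diff(2) int ab set_integrable_mult_right) (use int \<psi> in auto)
      also have "\<dots> = 0" using K by (simp add: k_def K_def)
      finally show ?thesis .
    qed
    ultimately obtain \<phi> where \<phi>: "test_function ?U \<phi>" "deriv \<phi> = \<theta>"
      using test_function_antiderivative[OF _ lr] by metis
    have "0 = (LINT x:?U|lebesgue. u x * complex_of_real (\<eta> x) - complex_of_real k * (u x * complex_of_real (\<psi> x)))"
      using test[OF \<phi>(1)] unfolding \<phi>(2) \<theta>_def by (simp add: algebra_simps)
    also have "\<dots> = (LINT x:?U|lebesgue. u x * complex_of_real (\<eta> x)) - complex_of_real k * (LINT x:?U|lebesgue. u x * complex_of_real (\<psi> x))"
      by (subst set_integral_diff(2)) (auto intro!: intu u ab \<psi> set_integrable_mult_right)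
    finally have 1: "(LINT x:?U|lebesgue. u x * complex_of_real (\<eta> x)) = complex_of_real k * (c * complex_of_real K)"
      using K by (simp add: c_def)
    have "(LINT x:?U|lebesgue. (u x - c) * complex_of_real (\<eta> x))
      = (LINT x:?U|lebesgue. u x * complex_of_real (\<eta> x)) - (LINT x:?U|lebesgue. c * complex_of_real (\<eta> x))"
      unfolding left_diff_distrib by (intro set_integral_diff(2) intu u cint ab)
    also have "(LINT x:?U|lebesgue. c * complex_of_real (\<eta> x)) = c * complex_of_real (?I \<eta>)"
      using set_integral_complex_of_real[of lebesgue ?U \<eta>] by simp
    also have "complex_of_real (?I \<eta>) = complex_of_real k * complex_of_real K"
      using K by (simp only: of_real_mult[symmetric]) (simp add: k_def)
    finally show "(LINT x:?U|lebesgue. (u x - c) * complex_of_real (\<eta> x)) = 0" using 1 by simp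
  qed
  then show ?thesis by (intro exI[of _ c]) auto
qed

section \<open>Primitives of integrable functions\<close>

text \<open>\<open>F\<close> is absolutely continuous on \<open>[l, r]\<close> with density \<open>f\<close>. The condition compares arbitrary pairs of
  points, which treats the two end points alike and is inherited by subintervals.\<close>

definition primitive_on :: "real \<Rightarrow> real \<Rightarrow> (real \<Rightarrow> complex) \<Rightarrow> (real \<Rightarrow> complex) \<Rightarrow> bool" where
  "primitive_on l r F f \<longleftrightarrow> set_integrable lebesgue {l..r} f \<and>
     (\<forall>x y. l \<le> x \<longrightarrow> x \<le> y \<longrightarrow> y \<le> r \<longrightarrow> F y - F x = (LINT t:{x..y}|lebesgue. f t))"

lemma primitive_on_continuous:
  assumes "primitive_on l r F f"
  shows "continuous_on {l..r} F"
proof -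
  have f: "set_integrable lebesgue {l..r} f" using assms by (simp add: primitive_on_def)
  then have "f integrable_on {l..r}" by (rule set_lebesgue_integral_eq_integral(1))
  then have "continuous_on {l..r} (\<lambda>x. F l + integral {l..x} f)"
    by (intro continuous_intros indefinite_integral_continuous_1)
  moreover have "F l + integral {l..x} f = F x" if "x \<in> {l..r}" for x
  proof -
    have "set_integrable lebesgue {l..x} f" by (rule set_integrable_subset[OF f]) (use that in auto)
    then have "(LINT t:{l..x}|lebesgue. f t) = integral {l..x} f" by (rule set_lebesgue_integral_eq_integral(2))
    moreover have "F x - F l = (LINT t:{l..x}|lebesgue. f t)" using assms that by (auto simp: primitive_on_def)
    ultimately show ?thesis by (simp add: algebra_simps)
  qed
  ultimately show ?thesis by (rule continuous_on_eq)
qed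

lemma primitive_on_subset:
  "primitive_on l r F f \<Longrightarrow> l \<le> a \<Longrightarrow> b \<le> r \<Longrightarrow> primitive_on a b F f"
  by (auto simp: primitive_on_def intro: set_integrable_subset)

text \<open>Fubini's theorem for \<open>f(t) g(s)\<close> on the triangle \<open>t \<le> s\<close>.\<close>

lemma primitive_on_integral_by_parts:
  assumes F: "primitive_on a b F f" and G: "primitive_on a b G g" and ab: "a \<le> b"
  shows "(LINT t:{a..b}|lebesgue. f t * G t + F t * g t) = F b * G b - F a * G a"
proof -
  interpret L: sigma_finite_measure "lebesgue :: real measure" by (rule sigma_finite_lebesgue)
  interpret pair_sigma_finite "lebesgue :: real measure" "lebesgue :: real measure" ..
  have f: "set_integrable lebesgue {a..b} f" and g: "set_integrable lebesgue {a..b} g"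
    using F G by (simp_all add: primitive_on_def)
  define h k where "h = (\<lambda>t. indicator {a..b} t *\<^sub>R f t)" and "k = (\<lambda>t. indicator {a..b} t *\<^sub>R g t)"
  have h: "integrable lebesgue h" and k: "integrable lebesgue k"
    using f g by (simp_all add: h_def k_def set_integrable_def)
  have [measurable]: "h \<in> borel_measurable lebesgue" "k \<in> borel_measurable lebesgue" using h k by auto
  have [measurable]: "(\<lambda>x::real. x) \<in> borel_measurable lebesgue"
    by (intro measurable_completion) simp
  \<comment> \<open>Integrating \<open>\<Phi>\<close> first over \<open>s\<close> produces \<open>G b - G t\<close>, first over \<open>t\<close> produces \<open>F s - F a\<close>.\<close>
  define \<Phi> where "\<Phi> = (\<lambda>(t, s). h t * (k s * of_bool (t \<le> s)))"
  have meas[measurable]: "\<Phi> \<in> borel_measurable (lebesgue \<Otimes>\<^sub>M lebesgue)"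
    unfolding \<Phi>_def by measurable
  have inner: "integrable lebesgue (\<lambda>s. k s * of_bool (t \<le> s))" for t
    by (rule integrable_mult_bounded[where B=1]) (use k in auto)
  have int: "integrable (lebesgue \<Otimes>\<^sub>M lebesgue) \<Phi>"
  proof (rule Fubini_integrable[OF meas])
    show "AE t in lebesgue. integrable lebesgue (\<lambda>s. \<Phi> (t, s))"
      unfolding \<Phi>_def by (auto intro!: AE_I2 integrable_mult_right inner)
    show "integrable lebesgue (\<lambda>t. LINT s|lebesgue. norm (\<Phi> (t, s)))"
    proof (rule Bochner_Integration.integrable_bound)
      show "integrable lebesgue (\<lambda>t. cmod (h t) * (LINT s|lebesgue. cmod (k s)))" using h by auto
      show "(\<lambda>t. LINT s|lebesgue. norm (\<Phi> (t, s))) \<in> borel_measurable lebesgue" by measurable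
      show "AE t in lebesgue. norm (LINT s|lebesgue. norm (\<Phi> (t, s))) \<le> norm (cmod (h t) * (LINT s|lebesgue. cmod (k s)))"
      proof (intro AE_I2)
        fix t
        have "(LINT s|lebesgue. norm (\<Phi> (t, s))) = cmod (h t) * (LINT s|lebesgue. cmod (k s * of_bool (t \<le> s)))"
          by (simp add: \<Phi>_def norm_mult)
        moreover have "(LINT s|lebesgue. cmod (k s * of_bool (t \<le> s))) \<le> (LINT s|lebesgue. cmod (k s))"
          by (rule integral_mono[OF integrable_norm[OF inner] integrable_norm[OF k]]) (auto simp: norm_mult)
        ultimately have "(LINT s|lebesgue. norm (\<Phi> (t, s))) \<le> cmod (h t) * (LINT s|lebesgue. cmod (k s))"
          by (simp only: mult_left_mono[OF _ norm_ge_zero])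
        then show "norm (LINT s|lebesgue. norm (\<Phi> (t, s))) \<le> norm (cmod (h t) * (LINT s|lebesgue. cmod (k s)))"
          by simp
      qed
    qed
  qed
  have Fs: "F s - F a = (LINT t|lebesgue. h t * of_bool (t \<le> s))" if "s \<in> {a..b}" for s
  proof -
    have "F s - F a = (LINT t:{a..s}|lebesgue. f t)" using F that by (auto simp: primitive_on_def)
    also have "\<dots> = (LINT t|lebesgue. h t * of_bool (t \<le> s))" unfolding set_lebesgue_integral_def
      by (rule Bochner_Integration.integral_cong) (use that in \<open>auto simp: h_def indicator_def\<close>)
    finally show ?thesis .
  qed
  have Gt: "G b - G t = (LINT s|lebesgue. k s * of_bool (t \<le> s))" if "t \<in> {a..b}" for t
  proof -
    have "G b - G t = (LINT s:{t..b}|lebesgue. g s)" using G that by (auto simp: primitive_on_def)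
    also have "\<dots> = (LINT s|lebesgue. k s * of_bool (t \<le> s))" unfolding set_lebesgue_integral_def
      by (rule Bochner_Integration.integral_cong) (use that in \<open>auto simp: k_def indicator_def\<close>)
    finally show ?thesis .
  qed
  have "(LINT s|lebesgue. LINT t|lebesgue. \<Phi> (t, s)) = (LINT t|lebesgue. LINT s|lebesgue. \<Phi> (t, s))"
    using Fubini_integral[of "\<lambda>t s. \<Phi> (t, s)"] int by simp
  also have "(LINT s|lebesgue. LINT t|lebesgue. \<Phi> (t, s)) = (LINT s|lebesgue. k s * (F s - F a))"
  proof (rule Bochner_Integration.integral_cong)
    fix s
    have "(LINT t|lebesgue. \<Phi> (t, s)) = (LINT t|lebesgue. k s * (h t * of_bool (t \<le> s)))"
      by (rule Bochner_Integration.integral_cong) (auto simp: \<Phi>_def)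
    also have "\<dots> = k s * (LINT t|lebesgue. h t * of_bool (t \<le> s))" by simp
    also have "\<dots> = k s * (F s - F a)" using Fs[of s] by (cases "s \<in> {a..b}") (auto simp: k_def)
    finally show "(LINT t|lebesgue. \<Phi> (t, s)) = k s * (F s - F a)" .
  qed simp
  also have "(LINT t|lebesgue. LINT s|lebesgue. \<Phi> (t, s)) = (LINT t|lebesgue. h t * (G b - G t))"
  proof (rule Bochner_Integration.integral_cong)
    fix t
    have "(LINT s|lebesgue. \<Phi> (t, s)) = h t * (LINT s|lebesgue. k s * of_bool (t \<le> s))"
      by (simp add: \<Phi>_def)
    also have "\<dots> = h t * (G b - G t)" using Gt[of t] by (cases "t \<in> {a..b}") (auto simp: h_def)
    finally show "(LINT s|lebesgue. \<Phi> (t, s)) = h t * (G b - G t)" .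
  qed simp
  finally have eq: "(LINT t:{a..b}|lebesgue. F t * g t - F a * g t) = (LINT t:{a..b}|lebesgue. G b * f t - f t * G t)"
    by (simp add: set_lebesgue_integral_def h_def k_def algebra_simps)
  have i1: "set_integrable lebesgue {a..b} (\<lambda>t. F t * g t)"
    using set_integrable_mult_continuous[OF g _ _ primitive_on_continuous[OF F]] by (simp add: mult.commute)
  have i2: "set_integrable lebesgue {a..b} (\<lambda>t. f t * G t)"
    using set_integrable_mult_continuous[OF f _ _ primitive_on_continuous[OF G]] by simp
  have If: "(LINT t:{a..b}|lebesgue. f t) = F b - F a" and Ig: "(LINT t:{a..b}|lebesgue. g t) = G b - G a"
    using F G ab by (auto simp: primitive_on_def)
  have "(LINT t:{a..b}|lebesgue. F t * g t) - F a * (G b - G a) = G b * (F b - F a) - (LINT t:{a..b}|lebesgue. f t * G t)"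
    using eq f g i1 i2 by (simp add: set_integral_diff(2) If Ig)
  then show ?thesis using i1 i2 by (simp add: set_integral_add(2) algebra_simps)
qed

lemma primitive_on_mult:
  assumes F: "primitive_on l r F f" and G: "primitive_on l r G g"
  shows "primitive_on l r (\<lambda>t. F t * G t) (\<lambda>t. f t * G t + F t * g t)"
  unfolding primitive_on_def
proof (intro conjI allI impI)
  have f: "set_integrable lebesgue {l..r} f" and g: "set_integrable lebesgue {l..r} g"
    using F G by (simp_all add: primitive_on_def)
  have "set_integrable lebesgue {l..r} (\<lambda>t. F t * g t)"
    using set_integrable_mult_continuous[OF g _ _ primitive_on_continuous[OF F]] by (simp add: mult.commute)
  moreover have "set_integrable lebesgue {l..r} (\<lambda>t. f t * G t)"
    using set_integrable_mult_continuous[OF f _ _ primitive_on_continuous[OF G]] by simp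
  ultimately show "set_integrable lebesgue {l..r} (\<lambda>t. f t * G t + F t * g t)"
    by (intro set_integral_add(1))
  fix x y assume "l \<le> x" "x \<le> y" "y \<le> r"
  then show "F y * G y - F x * G x = (LINT t:{x..y}|lebesgue. f t * G t + F t * g t)"
    using primitive_on_integral_by_parts[OF primitive_on_subset[OF F] primitive_on_subset[OF G]] by simp
qed

lemma primitive_on_C1:
  assumes "\<And>x. (F has_vector_derivative f x) (at x)" "continuous_on UNIV f"
  shows "primitive_on l r F f"
  unfolding primitive_on_def
proof (intro conjI allI impI)
  have c: "continuous_on A f" for A using assms(2) continuous_on_subset by blast
  show "set_integrable lebesgue {l..r} f"
    by (rule absolutely_integrable_continuous_real[OF c])
  fix x y assume "l \<le> x" "x \<le> y" "y \<le> r"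
  have "set_integrable lebesgue {x..y} f"
    by (rule absolutely_integrable_continuous_real[OF c])
  moreover have "(f has_integral (F y - F x)) {x..y}"
    by (rule fundamental_theorem_of_calculus) (use \<open>x \<le> y\<close> in \<open>auto intro: has_vector_derivative_at_within[OF assms(1)]\<close>)
  ultimately show "F y - F x = (LINT t:{x..y}|lebesgue. f t)"
    using set_lebesgue_integral_eq_integral(2) integral_unique by metis
qed

lemma primitive_on_cnj:
  assumes "primitive_on l r F f"
  shows "primitive_on l r (\<lambda>t. cnj (F t)) (\<lambda>t. cnj (f t))"
  unfolding primitive_on_def
proof (intro conjI allI impI)
  have eq: "indicator S t *\<^sub>R cnj (f t) = cnj (indicator S t *\<^sub>R f t)" for S t by simp
  show "set_integrable lebesgue {l..r} (\<lambda>t. cnj (f t))"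
    using assms unfolding primitive_on_def set_integrable_def eq
    by (intro integrable_bounded_linear[OF bounded_linear_cnj]) auto
  fix x y assume "l \<le> x" "x \<le> y" "y \<le> r"
  then have "F y - F x = (LINT t:{x..y}|lebesgue. f t)" using assms unfolding primitive_on_def by blast
  then show "cnj (F y) - cnj (F x) = (LINT t:{x..y}|lebesgue. cnj (f t))"
    unfolding set_lebesgue_integral_def eq Bochner_Integration.integral_cnj by (metis complex_cnj_diff)
qed

lemma set_integral_Ioo_eq_Icc:
  fixes f :: "real \<Rightarrow> 'a::{banach, second_countable_topology}"
  shows "(LINT x:{l<..<r}|lebesgue. f x) = (LINT x:{l..r}|lebesgue. f x)"
  unfolding set_lebesgue_integral_def
  by (rule integral_discrete_difference[where X="{l, r}"]) (auto simp: indicator_def)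

lemma square_integrable_imp_set_integrable:
  assumes "square_integrable k" shows "set_integrable lebesgue {l..r} k"
proof -
  have "square_integrable (indicator {l..r})"
    unfolding square_integrable_def
  proof
    show "(indicator {l..r} :: real \<Rightarrow> complex) \<in> borel_measurable lebesgue"
      by (rule borel_measurable_indicator) simp
    have "(\<lambda>x. (cmod (indicator {l..r} x))\<^sup>2) = indicat_real {l..r}" by (auto simp: indicator_def)
    then show "integrable lebesgue (\<lambda>x. (cmod (indicator {l..r} x))\<^sup>2)"
      by (simp add: integrable_indicator_iff emeasure_lborel_Icc_eq)
  qed
  from square_integrable_mult[OF assms this]
  have "integrable lebesgue (\<lambda>x. k x * cnj (indicator {l..r} x))" .
  moreover have "k x * cnj (indicator {l..r} x) = indicator {l..r} x *\<^sub>R k x" for x by (auto simp: indicator_def)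
  ultimately show ?thesis unfolding set_integrable_def by (simp only:)
qed

lemma primitive_on_indefinite_integral:
  assumes f: "set_integrable lebesgue {l..r} f"
  shows "primitive_on l r (\<lambda>x. c + (LINT t:{l..x}|lebesgue. f t)) f"
  unfolding primitive_on_def
proof (intro conjI allI impI)
  fix x y assume xy: "l \<le> x" "x \<le> y" "y \<le> r"
  have i: "set_integrable lebesgue {a..b} f" if "l \<le> a" "b \<le> r" for a b
    by (rule set_integrable_subset[OF f]) (use that in auto)
  have e: "(LINT t:{a..b}|lebesgue. f t) = integral {a..b} f" if "l \<le> a" "b \<le> r" for a b
    by (rule set_lebesgue_integral_eq_integral(2)[OF i[OF that]])
  have "integral {l..x} f + integral {x..y} f = integral {l..y} f"
    by (rule Henstock_Kurzweil_Integration.integral_combine[OF xy(1,2)])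
      (rule set_lebesgue_integral_eq_integral(1)[OF i[OF order_refl xy(3)]])
  then show "c + (LINT t:{l..y}|lebesgue. f t) - (c + (LINT t:{l..x}|lebesgue. f t)) = (LINT t:{x..y}|lebesgue. f t)"
    using xy by (simp add: e algebra_simps)
qed (rule f)

lemma primitive_on_cong_AE:
  assumes F: "primitive_on l r F f" and eq: "AE x in lebesgue. x \<in> {l<..<r} \<longrightarrow> g x = f x"
    and g: "set_integrable lebesgue {l..r} g"
  shows "primitive_on l r F g"
  unfolding primitive_on_def
proof (intro conjI allI impI)
  fix x y assume xy: "l \<le> x" "x \<le> y" "y \<le> r"
  have i: "set_integrable lebesgue {x<..<y} h" if "set_integrable lebesgue {l..r} h" for h :: "real \<Rightarrow> complex"
    by (rule set_integrable_subset[OF that]) (use xy in auto)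
  have "F y - F x = (LINT t:{x<..<y}|lebesgue. f t)"
    using F xy unfolding set_integral_Ioo_eq_Icc by (auto simp: primitive_on_def)
  also have "\<dots> = (LINT t:{x<..<y}|lebesgue. g t)"
    unfolding set_lebesgue_integral_def
  proof (rule integral_cong_AE)
    show "(\<lambda>t. indicat_real {x<..<y} t *\<^sub>R f t) \<in> borel_measurable lebesgue"
      "(\<lambda>t. indicat_real {x<..<y} t *\<^sub>R g t) \<in> borel_measurable lebesgue"
      using i[OF g] i[of f] F unfolding set_integrable_def primitive_on_def by auto
    show "AE t in lebesgue. indicat_real {x<..<y} t *\<^sub>R f t = indicat_real {x<..<y} t *\<^sub>R g t"
      using eq by eventually_elim (use xy in \<open>auto simp: indicator_def\<close>)
  qed
  finally show "F y - F x = (LINT t:{x..y}|lebesgue. g t)" unfolding set_integral_Ioo_eq_Icc .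
qed (rule g)

lemma primitive_on_test_function:
  assumes "test_function U \<phi>"
  shows "primitive_on l r (\<lambda>x. complex_of_real (\<phi> x)) (\<lambda>x. complex_of_real (deriv \<phi> x))"
proof (rule primitive_on_C1)
  have s: "smooth \<phi>" using assms by (simp add: test_function_def smooth_def)
  show "((\<lambda>x. complex_of_real (\<phi> x)) has_vector_derivative complex_of_real (deriv \<phi> x)) (at x)" for x
    by (rule has_vector_derivative_of_real) (use smooth_deriv(2)[OF s] in \<open>simp add: has_real_derivative_iff_has_vector_derivative\<close>)
  show "continuous_on UNIV (\<lambda>x. complex_of_real (deriv \<phi> x))"
    by (intro continuous_on_of_real smooth_continuous smooth_deriv s)
qed

section \<open>The continuous representative of an H1 function\<close>

abbreviation seg :: "real \<Rightarrow> real \<Rightarrow> real set" where "seg e p \<equiv> {min e p<..<max e p}"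

text \<open>\<open>F\<close> is the representative of \<open>f\<close>, with weak derivative \<open>g\<close>, that is continuous up to the boundary of
  the interval between \<open>e\<close> and \<open>p\<close>. The end points are not ordered: this covers both possible
  positions of the wave interval relative to the heat interval, and makes boundary terms symmetric in
  the two end points.\<close>

definition H1_rep :: "real \<Rightarrow> real \<Rightarrow> (real \<Rightarrow> complex) \<Rightarrow> L2 \<Rightarrow> L2 \<Rightarrow> bool" where
  "H1_rep e p F f g \<longleftrightarrow> f \<in> L2_on (seg e p) \<and> g \<in> L2_on (seg e p) \<and>
     primitive_on (min e p) (max e p) F (rep_L2 g) \<and>
     (AE x in lebesgue. x \<in> seg e p \<longrightarrow> rep_L2 f x = F x)"

text \<open>Estimates at one end point thereby yield those at the other.\<close>

lemma H1_rep_commute: "H1_rep e p F f g \<longleftrightarrow> H1_rep p e F f g"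
  by (simp add: H1_rep_def min.commute max.commute)

lemma set_integral_mult_cong_AE:
  fixes u v w :: "real \<Rightarrow> complex"
  assumes eq: "AE x in lebesgue. x \<in> U \<longrightarrow> u x = v x"
    and "set_integrable lebesgue U (\<lambda>x. u x * w x)" "set_integrable lebesgue U (\<lambda>x. v x * w x)"
  shows "(LINT x:U|lebesgue. u x * w x) = (LINT x:U|lebesgue. v x * w x)"
  unfolding set_lebesgue_integral_def
proof (rule integral_cong_AE)
  show "(\<lambda>x. indicat_real U x *\<^sub>R (u x * w x)) \<in> borel_measurable lebesgue"
    "(\<lambda>x. indicat_real U x *\<^sub>R (v x * w x)) \<in> borel_measurable lebesgue"
    using assms(2,3) unfolding set_integrable_def by auto
  show "AE x in lebesgue. indicat_real U x *\<^sub>R (u x * w x) = indicat_real U x *\<^sub>R (v x * w x)"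
    using eq by eventually_elim (auto simp: indicator_def)
qed

lemma H1_rep_imp_weak_derivative:
  assumes F: "H1_rep e p F f g"
  shows "has_weak_derivative_on f g (seg e p)"
  unfolding has_weak_derivative_on_def
proof (intro conjI allI impI)
  let ?U = "seg e p"
  let ?l = "min e p" and ?r = "max e p"
  show "f \<in> L2_on ?U" "g \<in> L2_on ?U" using F by (auto simp: H1_rep_def)
  have prim: "primitive_on ?l ?r F (rep_L2 g)" and eq: "AE x in lebesgue. x \<in> ?U \<longrightarrow> rep_L2 f x = F x"
    using F by (auto simp: H1_rep_def)
  fix \<phi> assume \<phi>: "test_function ?U \<phi>"
  then have s: "smooth \<phi>" by (simp add: test_function_def smooth_def)
  have c: "continuous_on A (\<lambda>x. complex_of_real (deriv \<phi> x))" "continuous_on A (\<lambda>x. complex_of_real (\<phi> x))" for A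
    by (intro continuous_on_of_real smooth_continuous smooth_deriv s)+
  have z: "\<phi> x = 0" if "x \<notin> ?U" for x
  proof (rule ccontr)
    assume "\<phi> x \<noteq> 0"
    then have "x \<in> closure {x. \<phi> x \<noteq> 0}" by (intro closure_subset[THEN subsetD]) simp
    then show False using \<phi> that unfolding test_function_def by blast
  qed
  have i: "set_integrable lebesgue {?l..?r} (rep_L2 k)" for k
    by (rule square_integrable_imp_set_integrable) simp
  have iF: "set_integrable lebesgue {?l..?r} F"
    by (rule absolutely_integrable_continuous_real[OF primitive_on_continuous[OF prim]])
  have m: "set_integrable lebesgue A (\<lambda>x. k x * complex_of_real (\<psi> x))"
    if "set_integrable lebesgue {?l..?r} k" "smooth \<psi>" "A = {?l..?r} \<or> A = ?U" for k \<psi> A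
  proof (rule set_integrable_mult_continuous[where l="?l" and r="?r"])
    show "set_integrable lebesgue A k" by (rule set_integrable_subset[OF that(1)]) (use that(3) in auto)
    show "continuous_on {?l..?r} (\<lambda>x. complex_of_real (\<psi> x))"
      by (intro continuous_on_of_real smooth_continuous that(2))
  qed (use that(3) in auto)
  have "(LINT x:?U|lebesgue. rep_L2 f x * complex_of_real (deriv \<phi> x)) = (LINT x:?U|lebesgue. F x * complex_of_real (deriv \<phi> x))"
    by (rule set_integral_mult_cong_AE[OF eq]) (intro m i iF smooth_deriv s disjI2 refl)+
  also have "\<dots> = (LINT x:{?l..?r}|lebesgue. F x * complex_of_real (deriv \<phi> x))" by (rule set_integral_Ioo_eq_Icc)
  also have "\<dots> = - (LINT x:{?l..?r}|lebesgue. rep_L2 g x * complex_of_real (\<phi> x))"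
  proof -
    have "(LINT x:{?l..?r}|lebesgue. rep_L2 g x * complex_of_real (\<phi> x) + F x * complex_of_real (deriv \<phi> x)) = 0"
      using primitive_on_integral_by_parts[OF prim primitive_on_test_function[OF \<phi>]] z[of ?l] z[of ?r] by simp
    moreover have "(LINT x:{?l..?r}|lebesgue. rep_L2 g x * complex_of_real (\<phi> x) + F x * complex_of_real (deriv \<phi> x)) =
      (LINT x:{?l..?r}|lebesgue. rep_L2 g x * complex_of_real (\<phi> x)) + (LINT x:{?l..?r}|lebesgue. F x * complex_of_real (deriv \<phi> x))"
      by (intro set_integral_add(2) m i iF smooth_deriv s disjI1 refl)
    ultimately show ?thesis by (simp add: eq_neg_iff_add_eq_0 add.commute)
  qed
  also have "(LINT x:{?l..?r}|lebesgue. rep_L2 g x * complex_of_real (\<phi> x)) = (LINT x:?U|lebesgue. rep_L2 g x * complex_of_real (\<phi> x))"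
    by (rule set_integral_Ioo_eq_Icc[symmetric])
  finally show "(LINT x:?U|lebesgue. rep_L2 f x * complex_of_real (deriv \<phi> x)) = - (LINT x:?U|lebesgue. rep_L2 g x * complex_of_real (\<phi> x))" .
qed

text \<open>The indefinite integral of \<open>g\<close> also has weak derivative \<open>g\<close>, so it differs from \<open>f\<close> by a constant by the
  du Bois-Reymond lemma.\<close>

lemma weak_derivative_imp_H1_rep:
  assumes wd: "has_weak_derivative_on f g (seg e p)" and ep: "e \<noteq> p"
  shows "\<exists>F. H1_rep e p F f g"
proof -
  let ?U = "seg e p"
  let ?l = "min e p" and ?r = "max e p"
  have lr: "?l < ?r" using ep by auto
  have i: "set_integrable lebesgue {?l..?r} (rep_L2 k)" for k
    by (rule square_integrable_imp_set_integrable) simp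
  define G where "G = (\<lambda>x. 0 + (LINT t:{?l..x}|lebesgue. rep_L2 g t))"
  have G: "primitive_on ?l ?r G (rep_L2 g)" unfolding G_def by (rule primitive_on_indefinite_integral[OF i])
  have "has_weak_derivative_on (abs_L2 (\<lambda>x. indicator ?U x * G x)) g ?U \<and>
      (AE x in lebesgue. x \<in> ?U \<longrightarrow> rep_L2 (abs_L2 (\<lambda>x. indicator ?U x * G x)) x = G x)"
  proof -
    have G': "continuous_on {?l..?r} G" by (rule primitive_on_continuous[OF G])
    have "set_integrable lebesgue {?l..?r} (\<lambda>x. 1 * (G x * cnj (G x)))"
      by (rule set_integrable_mult_continuous[where l="?l" and r="?r"])
        (auto intro!: continuous_intros G' absolutely_integrable_continuous_real)
    then have "integrable lebesgue (\<lambda>x. norm (indicator {?l..?r} x *\<^sub>R (1 * (G x * cnj (G x)))))"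
      unfolding set_integrable_def by (rule integrable_norm)
    then have "integrable lebesgue (\<lambda>x. indicat_real ?U x *\<^sub>R norm (indicator {?l..?r} x *\<^sub>R (1 * (G x * cnj (G x)))))"
      by (intro integrable_mult_indicator) auto
    moreover have "indicat_real ?U x *\<^sub>R norm (indicator {?l..?r} x *\<^sub>R (1 * (G x * cnj (G x)))) = (cmod (indicator ?U x * G x))\<^sup>2" for x
      by (auto simp: indicator_def norm_mult power2_eq_square)
    moreover have "(\<lambda>x. indicator ?U x * G x) \<in> borel_measurable lebesgue"
    proof -
      have "set_integrable lebesgue ?U G"
        by (rule set_integrable_subset[OF absolutely_integrable_continuous_real[OF G']]) auto
      then have "(\<lambda>x. indicat_real ?U x *\<^sub>R G x) \<in> borel_measurable lebesgue" unfolding set_integrable_def by auto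
      moreover have "indicat_real ?U x *\<^sub>R G x = indicator ?U x * G x" for x by (auto simp: indicator_def)
      ultimately show ?thesis by (simp only:)
    qed
    ultimately have sq: "square_integrable (\<lambda>x. indicator ?U x * G x)"
      unfolding square_integrable_def by (simp only:)
    note r = rep_abs_L2[OF sq]
    have "H1_rep e p G (abs_L2 (\<lambda>x. indicator ?U x * G x)) g"
      unfolding H1_rep_def L2_on_def mem_Collect_eq
    proof (intro conjI G)
      show "AE x in lebesgue. x \<notin> ?U \<longrightarrow> rep_L2 (abs_L2 (\<lambda>x. indicator ?U x * G x)) x = 0"
        "AE x in lebesgue. x \<in> ?U \<longrightarrow> rep_L2 (abs_L2 (\<lambda>x. indicator ?U x * G x)) x = G x"
        using r by (eventually_elim; simp add: indicator_def)+
      show "AE x in lebesgue. x \<notin> ?U \<longrightarrow> rep_L2 g x = 0"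
        using wd unfolding has_weak_derivative_on_def L2_on_def by blast
    qed
    then show ?thesis using H1_rep_imp_weak_derivative by (auto simp: H1_rep_def)
  qed
  then obtain k where k: "has_weak_derivative_on k g ?U" "AE x in lebesgue. x \<in> ?U \<longrightarrow> rep_L2 k x = G x" by blast
  have "\<exists>c. AE x in lebesgue. x \<in> ?U \<longrightarrow> rep_L2 f x - rep_L2 k x = c"
  proof (rule du_Bois_Reymond[OF lr])
    have iU: "set_integrable lebesgue ?U (rep_L2 k)" for k by (rule set_integrable_subset[OF i]) auto
    show "set_integrable lebesgue ?U (\<lambda>x. rep_L2 f x - rep_L2 k x)"
      by (intro set_integral_diff(1) iU)
    fix \<phi> assume \<phi>: "test_function ?U \<phi>"
    then have s: "smooth \<phi>" by (simp add: test_function_def smooth_def)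
    have m: "set_integrable lebesgue ?U (\<lambda>x. rep_L2 k x * complex_of_real (deriv \<phi> x))" for k
      by (rule set_integrable_mult_continuous[where l="?l" and r="?r", OF iU])
        (auto intro!: continuous_on_of_real smooth_continuous smooth_deriv s)
    have "(LINT x:?U|lebesgue. (rep_L2 f x - rep_L2 k x) * complex_of_real (deriv \<phi> x)) =
      (LINT x:?U|lebesgue. rep_L2 f x * complex_of_real (deriv \<phi> x)) - (LINT x:?U|lebesgue. rep_L2 k x * complex_of_real (deriv \<phi> x))"
      unfolding left_diff_distrib by (intro set_integral_diff(2) m)
    also have "\<dots> = 0" using wd k(1) \<phi> unfolding has_weak_derivative_on_def by simp
    finally show "(LINT x:?U|lebesgue. (rep_L2 f x - rep_L2 k x) * complex_of_real (deriv \<phi> x)) = 0" .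
  qed
  then obtain c where c: "AE x in lebesgue. x \<in> ?U \<longrightarrow> rep_L2 f x - rep_L2 k x = c" by blast
  have "H1_rep e p (\<lambda>x. c + (LINT t:{?l..x}|lebesgue. rep_L2 g t)) f g"
    unfolding H1_rep_def
  proof (intro conjI primitive_on_indefinite_integral i)
    show "f \<in> L2_on ?U" "g \<in> L2_on ?U" using wd by (auto simp: has_weak_derivative_on_def)
    show "AE x in lebesgue. x \<in> ?U \<longrightarrow> rep_L2 f x = c + (LINT t:{?l..x}|lebesgue. rep_L2 g t)"
      using c k(2) by eventually_elim (auto simp: G_def diff_eq_eq)
  qed
  then show ?thesis by blast
qed

lemma continuous_eq_AE_imp_eq:
  fixes F G :: "real \<Rightarrow> complex"
  assumes lr: "l < r" and F: "continuous_on {l..r} F" and G: "continuous_on {l..r} G"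
    and eq: "AE x in lebesgue. x \<in> {l<..<r} \<longrightarrow> F x = G x" and x: "x \<in> {l..r}"
  shows "F x = G x"
proof -
  let ?D = "\<lambda>x. norm (F x - G x)"
  have c: "continuous_on {l..r} ?D" by (intro continuous_intros F G)
  have "integral {l..r} ?D = (LINT x:{l..r}|lebesgue. ?D x)"
    by (rule set_lebesgue_integral_eq_integral(2)[symmetric]) (rule absolutely_integrable_continuous_real[OF c])
  also have "\<dots> = (LINT x:{l<..<r}|lebesgue. ?D x)" by (rule set_integral_Ioo_eq_Icc[symmetric])
  also have "\<dots> = 0" unfolding set_lebesgue_integral_def
    by (rule integral_eq_zero_AE) (use eq in \<open>eventually_elim, auto simp: indicator_def\<close>)
  finally have "(?D has_integral 0) (cbox l r)"
    using integrable_continuous_interval[OF c] by (metis has_integral_integral cbox_interval)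
  then have "?D x = 0"
    by (rule has_integral_0_cbox_imp_0[rotated 2]) (use c x lr in \<open>auto simp: box_real\<close>)
  then show ?thesis by simp
qed

text \<open>Two continuous representatives agree almost everywhere, hence on the closed interval, so the
  definite description in the trace is well defined.\<close>

lemma trace_at_eq:
  assumes F: "H1_rep e p F f g" and ep: "e \<noteq> p" and x: "x = e \<or> x = p"
  shows "trace_at (seg e p) x f = F x"
  unfolding trace_at_def
proof (rule the_equality)
  let ?l = "min e p" and ?r = "max e p"
  have lr: "?l < ?r" using ep by auto
  have cl: "closure (seg e p) = {?l..?r}" by (rule closure_greaterThanLessThan[OF lr])
  have ae: "(AE y in lebesgue_on (seg e p). rep_L2 f y = G y) \<longleftrightarrow> (AE y in lebesgue. y \<in> seg e p \<longrightarrow> rep_L2 f y = G y)" for G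
    by (subst AE_restrict_space_iff) auto
  have cF: "continuous_on {?l..?r} F" and eF: "AE y in lebesgue. y \<in> seg e p \<longrightarrow> rep_L2 f y = F y"
    using F primitive_on_continuous by (auto simp: H1_rep_def)
  show "\<exists>Fa. continuous_on (closure (seg e p)) Fa \<and> (AE x in lebesgue_on (seg e p). rep_L2 f x = Fa x) \<and> F x = Fa x"
    unfolding cl ae using cF eF by blast
  fix v assume "\<exists>Fa. continuous_on (closure (seg e p)) Fa \<and> (AE x in lebesgue_on (seg e p). rep_L2 f x = Fa x) \<and> v = Fa x"
  then obtain G where G: "continuous_on {?l..?r} G" "AE y in lebesgue. y \<in> seg e p \<longrightarrow> rep_L2 f y = G y" "v = G x"
    unfolding cl ae by blast
  have "G x = F x"
  proof (rule continuous_eq_AE_imp_eq[OF lr G(1) cF])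
    show "AE y in lebesgue. y \<in> seg e p \<longrightarrow> G y = F y" using eF G(2) by eventually_elim auto
  qed (use x in auto)
  then show "v = F x" using G(3) by simp
qed

section \<open>Integration by parts in H1\<close>

lemma cinner_H1_rep:
  assumes f: "f \<in> L2_on (seg e p)" and m: "bounded_multiplier m B"
    and G: "AE x in lebesgue. x \<in> seg e p \<longrightarrow> rep_L2 g x = G x" and G': "continuous_on {min e p..max e p} G"
    and n: "continuous_on {min e p..max e p} n" "\<And>x. x \<in> seg e p \<Longrightarrow> m x = n x"
  shows "cinner (mult_L2 m f) g = (LINT x:{min e p..max e p}|lebesgue. n x * rep_L2 f x * cnj (G x))"
proof -
  let ?l = "min e p" and ?r = "max e p"
  have "cinner (mult_L2 m f) g = (LINT x|lebesgue. m x * rep_L2 f x * cnj (rep_L2 g x))"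
    by (rule cinner_mult_L2[OF m])
  also have "\<dots> = (LINT x:seg e p|lebesgue. n x * rep_L2 f x * cnj (G x))"
    unfolding set_lebesgue_integral_def
  proof (rule integral_cong_AE)
    have cm: "cnj \<in> borel_measurable borel" by (intro borel_measurable_continuous_onI continuous_intros)
    note [measurable] = cm
    have [measurable]: "m \<in> borel_measurable lebesgue" using m by (simp add: bounded_multiplier_def)
    show "(\<lambda>x. m x * rep_L2 f x * cnj (rep_L2 g x)) \<in> borel_measurable lebesgue" by measurable
    have "set_integrable lebesgue (seg e p) (\<lambda>x. rep_L2 f x * (n x * cnj (G x)))"
    proof (rule set_integrable_mult_continuous[where l="?l" and r="?r"])
      show "set_integrable lebesgue (seg e p) (rep_L2 f)"
        by (rule set_integrable_subset[OF square_integrable_imp_set_integrable[OF square_integrable_rep, of "min e p" "max e p"]]) auto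
    qed (auto intro!: continuous_intros G' n)
    then show "(\<lambda>x. indicat_real (seg e p) x *\<^sub>R (n x * rep_L2 f x * cnj (G x))) \<in> borel_measurable lebesgue"
      unfolding set_integrable_def by (simp add: mult_ac borel_measurable_integrable)
    have f0: "AE x in lebesgue. x \<notin> seg e p \<longrightarrow> rep_L2 f x = 0" using f by (simp add: L2_on_def)
    show "AE x in lebesgue. m x * rep_L2 f x * cnj (rep_L2 g x) = indicat_real (seg e p) x *\<^sub>R (n x * rep_L2 f x * cnj (G x))"
      using f0 G by eventually_elim (use n(2) in \<open>auto simp: indicator_def\<close>)
  qed
  also have "\<dots> = (LINT x:{?l..?r}|lebesgue. n x * rep_L2 f x * cnj (G x))" by (rule set_integral_Ioo_eq_Icc)
  finally show ?thesis .
qed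

lemma bounded_multiplier_1: "bounded_multiplier (\<lambda>x. 1) 1"
  by (simp add: bounded_multiplier_def)

lemma mult_L2_1: "mult_L2 (\<lambda>x. 1) f = f"
  by (simp add: mult_L2_def abs_rep_L2)

lemma cinner_mult_adjoint:
  assumes m: "bounded_multiplier m B" and real: "\<And>x. cnj (m x) = m x"
  shows "cinner (mult_L2 m f) g = cinner f (mult_L2 m g)"
proof -
  have "cinner f (mult_L2 m g) = cnj (LINT x|lebesgue. m x * rep_L2 g x * cnj (rep_L2 f x))"
    using cinner_commute[of f "mult_L2 m g"] cinner_mult_L2[OF m, of g f] by simp
  also have "\<dots> = (LINT x|lebesgue. cnj (m x * rep_L2 g x * cnj (rep_L2 f x)))" by (rule Bochner_Integration.integral_cnj[symmetric])
  also have "\<dots> = (LINT x|lebesgue. m x * rep_L2 f x * cnj (rep_L2 g x))" by (simp add: real mult_ac)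
  finally show ?thesis using cinner_mult_L2[OF m, of f g] by simp
qed

text \<open>Integration by parts for the product \<open>n F\<close> and the conjugate of \<open>G\<close>, written with inner products in L2.
  The multiplier \<open>m\<close> is \<open>n\<close> cut off outside the interval, and real, so it can be moved from one argument of
  the inner product to the other. The weight 1 gives the usual formula, the weight \<open>x - e\<close> the
  multiplier identity.\<close>

lemma primitive_on_weighted_by_parts:
  assumes F: "H1_rep e p F f f'" and G: "H1_rep e p G g g'"
    and m: "bounded_multiplier m B" and n: "primitive_on (min e p) (max e p) n n'" "continuous_on {min e p..max e p} n'"
       "\<And>x. x \<in> seg e p \<Longrightarrow> m x = n x" "\<And>x. cnj (m x) = m x"
  shows "cinner (mult_L2 m f') g + cinner (mult_L2 m f) g' + (LINT x:{min e p..max e p}|lebesgue. n' x * F x * cnj (G x))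
    = n (max e p) * F (max e p) * cnj (G (max e p)) - n (min e p) * F (min e p) * cnj (G (min e p))"
proof -
  let ?l = "min e p" and ?r = "max e p"
  have pF: "primitive_on ?l ?r F (rep_L2 f')" and eF: "AE y in lebesgue. y \<in> seg e p \<longrightarrow> rep_L2 f y = F y"
    and pG: "primitive_on ?l ?r G (rep_L2 g')" and eG: "AE y in lebesgue. y \<in> seg e p \<longrightarrow> rep_L2 g y = G y"
    and f': "f' \<in> L2_on (seg e p)" and g': "g' \<in> L2_on (seg e p)"
    using F G by (auto simp: H1_rep_def)
  have cF: "continuous_on {?l..?r} F" and cG: "continuous_on {?l..?r} G" and cn: "continuous_on {?l..?r} n"
    using pF pG n(1) primitive_on_continuous by auto
  have i: "set_integrable lebesgue {?l..?r} (rep_L2 k)" for k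
    by (rule square_integrable_imp_set_integrable) simp
  have icnj: "set_integrable lebesgue {?l..?r} (\<lambda>x. cnj (rep_L2 g' x))"
    using primitive_on_cnj[OF pG] by (simp add: primitive_on_def)
  have 1: "cinner (mult_L2 m f') g = (LINT x:{?l..?r}|lebesgue. rep_L2 f' x * (n x * cnj (G x)))"
    by (subst cinner_H1_rep[OF f' m eG cG cn n(3)]) (simp_all add: mult_ac)
  have "cinner (mult_L2 m f) g' = cnj (cinner (mult_L2 m g') f)"
    using cinner_mult_adjoint[OF m n(4), of f g'] cinner_commute[of f "mult_L2 m g'"] by simp
  also have "\<dots> = cnj (LINT x:{?l..?r}|lebesgue. n x * rep_L2 g' x * cnj (F x))"
    by (subst cinner_H1_rep[OF g' m eF cF cn n(3)]) simp_all
  also have "\<dots> = (LINT x:{?l..?r}|lebesgue. cnj (rep_L2 g' x) * (cnj (n x) * F x))"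
    unfolding set_lebesgue_integral_def Bochner_Integration.integral_cnj[symmetric] by (simp add: mult_ac)
  also have "\<dots> = (LINT x:{?l..?r}|lebesgue. cnj (rep_L2 g' x) * (n x * F x))"
  proof -
    have "cnj (n x) = n x" if "x \<in> seg e p" for x using n(3,4)[of x] that by metis
    then have "(LINT x:seg e p|lebesgue. cnj (rep_L2 g' x) * (cnj (n x) * F x)) = (LINT x:seg e p|lebesgue. cnj (rep_L2 g' x) * (n x * F x))"
      unfolding set_lebesgue_integral_def by (intro Bochner_Integration.integral_cong) (auto simp: indicator_def)
    then show ?thesis unfolding set_integral_Ioo_eq_Icc .
  qed
  finally have 2: "cinner (mult_L2 m f) g' = (LINT x:{?l..?r}|lebesgue. cnj (rep_L2 g' x) * (n x * F x))" .
  have I1: "set_integrable lebesgue {?l..?r} (\<lambda>x. rep_L2 f' x * (n x * cnj (G x)))"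
    by (rule set_integrable_mult_continuous[where l="?l" and r="?r", OF i]) (auto intro!: continuous_intros cG cn)
  have I2: "set_integrable lebesgue {?l..?r} (\<lambda>x. cnj (rep_L2 g' x) * (n x * F x))"
    by (rule set_integrable_mult_continuous[where l="?l" and r="?r", OF icnj]) (auto intro!: continuous_intros cF cn)
  have I3: "set_integrable lebesgue {?l..?r} (\<lambda>x. n' x * F x * cnj (G x))"
    by (rule absolutely_integrable_continuous_real) (intro continuous_intros cF cG n(2))
  have "(LINT x:{?l..?r}|lebesgue. (n' x * F x + n x * rep_L2 f' x) * cnj (G x) + n x * F x * cnj (rep_L2 g' x))
    = n ?r * F ?r * cnj (G ?r) - n ?l * F ?l * cnj (G ?l)"
    by (rule primitive_on_integral_by_parts[OF primitive_on_mult[OF n(1) pF] primitive_on_cnj[OF pG]]) simp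
  also have "(\<lambda>x. (n' x * F x + n x * rep_L2 f' x) * cnj (G x) + n x * F x * cnj (rep_L2 g' x)) =
     (\<lambda>x. rep_L2 f' x * (n x * cnj (G x)) + (cnj (rep_L2 g' x) * (n x * F x) + n' x * F x * cnj (G x)))"
    by (auto simp: algebra_simps)
  finally show ?thesis using I1 I2 I3 by (simp add: 1 2 set_integral_add add.assoc)
qed

lemma H1_integration_by_parts:
  assumes F: "H1_rep e p F f f'" and G: "H1_rep e p G g g'"
  shows "cinner f' g + cinner f g' = of_real (sgn (p - e)) * (F p * cnj (G p) - F e * cnj (G e))"
proof -
  have "primitive_on (min e p) (max e p) (\<lambda>x. 1) (\<lambda>x. 0)"
    by (rule primitive_on_C1) (auto intro!: derivative_eq_intros)
  from primitive_on_weighted_by_parts[OF F G bounded_multiplier_1 this]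
  have "cinner f' g + cinner f g' = F (max e p) * cnj (G (max e p)) - F (min e p) * cnj (G (min e p))"
    by (simp add: mult_L2_1 set_lebesgue_integral_def)
  then show ?thesis by (auto simp: max_def min_def sgn_if)
qed

text \<open>The cut-off makes the weight \<open>x - e\<close> a bounded multiplier on the real line.\<close>

definition offset :: "real \<Rightarrow> real \<Rightarrow> real \<Rightarrow> complex" where
  "offset e p x = indicator (seg e p) x * of_real (x - e)"

lemma offset_cnj: "cnj (offset e p x) = offset e p x"
  by (simp add: offset_def indicator_def)

lemma bounded_multiplier_offset: "bounded_multiplier (offset e p) \<bar>p - e\<bar>"
  unfolding bounded_multiplier_def
proof (intro conjI allI)
  have "(\<lambda>x. complex_of_real (x - e)) \<in> borel_measurable borel"
    by (intro borel_measurable_continuous_onI continuous_intros)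
  then have "(\<lambda>x. complex_of_real (x - e)) \<in> borel_measurable lebesgue" by (simp add: measurable_completion)
  then show "offset e p \<in> borel_measurable lebesgue"
    unfolding offset_def[abs_def] by (intro borel_measurable_times borel_measurable_indicator) simp_all
  show "cmod (offset e p x) \<le> \<bar>p - e\<bar>" for x
    by (auto simp: offset_def indicator_def simp flip: of_real_diff)
qed

lemma norm_square_H1_rep:
  assumes "H1_rep e p F f f'"
  shows "(LINT x:{min e p..max e p}|lebesgue. 1 * F x * cnj (F x)) = of_real ((norm f)\<^sup>2)"
proof -
  have eF: "AE y in lebesgue. y \<in> seg e p \<longrightarrow> rep_L2 f y = F y" and f: "f \<in> L2_on (seg e p)"
    and cF: "continuous_on {min e p..max e p} F" using assms primitive_on_continuous by (auto simp: H1_rep_def)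
  have i: "set_integrable lebesgue (seg e p) (rep_L2 f)"
    by (rule set_integrable_subset[OF square_integrable_imp_set_integrable[OF square_integrable_rep, of "min e p" "max e p"]]) auto
  have iF: "set_integrable lebesgue (seg e p) F"
    by (rule set_integrable_subset[OF absolutely_integrable_continuous_real[OF cF]]) auto
  have "of_real ((norm f)\<^sup>2) = cinner (mult_L2 (\<lambda>x. 1) f) f" by (simp add: mult_L2_1 cinner_self)
  also have "\<dots> = (LINT x:{min e p..max e p}|lebesgue. rep_L2 f x * cnj (F x))"
    by (subst cinner_H1_rep[OF f bounded_multiplier_1 eF cF]) auto
  also have "\<dots> = (LINT x:seg e p|lebesgue. rep_L2 f x * cnj (F x))" by (rule set_integral_Ioo_eq_Icc[symmetric])
  also have "\<dots> = (LINT x:seg e p|lebesgue. F x * cnj (F x))"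
    by (rule set_integral_mult_cong_AE[OF eF])
      (auto intro!: set_integrable_mult_continuous[where l="min e p" and r="max e p"] i iF continuous_intros cF)
  also have "\<dots> = (LINT x:{min e p..max e p}|lebesgue. 1 * F x * cnj (F x))" by (simp add: set_integral_Ioo_eq_Icc)
  finally show ?thesis by simp
qed

text \<open>The weight \<open>x - e\<close> vanishes at \<open>e\<close>, so only the boundary term at \<open>p\<close> survives, and its derivative 1
  produces the norm of \<open>f\<close>. This is the source of the trace inequality, of Poincare's inequality
  and of the observability of the wave from the interface.\<close>

lemma H1_multiplier_identity:
  assumes F: "H1_rep e p F f f'"
  shows "2 * Re (cinner (mult_L2 (offset e p) f') f) + (norm f)\<^sup>2 = \<bar>p - e\<bar> * (cmod (F p))\<^sup>2"
proof -
  have n: "primitive_on (min e p) (max e p) (\<lambda>x. of_real (x - e)) (\<lambda>x. 1)"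
    by (rule primitive_on_C1) (auto intro!: derivative_eq_intros)
  have on: "offset e p x = of_real (x - e)" if "x \<in> seg e p" for x using that by (simp add: offset_def)
  have "cinner (mult_L2 (offset e p) f) f' = cnj (cinner (mult_L2 (offset e p) f') f)"
    using cinner_mult_adjoint[OF bounded_multiplier_offset offset_cnj, of e p f f'] cinner_commute[of f] by simp
  then have "Re (cinner (mult_L2 (offset e p) f) f') = Re (cinner (mult_L2 (offset e p) f') f)" by simp
  then have "2 * Re (cinner (mult_L2 (offset e p) f') f) + (norm f)\<^sup>2 =
      Re (cinner (mult_L2 (offset e p) f') f + cinner (mult_L2 (offset e p) f) f' + of_real ((norm f)\<^sup>2))" by simp
  also have "\<dots> = Re (of_real (max e p - e) * F (max e p) * cnj (F (max e p)) - of_real (min e p - e) * F (min e p) * cnj (F (min e p)))"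
    using primitive_on_weighted_by_parts[OF F F bounded_multiplier_offset n _ on offset_cnj] norm_square_H1_rep[OF F] by simp
  also have "\<dots> = \<bar>p - e\<bar> * (cmod (F p))\<^sup>2"
  proof -
    have k: "Re (complex_of_real a * z * cnj z) = a * (cmod z)\<^sup>2" for a z
      by (simp only: mult.assoc complex_norm_square[symmetric] of_real_mult[symmetric] Re_complex_of_real)
    show ?thesis unfolding minus_complex.sel k
      by (cases "e \<le> p") (simp_all add: max_def min_def algebra_simps)
  qed
  finally show ?thesis .
qed

lemma norm_offset_cinner_le: "\<bar>Re (cinner (mult_L2 (offset e p) f') f)\<bar> \<le> \<bar>p - e\<bar> * norm f' * norm f"
proof -
  have "\<bar>Re (cinner (mult_L2 (offset e p) f') f)\<bar> \<le> norm (mult_L2 (offset e p) f') * norm f"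
    using abs_Re_le_cmod cinner_Cauchy_Schwarz order_trans by blast
  also have "\<dots> \<le> \<bar>p - e\<bar> * norm f' * norm f"
    by (intro mult_right_mono norm_mult_L2_le[OF bounded_multiplier_offset]) simp
  finally show ?thesis .
qed

lemma H1_trace_bound:
  assumes "H1_rep e p F f f'"
  shows "\<bar>p - e\<bar> * (cmod (F p))\<^sup>2 \<le> (norm f)\<^sup>2 + 2 * (\<bar>p - e\<bar> * norm f' * norm f)"
  using H1_multiplier_identity[OF assms] norm_offset_cinner_le[of e p f' f] by linarith

text \<open>With the roles of the end points exchanged, the only boundary term in the multiplier identity is
  the one at \<open>e\<close>.\<close>

lemma H1_Poincare:
  assumes F: "H1_rep e p F f f'" and z: "F e = 0"
  shows "norm f \<le> 2 * \<bar>p - e\<bar> * norm f'"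
proof -
  have "2 * Re (cinner (mult_L2 (offset p e) f') f) + (norm f)\<^sup>2 = 0"
    using H1_multiplier_identity[of p e F f f'] F z by (simp add: H1_rep_commute)
  then have "norm f * norm f \<le> (2 * \<bar>p - e\<bar> * norm f') * norm f"
    using norm_offset_cinner_le[of p e f' f] by (simp add: power2_eq_square abs_minus_commute)
  then show ?thesis by (cases "norm f = 0") auto
qed

section \<open>Semigroups and their generators\<close>

text \<open>The gliding hump argument for the uniform boundedness principle: stepping by \<open>d n\<close> with norm at
  most \<open>3\<^sup>-\<^sup>n\<close>, the \<open>n\<close>-th operator is made large, and the later steps together are too short to undo
  this. The growth \<open>4\<^sup>n\<close> of the norms beats the factor \<open>3\<^sup>-\<^sup>n\<close>.\<close>

lemma uniform_boundedness_sequence: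
  fixes S :: "nat \<Rightarrow> 'a::banach \<Rightarrow> 'b::real_normed_vector"
  assumes lin: "\<And>n. bounded_linear (S n)" and big: "\<And>n. onorm (S n) \<ge> 4 ^ n"
  shows "\<exists>x. \<forall>n. norm (S n x) \<ge> (1/6) * (4/3) ^ n"
proof -
  have key: "\<exists>d. norm d \<le> (1/3)^n \<and> norm (S n (x + d)) \<ge> (2/3) * (1/3)^n * onorm (S n)" for n x
  proof -
    interpret Sn: bounded_linear "S n" by (rule lin)
    have pos: "onorm (S n) > 0" using big[of n] by (rule less_le_trans[rotated]) simp
    have "\<exists>u. norm (S n u) > (2/3) * onorm (S n) * norm u"
    proof (rule ccontr)
      assume "\<not> ?thesis"
      then have "norm (S n u) \<le> (2/3) * onorm (S n) * norm u" for u by (simp add: not_less)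
      then have "onorm (S n) \<le> (2/3) * onorm (S n)" using pos by (intro onorm_bound) auto
      with pos show False by simp
    qed
    then obtain u where u: "norm (S n u) > (2/3) * onorm (S n) * norm u" by blast
    then have "u \<noteq> 0" by auto
    define z where "z = ((1/3)^n / norm u) *\<^sub>R u"
    have nz: "norm z = (1/3)^n" using \<open>u \<noteq> 0\<close> by (simp add: z_def)
    have "norm (S n z) = (1/3)^n / norm u * norm (S n u)" by (simp add: z_def Sn.scaleR)
    also have "\<dots> \<ge> (1/3)^n / norm u * ((2/3) * onorm (S n) * norm u)"
      using u by (intro mult_left_mono) auto
    finally have Sz: "norm (S n z) \<ge> (2/3) * (1/3)^n * onorm (S n)" using \<open>u \<noteq> 0\<close> by (simp add: field_simps)
    \<comment> \<open>One of the two steps \<open>z\<close> and \<open>- z\<close> makes the image at least as large as that of \<open>z\<close> itself.\<close>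
    have "2 *\<^sub>R S n z = S n (x + z) - S n (x + (- z))"
      unfolding Sn.add Sn.neg by (simp add: scaleR_2)
    then have "2 * norm (S n z) \<le> norm (S n (x + z)) + norm (S n (x + (- z)))"
      by (metis norm_scaleR norm_triangle_ineq4 abs_numeral)
    then have "norm (S n z) \<le> norm (S n (x + z)) \<or> norm (S n z) \<le> norm (S n (x + (- z)))" by linarith
    then show ?thesis
    proof
      assume "norm (S n z) \<le> norm (S n (x + z))"
      then show ?thesis using nz Sz by (intro exI[of _ z]) auto
    next
      assume "norm (S n z) \<le> norm (S n (x + (- z)))"
      then show ?thesis using nz Sz by (intro exI[of _ "- z"]) auto
    qed
  qed
  then obtain D where D: "\<And>n x. norm (D n x) \<le> (1/3)^n"
    "\<And>n x. norm (S n (x + D n x)) \<ge> (2/3) * (1/3)^n * onorm (S n)" by metis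
  define X where "X = rec_nat 0 (\<lambda>n x. x + D n x)"
  define d where "d = (\<lambda>n. D n (X n))"
  have XS: "X (Suc n) = X n + d n" for n by (simp add: X_def d_def)
  have X: "X n = (\<Sum>k<n. d k)" for n by (induction n) (simp_all add: XS, simp add: X_def)
  have dn: "norm (d n) \<le> (1/3)^n" for n by (simp add: d_def D)
  have g: "summable (\<lambda>n. (1/3::real)^n)" by (rule summable_geometric) simp
  have sd: "summable d" by (rule summable_comparison_test'[OF g]) (use dn in auto)
  have "norm (S n (\<Sum>k. d k)) \<ge> (1/6) * (4/3) ^ n" for n
  proof -
    interpret Sn: bounded_linear "S n" by (rule lin)
    define R where "R = (\<Sum>k. d (k + Suc n))"
    have split: "(\<Sum>k. d k) = R + X (Suc n)" unfolding R_def X by (rule suminf_split_initial_segment[OF sd])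
    have gn: "(\<lambda>k. (1/3::real)^(k + Suc n)) sums ((1/3)^n / 2)"
      using sums_mult[OF geometric_sums[of "1/3::real"], of "(1/3)^Suc n"]
      by (simp add: power_add mult.commute)
    have sn: "summable (\<lambda>k. norm (d (k + Suc n)))"
      by (rule summable_comparison_test'[OF sums_summable[OF gn]]) (simp only: real_norm_def abs_norm_cancel dn)
    have "norm R \<le> (\<Sum>k. norm (d (k + Suc n)))" unfolding R_def by (rule summable_norm[OF sn])
    also have "\<dots> \<le> (\<Sum>k. (1/3::real)^(k + Suc n))"
      by (rule suminf_le[OF dn sn sums_summable[OF gn]])
    finally have "norm R \<le> (\<Sum>k. (1/3::real)^(k + Suc n))" .
    then have "norm R \<le> (1/3)^n / 2" using gn sums_unique by metis
    then have "norm (S n R) \<le> onorm (S n) * ((1/3)^n / 2)"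
      using onorm[OF lin, of n R] onorm_pos_le[OF lin, of n] by (meson mult_left_mono order_trans)
    moreover have "norm (S n (X (Suc n))) \<ge> (2/3) * (1/3)^n * onorm (S n)"
      unfolding XS d_def by (rule D)
    moreover have "norm (S n (\<Sum>k. d k)) \<ge> norm (S n (X (Suc n))) - norm (S n R)"
      unfolding split Sn.add by (metis add.commute norm_diff_ineq)
    ultimately have "norm (S n (\<Sum>k. d k)) \<ge> (1/6) * (1/3)^n * onorm (S n)" by (simp add: algebra_simps)
    moreover have "(1/6) * (1/3)^n * onorm (S n) \<ge> (1/6) * (1/3)^n * 4^n"
      by (intro mult_left_mono big) simp
    moreover have "(1/6) * (1/3)^n * 4^n = (1/6) * (4/3::real)^n" by (simp add: power_divide)
    ultimately show ?thesis by linarith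
  qed
  then show ?thesis by blast
qed

lemma has_vector_derivative_quotient_at_right:
  fixes f :: "real \<Rightarrow> 'a::real_normed_vector"
  assumes f: "(f has_vector_derivative y) (at x within S)" and S: "{x..x + \<eta>} \<subseteq> S" "\<eta> > 0"
  shows "((\<lambda>h. (f (x + h) - f x) /\<^sub>R h) \<longlongrightarrow> y) (at_right 0)"
proof (rule tendstoI)
  fix e :: real assume "e > 0"
  then obtain d where d: "d > 0" "\<And>s. s \<in> S \<Longrightarrow> norm (s - x) < d \<Longrightarrow> norm (f s - f x - (s - x) *\<^sub>R y) \<le> e/2 * norm (s - x)"
    using f unfolding has_vector_derivative_def has_derivative_within_alt by (metis half_gt_zero)
  have "dist ((f (x + h) - f x) /\<^sub>R h) y < e" if h: "0 < h" "h < min d \<eta>" for h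
  proof -
    have "norm (f (x + h) - f x - h *\<^sub>R y) \<le> e/2 * h"
      using d(2)[of "x + h"] h S(1) by (force simp: subset_iff)
    moreover have "(f (x + h) - f x) /\<^sub>R h - y = (f (x + h) - f x - h *\<^sub>R y) /\<^sub>R h"
      using h by (simp add: scaleR_diff_right)
    ultimately have "norm ((f (x + h) - f x) /\<^sub>R h - y) \<le> e/2"
      using h by (simp add: divide_inverse_commute[symmetric] pos_divide_le_eq)
    then show ?thesis using \<open>e > 0\<close> by (simp add: dist_norm)
  qed
  then show "\<forall>\<^sub>F h in at_right 0. dist ((f (x + h) - f x) /\<^sub>R h) y < e"
    unfolding eventually_at_right_field using d(1) S(2) by (intro exI[of _ "min d \<eta>"]) auto
qed

lemma nonincreasing_on_nonneg:
  fixes f :: "real \<Rightarrow> real"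
  assumes f: "\<And>t. 0 \<le> t \<Longrightarrow> (f has_vector_derivative f' t) (at t within {0..})"
    and f': "\<And>t. 0 \<le> t \<Longrightarrow> f' t \<le> 0" and t: "0 \<le> t"
  shows "f t \<le> f 0"
proof (rule DERIV_nonpos_imp_decreasing_open[OF t])
  have "continuous_on {0..} f"
    unfolding continuous_on_eq_continuous_within using has_vector_derivative_continuous[OF f] by auto
  then show "continuous_on {0..t} f" by (rule continuous_on_subset) auto
  fix s assume s: "0 < s" "s < t"
  have at: "at s within {0..} = at s"
    by (rule at_within_open_subset[of _ "{0<..}"]) (use s in auto)
  have "(f has_real_derivative f' s) (at s)"
    using f[of s] s unfolding at has_real_derivative_iff_has_vector_derivative by linarith
  then show "\<exists>y. (f has_real_derivative y) (at s) \<and> y \<le> 0" using f'[of s] s by (intro exI[of _ "f' s"]) simp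
qed

text \<open>A generator on a subspace that is the range of a bounded projection \<open>P\<close>. The maps \<open>T t\<close> are
  constrained only on \<open>X\<close>; composing them with \<open>P\<close> gives bounded operators on the whole Banach space,
  which commute with integrals and have operator norms.\<close>

locale c0_semigroup =
  fixes X :: "'a::{complex_inner,banach} set" and A :: "('a \<times> 'a) set" and T :: "real \<Rightarrow> 'a \<Rightarrow> 'a" and P :: "'a \<Rightarrow> 'a"
  assumes generates: "generates_on X A T"
    and P: "bounded_linear P" "\<And>x. P x \<in> X" "\<And>x. x \<in> X \<Longrightarrow> P x = x"
    and X_scaleC: "\<And>c x. x \<in> X \<Longrightarrow> scaleC c x \<in> X"
begin

lemma X_diff: "x \<in> X \<Longrightarrow> y \<in> X \<Longrightarrow> x - y \<in> X"
  using P bounded_linear.linear linear_diff by metis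

lemma X_scaleR: "x \<in> X \<Longrightarrow> r *\<^sub>R x \<in> X"
  using P bounded_linear.linear linear_scale by metis

lemma C0: "C0_semigroup_on X T" and A_eq: "A = generator_on X T"
  using generates by (auto simp: generates_on_def)

lemma T_in: "0 \<le> t \<Longrightarrow> x \<in> X \<Longrightarrow> T t x \<in> X"
  and T_add: "0 \<le> t \<Longrightarrow> x \<in> X \<Longrightarrow> y \<in> X \<Longrightarrow> T t (x + y) = T t x + T t y"
  and T_scaleC: "0 \<le> t \<Longrightarrow> x \<in> X \<Longrightarrow> T t (scaleC c x) = scaleC c (T t x)"
  and T_bounded: "0 \<le> t \<Longrightarrow> \<exists>M. \<forall>x\<in>X. norm (T t x) \<le> M * norm x"
  and T_0: "x \<in> X \<Longrightarrow> T 0 x = x"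
  and T_plus: "0 \<le> s \<Longrightarrow> 0 \<le> t \<Longrightarrow> x \<in> X \<Longrightarrow> T (s + t) x = T s (T t x)"
  and T_at_0: "x \<in> X \<Longrightarrow> ((\<lambda>t. T t x) \<longlongrightarrow> x) (at_right 0)"
  using C0 unfolding C0_semigroup_on_def by blast+

lemma A_iff: "(x, y) \<in> A \<longleftrightarrow> x \<in> X \<and> y \<in> X \<and> ((\<lambda>t. (T t x - x) /\<^sub>R t) \<longlongrightarrow> y) (at_right 0)"
  by (simp add: A_eq generator_on_def)

lemma A_in: "(x, y) \<in> A \<Longrightarrow> x \<in> X" "(x, y) \<in> A \<Longrightarrow> y \<in> X"
  by (auto simp: A_iff)

lemma T_scaleR: "0 \<le> t \<Longrightarrow> x \<in> X \<Longrightarrow> T t (r *\<^sub>R x) = r *\<^sub>R T t x"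
  by (simp add: T_scaleC flip: scaleC_of_real)

lemma T_diff: "0 \<le> t \<Longrightarrow> x \<in> X \<Longrightarrow> y \<in> X \<Longrightarrow> T t (x - y) = T t x - T t y"
  using T_add[of t "x - y" y] by (simp add: X_diff algebra_simps)

lemma bounded_linear_T: "0 \<le> t \<Longrightarrow> bounded_linear (\<lambda>x. T t (P x))"
proof -
  assume t: "0 \<le> t"
  obtain M where M: "\<forall>x\<in>X. norm (T t x) \<le> M * norm x" using T_bounded[OF t] by blast
  interpret P: bounded_linear P by (rule P)
  obtain K where K: "\<And>x. norm (P x) \<le> norm x * K" using P.bounded by blast
  show ?thesis
  proof (rule bounded_linear_intro[where K="\<bar>M\<bar> * K"])
    fix x
    have "norm (T t (P x)) \<le> M * norm (P x)" using M P(2) by blast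
    also have "\<dots> \<le> \<bar>M\<bar> * norm (P x)" by (intro mult_right_mono) auto
    also have "\<dots> \<le> \<bar>M\<bar> * (norm x * K)" by (intro mult_left_mono K) auto
    finally show "norm (T t (P x)) \<le> norm x * (\<bar>M\<bar> * K)" by (simp add: mult_ac)
  qed (simp_all add: P.add P.scaleR T_add T_scaleR P(2) t)
qed

text \<open>Otherwise the uniform boundedness principle gives a vector whose orbit is unbounded near time zero,
  against strong continuity there.\<close>

lemma T_locally_bounded:
  obtains \<delta> M where "\<delta> > 0" "M > 0" "\<And>t x. 0 \<le> t \<Longrightarrow> t \<le> \<delta> \<Longrightarrow> x \<in> X \<Longrightarrow> norm (T t x) \<le> M * norm x"
proof -
  have "\<exists>n::nat. \<forall>t x. 0 \<le> t \<longrightarrow> t \<le> 1 / real (Suc n) \<longrightarrow> x \<in> X \<longrightarrow> norm (T t x) \<le> 4 ^ n * norm x"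
  proof (rule ccontr)
    assume "\<not> ?thesis"
    then have "\<forall>n. \<exists>t x. 0 \<le> t \<and> t \<le> 1 / real (Suc n) \<and> x \<in> X \<and> norm (T t x) > 4 ^ n * norm x"
      by (meson not_le)
    then obtain t x where t: "\<And>n. 0 \<le> t n" "\<And>n. t n \<le> 1 / real (Suc n)"
      and x: "\<And>n. x n \<in> X" "\<And>n. norm (T (t n) (x n)) > 4 ^ n * norm (x n)" by metis
    have t0: "t n \<noteq> 0" for n
    proof
      assume "t n = 0"
      then have "norm (x n) > 4 ^ n * norm (x n)" using x[of n] by (simp add: T_0)
      moreover have "norm (x n) \<le> 4 ^ n * norm (x n)" by (simp add: mult_le_cancel_right1)
      ultimately show False by simp
    qed
    have tpos: "t n > 0" for n using t(1)[of n] t0[of n] by (simp add: order_less_le)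
    define S where "S = (\<lambda>n x. T (t n) (P x))"
    have S: "bounded_linear (S n)" for n unfolding S_def by (rule bounded_linear_T[OF t(1)])
    have "onorm (S n) \<ge> 4 ^ n" for n
    proof (rule ccontr)
      assume "\<not> ?thesis"
      then have "onorm (S n) * norm (x n) \<le> 4 ^ n * norm (x n)" by (intro mult_right_mono) auto
      moreover have "norm (T (t n) (x n)) \<le> onorm (S n) * norm (x n)"
        using onorm[OF S, of n "x n"] P(3)[OF x(1)] by (simp add: S_def)
      ultimately show False using x(2)[of n] by simp
    qed
    from uniform_boundedness_sequence[OF S this] obtain z where
      z: "\<And>n. norm (T (t n) (P z)) \<ge> (1/6) * (4/3) ^ n" by (auto simp: S_def)
    have "t \<longlonglongrightarrow> 0"
      by (rule tendsto_sandwich[OF _ _ tendsto_const LIMSEQ_inverse_real_of_nat])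
        (use t in \<open>auto simp: inverse_eq_divide simp del: of_nat_Suc\<close>)
    then have "filterlim t (at_right 0) sequentially"
      unfolding filterlim_at using tpos t0 by simp
    then have "(\<lambda>n. T (t n) (P z)) \<longlonglongrightarrow> P z" by (rule filterlim_compose[OF T_at_0[OF P(2)]])
    then have "(\<lambda>n. norm (T (t n) (P z))) \<longlonglongrightarrow> norm (P z)" by (rule tendsto_norm)
    then have "Bseq (\<lambda>n. norm (T (t n) (P z)))" by (rule convergent_imp_Bseq[OF convergentI])
    then obtain K where K: "\<And>n. norm (T (t n) (P z)) \<le> K" by (auto simp: Bseq_def)
    obtain n where "6 * K < (4/3) ^ n" using real_arch_pow[of "4/3"] by auto
    with K[of n] z[of n] show False by simp
  qed
  then show ?thesis using that by (metis of_nat_0_less_iff zero_less_Suc zero_less_divide_1_iff zero_less_numeral zero_less_power)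
qed

text \<open>Continuity and differentiability from the left at \<open>t\<close> need a bound on the operators just before \<open>t\<close>.\<close>

lemma T_left_bounded:
  assumes t: "0 \<le> t"
  obtains \<delta> K where "\<delta> > 0" "K > 0"
    "\<And>u x. 0 \<le> u \<Longrightarrow> t - \<delta> \<le> u \<Longrightarrow> u \<le> t \<Longrightarrow> x \<in> X \<Longrightarrow> norm (T u x) \<le> K * norm x"
proof -
  obtain \<delta> M where M: "\<delta> > 0" "M > 0" "\<And>t x. 0 \<le> t \<Longrightarrow> t \<le> \<delta> \<Longrightarrow> x \<in> X \<Longrightarrow> norm (T t x) \<le> M * norm x"
    by (rule T_locally_bounded) (rule that; blast)
  define t' where "t' = max (t - \<delta>) 0"
  have t': "0 \<le> t'" by (simp add: t'_def)
  obtain L where L: "\<forall>x\<in>X. norm (T t' x) \<le> L * norm x" using T_bounded[OF t'] by blast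
  show ?thesis
  proof (rule that[OF M(1)])
    show "(\<bar>L\<bar> + 1) * M > 0" using M(2) by simp
    fix u x assume u: "0 \<le> u" "t - \<delta> \<le> u" "u \<le> t" "x \<in> X"
    define h where "h = u - t'"
    have h: "0 \<le> h" "h \<le> \<delta>" "u = t' + h" using u by (auto simp: h_def t'_def)
    have "norm (T u x) = norm (T t' (T h x))" using h u t' by (simp add: T_plus)
    also have "\<dots> \<le> L * norm (T h x)" using L T_in[OF h(1) u(4)] by blast
    also have "\<dots> \<le> (\<bar>L\<bar> + 1) * norm (T h x)" by (intro mult_right_mono) auto
    also have "\<dots> \<le> (\<bar>L\<bar> + 1) * (M * norm x)" using M(3)[OF h(1,2) u(4)] by (intro mult_left_mono) auto
    finally show "norm (T u x) \<le> (\<bar>L\<bar> + 1) * M * norm x" by (simp add: mult_ac)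
  qed
qed

lemma T_increment:
  assumes "0 \<le> s" "0 \<le> t" "x \<in> X"
  shows "T (max s t) x - T (min s t) x = T (min s t) (T \<bar>s - t\<bar> x - x)"
proof -
  have "max s t = min s t + \<bar>s - t\<bar>" by (auto simp: max_def min_def)
  then show ?thesis using assms by (simp add: T_plus T_diff T_in)
qed

lemma T_continuous:
  assumes x: "x \<in> X"
  shows "continuous_on {0..} (\<lambda>t. T t x)"
  unfolding continuous_on_iff
proof (intro ballI allI impI)
  fix t e :: real assume "t \<in> {0..}" and e: "e > 0"
  then have t: "0 \<le> t" by simp
  obtain \<delta> K where K: "\<delta> > 0" "K > 0" "\<And>u x. 0 \<le> u \<Longrightarrow> t - \<delta> \<le> u \<Longrightarrow> u \<le> t \<Longrightarrow> x \<in> X \<Longrightarrow> norm (T u x) \<le> K * norm x"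
    by (rule T_left_bounded[OF t]) (rule that; blast)
  have "\<forall>\<^sub>F h in at_right 0. dist (T h x) x < e / K"
    using T_at_0[OF x] e K(2) by (intro tendstoD) auto
  then obtain b where b: "b > 0" "\<And>h. 0 < h \<Longrightarrow> h < b \<Longrightarrow> dist (T h x) x < e / K"
    unfolding eventually_at_right_field by auto
  show "\<exists>d>0. \<forall>s\<in>{0..}. dist s t < d \<longrightarrow> dist (T s x) (T t x) < e"
  proof (intro exI[of _ "min b \<delta>"] conjI ballI impI)
    fix s :: real assume s: "s \<in> {0..}" "dist s t < min b \<delta>"
    show "dist (T s x) (T t x) < e"
    proof (cases "s = t")
      case False
      define h where "h = \<bar>s - t\<bar>"
      have h: "0 < h" "h < b" "h < \<delta>" using s False by (auto simp: h_def dist_real_def)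
      have "dist (T s x) (T t x) = norm (T (max s t) x - T (min s t) x)"
        by (auto simp: dist_norm max_def min_def norm_minus_commute)
      also have "\<dots> = norm (T (min s t) (T h x - x))" using T_increment[of s t x] s t x by (simp add: h_def)
      also have "\<dots> \<le> K * norm (T h x - x)"
        by (rule K(3)) (use s t x h X_diff T_in in \<open>auto simp: h_def min_def\<close>)
      also have "\<dots> < K * (e / K)" using b(2)[OF h(1,2)] K(2) by (intro mult_strict_left_mono) (auto simp: dist_norm)
      finally show ?thesis using K(2) by simp
    qed (use e in simp)
  qed (use b K in auto)
qed

text \<open>The generator is defined by a derivative from the right at time zero. An increment to the left of \<open>t\<close> is
  the image of an increment at zero under an operator at an earlier time, and these are uniformly
  bounded.\<close>

lemma T_has_vector_derivative:
  assumes xy: "(x, y) \<in> A" and t: "0 \<le> t"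
  shows "((\<lambda>t. T t x) has_vector_derivative T t y) (at t within {0..})"
  unfolding has_vector_derivative_def has_derivative_within_alt
proof (intro conjI allI impI)
  show "bounded_linear (\<lambda>h. h *\<^sub>R T t y)" by (rule bounded_linear_scaleR_left)
  fix e :: real assume e: "e > 0"
  have x: "x \<in> X" and y: "y \<in> X" using xy by (auto simp: A_iff)
  obtain \<delta> K where K: "\<delta> > 0" "K > 0" "\<And>u x. 0 \<le> u \<Longrightarrow> t - \<delta> \<le> u \<Longrightarrow> u \<le> t \<Longrightarrow> x \<in> X \<Longrightarrow> norm (T u x) \<le> K * norm x"
    by (rule T_left_bounded[OF t]) (rule that; blast)
  have "\<forall>\<^sub>F h in at_right 0. dist ((T h x - x) /\<^sub>R h) y < e / (2 * K)"
    using xy e K(2) by (intro tendstoD) (auto simp: A_iff)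
  then obtain b where b: "b > 0" "\<And>h. 0 < h \<Longrightarrow> h < b \<Longrightarrow> dist ((T h x - x) /\<^sub>R h) y < e / (2 * K)"
    unfolding eventually_at_right_field by auto
  obtain c where c: "c > 0" "\<And>s. 0 \<le> s \<Longrightarrow> dist s t < c \<Longrightarrow> dist (T s y) (T t y) < e / 2"
    using T_continuous[OF y] t e unfolding continuous_on_iff by (metis atLeast_iff half_gt_zero)
  show "\<exists>d>0. \<forall>s\<in>{0..}. norm (s - t) < d \<longrightarrow> norm (T s x - T t x - (s - t) *\<^sub>R T t y) \<le> e * norm (s - t)"
  proof (intro exI[of _ "min (min b \<delta>) c"] conjI ballI impI)
    fix s :: real assume s: "s \<in> {0..}" "norm (s - t) < min (min b \<delta>) c"
    show "norm (T s x - T t x - (s - t) *\<^sub>R T t y) \<le> e * norm (s - t)"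
    proof (cases "s = t")
      case False
      define h where "h = \<bar>s - t\<bar>"
      have h: "0 < h" "h < b" "h < \<delta>" "h < c" using s False by (auto simp: h_def)
      define u where "u = min s t"
      have u: "0 \<le> u" "t - \<delta> \<le> u" "u \<le> t" "dist u t < c" using s t h c by (auto simp: u_def h_def dist_real_def min_def)
      \<comment> \<open>The sign allows increments to the left and to the right to be treated together.\<close>
      define \<sigma> where "\<sigma> = sgn (s - t)"
      have st: "s - t = \<sigma> * h" "\<bar>\<sigma>\<bar> = 1" using False by (auto simp: \<sigma>_def h_def sgn_if)
      have "T s x - T t x = \<sigma> *\<^sub>R (T (max s t) x - T (min s t) x)"
        using False by (auto simp: \<sigma>_def sgn_if max_def min_def)
      also have "\<dots> = \<sigma> *\<^sub>R T u (T h x - x)" using T_increment[of s t x] s t x by (simp add: h_def u_def)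
      finally have "T s x - T t x - (s - t) *\<^sub>R T t y = \<sigma> *\<^sub>R (T u (T h x - x) - h *\<^sub>R T t y)"
        by (simp add: st scaleR_diff_right)
      also have "T u (T h x - x) - h *\<^sub>R T t y = T u (T h x - x - h *\<^sub>R y) + h *\<^sub>R (T u y - T t y)"
        using u(1) h x y by (simp add: T_diff T_scaleR X_diff X_scaleR T_in scaleR_diff_right)
      finally have "norm (T s x - T t x - (s - t) *\<^sub>R T t y) = norm (T u (T h x - x - h *\<^sub>R y) + h *\<^sub>R (T u y - T t y))"
        by (simp add: st)
      also have "\<dots> \<le> norm (T u (T h x - x - h *\<^sub>R y)) + h * norm (T u y - T t y)"
        using h norm_triangle_ineq[of "T u (T h x - x - h *\<^sub>R y)" "h *\<^sub>R (T u y - T t y)"] by simp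
      also have "\<dots> \<le> K * norm (T h x - x - h *\<^sub>R y) + h * (e / 2)"
        using K(3)[OF u(1-3), of "T h x - x - h *\<^sub>R y"] c(2)[OF u(1,4)] h x y
        by (intro add_mono mult_left_mono) (auto simp: dist_norm X_diff X_scaleR T_in)
      also have "norm (T h x - x - h *\<^sub>R y) = h * norm ((T h x - x) /\<^sub>R h - y)"
      proof -
        have "T h x - x - h *\<^sub>R y = h *\<^sub>R ((T h x - x) /\<^sub>R h - y)" using h by (simp add: scaleR_diff_right)
        then show ?thesis using h by simp
      qed
      also have "K * (h * norm ((T h x - x) /\<^sub>R h - y)) + h * (e / 2) \<le> K * (h * (e / (2 * K))) + h * (e / 2)"
        using b(2)[OF h(1,2)] h K(2) by (intro add_mono mult_left_mono) (auto simp: dist_norm)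
      also have "\<dots> = e * norm (s - t)" using K(2) h by (simp add: h_def field_simps)
      finally show ?thesis .
    qed simp
  qed (use b K c in auto)
qed

lemma A_invariant:
  assumes xy: "(x, y) \<in> A" and t: "0 \<le> t"
  shows "(T t x, T t y) \<in> A"
proof -
  have x: "x \<in> X" and y: "y \<in> X" using xy by (auto simp: A_iff)
  have "((\<lambda>h. T t (P ((T h x - x) /\<^sub>R h))) \<longlongrightarrow> T t (P y)) (at_right 0)"
    using xy by (intro bounded_linear.tendsto[OF bounded_linear_T[OF t]]) (auto simp: A_iff)
  moreover have "\<forall>\<^sub>F h in at_right 0. T t (P ((T h x - x) /\<^sub>R h)) = (T h (T t x) - T t x) /\<^sub>R h"
    unfolding eventually_at_right_field
  proof (intro exI[of _ 1] conjI allI impI)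
    fix h :: real assume h: "0 < h"
    have "T h (T t x) = T t (T h x)" using T_plus[of h t x] T_plus[of t h x] h t x by (simp add: add.commute)
    then show "T t (P ((T h x - x) /\<^sub>R h)) = (T h (T t x) - T t x) /\<^sub>R h"
      using h t x by (simp add: P(3) X_scaleR X_diff T_in T_scaleR T_diff)
  qed simp
  ultimately have "((\<lambda>h. (T h (T t x) - T t x) /\<^sub>R h) \<longlongrightarrow> T t (P y)) (at_right 0)"
    by (rule Lim_transform_eventually)
  then show ?thesis using x y t by (simp add: A_iff T_in P(3))
qed

lemma A_diff:
  assumes "(x, y) \<in> A" "(x', y') \<in> A" shows "(x - x', y - y') \<in> A"
proof -
  have X: "x \<in> X" "y \<in> X" "x' \<in> X" "y' \<in> X" using assms by (auto simp: A_iff)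
  have "((\<lambda>h. (T h x - x) /\<^sub>R h - (T h x' - x') /\<^sub>R h) \<longlongrightarrow> y - y') (at_right 0)"
    using assms by (intro tendsto_diff) (auto simp: A_iff)
  then have "((\<lambda>h. (T h (x - x') - (x - x')) /\<^sub>R h) \<longlongrightarrow> y - y') (at_right 0)"
    by (rule Lim_transform_eventually)
      (use X in \<open>auto simp: eventually_at_right_field T_diff scaleR_diff_right algebra_simps intro!: exI[of _ 1]\<close>)
  then show ?thesis using X by (simp add: A_iff X_diff)
qed

lemma A_scaleR:
  assumes "(x, y) \<in> A" shows "(r *\<^sub>R x, r *\<^sub>R y) \<in> A"
proof -
  have X: "x \<in> X" "y \<in> X" using assms by (auto simp: A_iff)
  have "((\<lambda>h. r *\<^sub>R ((T h x - x) /\<^sub>R h)) \<longlongrightarrow> r *\<^sub>R y) (at_right 0)"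
    using assms by (intro tendsto_intros) (auto simp: A_iff)
  then have "((\<lambda>h. (T h (r *\<^sub>R x) - r *\<^sub>R x) /\<^sub>R h) \<longlongrightarrow> r *\<^sub>R y) (at_right 0)"
    by (rule Lim_transform_eventually)
      (use X in \<open>auto simp: eventually_at_right_field T_scaleR scaleR_diff_right mult.commute intro!: exI[of _ 1]\<close>)
  then show ?thesis using X by (simp add: A_iff X_scaleR)
qed

text \<open>Time averages of an orbit lie in the domain of the generator and approximate the initial value. They
  are used to extend estimates from the domain, or from the domain of its square.\<close>

definition mean :: "real \<Rightarrow> 'a \<Rightarrow> 'a" where
  "mean \<epsilon> x = integral {0..\<epsilon>} (\<lambda>s. T s x) /\<^sub>R \<epsilon>"

lemma mean_in_domain:
  assumes x: "x \<in> X" and e: "\<epsilon> > 0"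
  shows "(mean \<epsilon> x, (T \<epsilon> x - x) /\<^sub>R \<epsilon>) \<in> A"
proof -
  define f where "f = (\<lambda>s. T s x)"
  define I where "I = (\<lambda>u. integral {0..u} f)"
  have cont: "continuous_on {0..b} f" for b
    unfolding f_def by (rule continuous_on_subset[OF T_continuous[OF x]]) auto
  have I': "(I has_vector_derivative f u) (at u within {0..b})" if "0 \<le> u" "u \<le> b" for u b
    unfolding I_def by (rule integral_has_vector_derivative[OF cont]) (use that in auto)
  have fint: "f integrable_on {0..b}" for b by (rule integrable_continuous_interval[OF cont])
  have P_int: "P (I b) = I b" for b
  proof -
    have "P (I b) = integral {0..b} (P \<circ> f)" unfolding I_def by (rule integral_linear[OF fint P(1), symmetric])
    also have "\<dots> = I b" unfolding I_def by (rule integral_cong) (auto simp: f_def P(3) T_in x)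
    finally show ?thesis .
  qed
  have IX: "I b \<in> X" for b using P(2)[of "I b"] P_int by simp
  \<comment> \<open>The semigroup translates the orbit in time, so its integral changes only at the two ends.\<close>
  have TI: "T t (I \<epsilon>) = I (\<epsilon> + t) - I (0 + t)" if t: "0 \<le> t" for t
  proof -
    have "T t (I \<epsilon>) = T t (P (I \<epsilon>))" by (simp add: P_int)
    also have "\<dots> = integral {0..\<epsilon>} ((\<lambda>x. T t (P x)) \<circ> f)"
      unfolding I_def by (rule integral_linear[OF fint bounded_linear_T[OF t], symmetric])
    also have "\<dots> = integral {0..\<epsilon>} (\<lambda>u. f (u + t))"
      by (rule integral_cong) (use t x in \<open>auto simp: f_def P(3) T_in add.commute simp flip: T_plus\<close>)
    also have "\<dots> = I (\<epsilon> + t) - I (0 + t)"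
    proof (rule integral_unique, rule fundamental_theorem_of_calculus)
      fix u assume u: "u \<in> {0..\<epsilon>}"
      have "(I \<circ> (\<lambda>u. u + t) has_vector_derivative (1 *\<^sub>R f (u + t))) (at u within {0..\<epsilon>})"
      proof (rule vector_diff_chain_within)
        show "((\<lambda>u. u + t) has_vector_derivative 1) (at u within {0..\<epsilon>})" by (auto intro!: derivative_eq_intros)
        show "(I has_vector_derivative f (u + t)) (at (u + t) within (\<lambda>u. u + t) ` {0..\<epsilon>})"
          by (rule has_vector_derivative_within_subset[OF I'[of "u + t" "\<epsilon> + t"]]) (use u t in auto)
      qed
      then show "((\<lambda>u. I (u + t)) has_vector_derivative f (u + t)) (at u within {0..\<epsilon>})" by (simp add: o_def)
    qed (use e in simp)
    finally show ?thesis .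
  qed
  have I0: "I 0 = 0" by (simp add: I_def)
  have "((\<lambda>h. (I (\<epsilon> + h) - I \<epsilon>) /\<^sub>R h) \<longlongrightarrow> f \<epsilon>) (at_right 0)"
    by (rule has_vector_derivative_quotient_at_right[OF I'[of \<epsilon> "\<epsilon> + 1"], where \<eta>=1]) (use e in auto)
  moreover have "((\<lambda>h. (I (0 + h) - I 0) /\<^sub>R h) \<longlongrightarrow> f 0) (at_right 0)"
    by (rule has_vector_derivative_quotient_at_right[OF I'[of 0 1], where \<eta>=1]) auto
  ultimately have "((\<lambda>h. (I (\<epsilon> + h) - I \<epsilon>) /\<^sub>R h - (I (0 + h) - I 0) /\<^sub>R h) \<longlongrightarrow> f \<epsilon> - f 0) (at_right 0)"
    by (rule tendsto_diff)
  then have "((\<lambda>h. (T h (I \<epsilon>) - I \<epsilon>) /\<^sub>R h) \<longlongrightarrow> f \<epsilon> - f 0) (at_right 0)"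
    by (rule Lim_transform_eventually)
      (auto simp: eventually_at_right_field TI I0 scaleR_diff_right algebra_simps intro!: exI[of _ 1])
  then have "(I \<epsilon>, T \<epsilon> x - x) \<in> A" using IX x e by (simp add: A_iff f_def T_0 T_in X_diff)
  from A_scaleR[OF this, of "inverse \<epsilon>"] show ?thesis by (simp add: mean_def I_def f_def)
qed

lemma mean_tendsto:
  assumes x: "x \<in> X"
  shows "((\<lambda>\<epsilon>. mean \<epsilon> x) \<longlongrightarrow> x) (at_right 0)"
proof -
  have cont: "continuous_on {0..1} (\<lambda>s. T s x)"
    by (rule continuous_on_subset[OF T_continuous[OF x]]) auto
  have "((\<lambda>u. integral {0..u} (\<lambda>s. T s x)) has_vector_derivative T 0 x) (at 0 within {0..1})"
    by (rule integral_has_vector_derivative[OF cont]) auto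
  from has_vector_derivative_quotient_at_right[OF this, where \<eta>=1]
  show ?thesis using x by (simp add: mean_def T_0)
qed

end

section \<open>Contractions and quasimodes\<close>

lemma mult_le_sum_squares:
  fixes a b :: real assumes "0 \<le> a" "0 \<le> b" shows "a * b \<le> a\<^sup>2 + b\<^sup>2"
proof -
  have "2 * (a * b) \<le> a\<^sup>2 + b\<^sup>2" using sum_squares_bound[of a b] by (simp only: mult.assoc)
  moreover have "0 \<le> a * b" by (rule mult_nonneg_nonneg[OF assms])
  ultimately show ?thesis by linarith
qed

context c0_semigroup begin

lemma T_quadratic_form_derivative:
  assumes B: "bounded_linear B" "\<And>x y. inner (B x) y = inner x (B y)"
    and xy: "(x, y) \<in> A" and t: "0 \<le> t"
  shows "((\<lambda>t. inner (B (T t x)) (T t x)) has_vector_derivative 2 * inner (B (T t y)) (T t x)) (at t within {0..})"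
proof -
  have d: "((\<lambda>t. T t x) has_derivative (\<lambda>h. h *\<^sub>R T t y)) (at t within {0..})"
    using T_has_vector_derivative[OF xy t] by (simp add: has_vector_derivative_def)
  have dB: "((\<lambda>t. B (T t x)) has_derivative (\<lambda>h. B (h *\<^sub>R T t y))) (at t within {0..})"
    by (rule bounded_linear.has_derivative[OF B(1) d])
  have "((\<lambda>t. inner (B (T t x)) (T t x)) has_derivative
      (\<lambda>h. inner (B (T t x)) (h *\<^sub>R T t y) + inner (B (h *\<^sub>R T t y)) (T t x))) (at t within {0..})"
    by (rule has_derivative_inner[OF dB d])
  moreover have "(\<lambda>h. inner (B (T t x)) (h *\<^sub>R T t y) + inner (B (h *\<^sub>R T t y)) (T t x))
      = (\<lambda>h. h *\<^sub>R (2 * inner (B (T t y)) (T t x)))"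
  proof
    fix h :: real
    have 1: "inner (B (T t x)) (T t y) = inner (B (T t y)) (T t x)"
      by (subst B(2)) (rule inner_commute)
    have 2: "B (h *\<^sub>R T t y) = h *\<^sub>R B (T t y)"
      by (rule linear_scale[OF bounded_linear.linear[OF B(1)]])
    show "inner (B (T t x)) (h *\<^sub>R T t y) + inner (B (h *\<^sub>R T t y)) (T t x) = h *\<^sub>R (2 * inner (B (T t y)) (T t x))"
      unfolding 2 inner_scaleR_left inner_scaleR_right 1 by simp
  qed
  ultimately show ?thesis by (simp add: has_vector_derivative_def)
qed

lemmas T_norm_derivative = T_quadratic_form_derivative[where B="\<lambda>x. x", OF bounded_linear_ident refl]

text \<open>On the domain the squared norm has derivative \<open>2 \<langle>A T(t) x, T(t) x\<rangle>\<close>; time averages extend the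
  estimate to all of \<open>X\<close>.\<close>

lemma contraction:
  assumes diss: "\<And>x y. (x, y) \<in> A \<Longrightarrow> inner y x \<le> 0" and t: "0 \<le> t" and x: "x \<in> X"
  shows "norm (T t x) \<le> norm x"
proof -
  have dom: "norm (T t x) \<le> norm x" if xy: "(x, y) \<in> A" for x y
  proof -
    have "inner (T t x) (T t x) \<le> inner (T 0 x) (T 0 x)"
      by (rule nonincreasing_on_nonneg[OF T_norm_derivative[OF xy] _ t])
        (use diss A_invariant[OF xy] in auto)
    then have "(norm (T t x))\<^sup>2 \<le> (norm x)\<^sup>2" using A_in(1)[OF xy] by (simp add: T_0 power2_norm_eq_inner)
    then show ?thesis by (rule power2_le_imp_le) simp
  qed
  have "((\<lambda>\<epsilon>. norm (T t (P (mean \<epsilon> x)))) \<longlongrightarrow> norm (T t (P x))) (at_right 0)"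
    by (intro tendsto_norm bounded_linear.tendsto[OF bounded_linear_T[OF t]] mean_tendsto x)
  moreover have "((\<lambda>\<epsilon>. norm (mean \<epsilon> x)) \<longlongrightarrow> norm x) (at_right 0)"
    by (intro tendsto_norm mean_tendsto x)
  moreover have "\<forall>\<^sub>F \<epsilon> in at_right 0. norm (T t (P (mean \<epsilon> x))) \<le> norm (mean \<epsilon> x)"
    using dom[OF mean_in_domain[OF x]] A_in(1)[OF mean_in_domain[OF x]]
    by (auto simp: eventually_at_right_field P(3) intro!: exI[of _ 1])
  ultimately have "norm (T t (P x)) \<le> norm x"
    by (intro tendsto_le[OF trivial_limit_at_right_real])
  then show ?thesis using x by (simp add: P(3))
qed

text \<open>The orbit multiplied by \<open>exp(-\<i> s t)\<close> has derivative of norm at most \<open>\<parallel>\<i> s x - y\<parallel>\<close>: an approximate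
  eigenvector can lose norm only at this speed.\<close>

lemma phase_bound:
  assumes contr: "\<And>t x. 0 \<le> t \<Longrightarrow> x \<in> X \<Longrightarrow> norm (T t x) \<le> norm x"
    and xy: "(x, y) \<in> A" and t: "0 \<le> t"
  shows "norm x \<le> norm (T t x) + t * norm (scaleC (\<i> * of_real s) x - y)"
proof -
  have X: "x \<in> X" "y \<in> X" using A_in[OF xy] by auto
  define z where "z = y - scaleC (\<i> * of_real s) x"
  have z: "z \<in> X" using X by (simp add: z_def X_diff X_scaleC)
  define e where "e = (\<lambda>r. exp (- (\<i> * of_real s) * of_real r))"
  have e1: "cmod (e r) = 1" for r by (simp add: e_def norm_exp_eq_Re)
  have de: "(e has_vector_derivative (- (\<i> * of_real s) * e r)) (at r within {0..})" for r :: real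
  proof -
    have "((\<lambda>w. exp (- (\<i> * of_real s) * w)) has_field_derivative (- (\<i> * of_real s) * e r)) (at (of_real r))"
      unfolding e_def by (auto intro!: derivative_eq_intros)
    then have "((\<lambda>w. exp (- (\<i> * of_real s) * of_real w)) has_vector_derivative (- (\<i> * of_real s) * e r)) (at r)"
      by (rule has_vector_derivative_real_field)
    then show ?thesis unfolding e_def by (rule has_vector_derivative_at_within)
  qed
  have der: "((\<lambda>r. scaleC (e r) (T r x)) has_derivative (\<lambda>h. h *\<^sub>R scaleC (e r) (T r z))) (at r within {0..t})"
    if r: "0 \<le> r" for r
  proof -
    have "((\<lambda>r. scaleC (e r) (T r x)) has_vector_derivative
        (scaleC (e r) (T r y) + scaleC (- (\<i> * of_real s) * e r) (T r x))) (at r within {0..})"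
      by (rule bounded_bilinear.has_vector_derivative[OF bounded_bilinear_scaleC de T_has_vector_derivative[OF xy r]])
    moreover have "scaleC (e r) (T r y) + scaleC (- (\<i> * of_real s) * e r) (T r x) = scaleC (e r) (T r z)"
    proof -
      have "T r z = T r y - scaleC (\<i> * of_real s) (T r x)"
        using X r by (simp add: z_def T_diff T_scaleC X_scaleC)
      moreover have "scaleC (- (\<i> * of_real s) * e r) (T r x) = - scaleC (e r) (scaleC (\<i> * of_real s) (T r x))"
        by (simp only: scaleC_scaleC bounded_bilinear.minus_left[OF bounded_bilinear_scaleC, symmetric] mult_minus_left mult_minus_right mult.commute)
      ultimately show ?thesis by (simp add: scaleC_diff_right)
    qed
    ultimately have "((\<lambda>r. scaleC (e r) (T r x)) has_vector_derivative scaleC (e r) (T r z)) (at r within {0..})" by simp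
    then have "((\<lambda>r. scaleC (e r) (T r x)) has_vector_derivative scaleC (e r) (T r z)) (at r within {0..t})"
      by (rule has_vector_derivative_within_subset) auto
    then show ?thesis by (simp add: has_vector_derivative_def)
  qed
  have *: "norm (scaleC (e t) (T t x) - scaleC (e 0) (T 0 x)) \<le> norm z * norm (t - 0)"
  proof (rule differentiable_bound[where S="{0..t}"])
    show "onorm (\<lambda>h. h *\<^sub>R scaleC (e r) (T r z)) \<le> norm z" if "r \<in> {0..t}" for r
    proof (rule onorm_le)
      fix h :: real
      show "norm (h *\<^sub>R scaleC (e r) (T r z)) \<le> norm z * norm h"
        using contr[of r z] z that by (simp add: e1 mult.commute mult_left_mono)
    qed
  qed (use der t in auto)
  have "norm (scaleC (e t) (T t x) - x) \<le> t * norm z"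
  proof -
    have "scaleC (e 0) (T 0 x) = x" using X scaleC_of_real[of 1 x] by (simp add: e_def T_0)
    with * show ?thesis using t by (simp add: mult.commute)
  qed
  moreover have "norm x \<le> norm (scaleC (e t) (T t x)) + norm (scaleC (e t) (T t x) - x)"
    using norm_triangle_ineq4[of "scaleC (e t) (T t x)" "scaleC (e t) (T t x) - x"] by simp
  moreover have "norm z = norm (scaleC (\<i> * of_real s) x - y)" by (simp add: z_def norm_minus_commute)
  ultimately show ?thesis by (simp add: e1)
qed

text \<open>Up to the time \<open>sqrt s / (2 c)\<close> half of the norm of a quasimode persists. Decay with exponent \<open>1 / d\<close>
  would bound it by the graph norm, of order \<open>s\<close>, times a quantity of order \<open>s\<close> to the power
  \<open>- 1 / (2 d)\<close>; for \<open>1 / d > 2\<close> this product tends to zero.\<close>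

lemma quasimodes_exclude_fast_decay:
  assumes contr: "\<And>t x. 0 \<le> t \<Longrightarrow> x \<in> X \<Longrightarrow> norm (T t x) \<le> norm x"
    and c: "c > 0"
    and quasi: "\<And>s0. \<exists>s\<ge>s0. \<exists>x y. (x, y) \<in> A \<and> x \<noteq> 0 \<and> norm (scaleC (\<i> * of_real s) x - y) \<le> c / sqrt s * norm x"
    and d: "1 / d > 2"
  shows "\<not> polynomial_decay X A T d"
proof
  assume "polynomial_decay X A T d"
  from this[unfolded polynomial_decay_def, THEN spec, of 1] obtain C where C: "C > 0"
    and *: "\<forall>t\<ge>0. \<forall>x\<in>X. \<forall>y. (x, y) \<in> A ^^ 1 \<longrightarrow>
      norm (T t x) \<le> C / (1 + t) powr (real 1 / d) * sqrt ((norm x)\<^sup>2 + (norm y)\<^sup>2)"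
    by (elim exE conjE)
  define \<gamma> where "\<gamma> = 1 / d"
  have \<gamma>: "\<gamma> > 2" using d by (simp add: \<gamma>_def)
  define D where "D = C * (2 + c) * (2 * c) powr \<gamma>"
  have "((\<lambda>u. D * u powr (2 - \<gamma>)) \<longlongrightarrow> D * 0) at_top"
    by (intro tendsto_mult tendsto_const tendsto_neg_powr filterlim_ident) (use \<gamma> in simp)
  then have "\<forall>\<^sub>F u in at_top. D * u powr (2 - \<gamma>) < 1/2" by (rule order_tendstoD(2)) simp
  then obtain u0 where u0: "\<And>u. u \<ge> u0 \<Longrightarrow> D * u powr (2 - \<gamma>) < 1/2" by (auto simp: eventually_at_top_linorder)
  obtain s x y where s: "s \<ge> 1 + u0\<^sup>2" and xy: "(x, y) \<in> A" "x \<noteq> 0"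
      "norm (scaleC (\<i> * of_real s) x - y) \<le> c / sqrt s * norm x"
    using quasi by blast
  define u where "u = sqrt s"
  have s1: "s \<ge> 1" using s zero_le_power2[of u0] by linarith
  have u: "u \<ge> 1" "u\<^sup>2 = s" "u \<ge> u0"
  proof -
    show "u \<ge> 1" "u\<^sup>2 = s" using s1 by (simp_all add: u_def)
    have "\<bar>u0\<bar> \<le> u" unfolding u_def by (rule real_le_rsqrt) (use s in simp)
    then show "u \<ge> u0" by linarith
  qed
  define a where "a = norm x"
  have a: "a > 0" using xy by (simp add: a_def)
  define t where "t = u / (2 * c)"
  have t: "t > 0" using u c by (simp add: t_def)
  define \<rho> where "\<rho> = norm (scaleC (\<i> * of_real s) x - y)"
  have \<rho>: "\<rho> \<le> c / u * a" using xy(3) by (simp add: \<rho>_def u_def a_def)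
  have "t * \<rho> \<le> t * (c / u * a)" using \<rho> t by (intro mult_left_mono) auto
  also have "\<dots> = a / 2" using u c by (simp add: t_def)
  finally have t\<rho>: "t * \<rho> \<le> a / 2" .
  have ny: "norm y \<le> (s + c) * a"
  proof -
    have "norm y \<le> norm (scaleC (\<i> * of_real s) x) + \<rho>"
      unfolding \<rho>_def using norm_triangle_ineq4[of "scaleC (\<i> * of_real s) x" "scaleC (\<i> * of_real s) x - y"] by simp
    also have "norm (scaleC (\<i> * of_real s) x) = s * a" using s1 by (simp add: norm_mult a_def)
    also have "\<rho> \<le> c * a"
    proof -
      have "c / u \<le> c / 1" using u c by (intro divide_left_mono) auto
      then show ?thesis using \<rho> a mult_right_mono[of "c / u" c a] by simp
    qed
    finally show ?thesis by (simp add: algebra_simps)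
  qed
  have "a \<le> norm (T t x) + t * \<rho>"
    unfolding a_def \<rho>_def by (rule phase_bound[OF contr xy(1)]) (use t in auto)
  then have "a / 2 \<le> norm (T t x)" using t\<rho> by linarith
  also have "\<dots> \<le> C / (1 + t) powr \<gamma> * sqrt ((norm x)\<^sup>2 + (norm y)\<^sup>2)"
    using *[rule_format, of t x y] t xy(1) A_in[OF xy(1)] by (simp add: \<gamma>_def)
  also have "\<dots> \<le> C / t powr \<gamma> * ((2 + c) * s * a)"
  proof (rule mult_mono)
    show "C / (1 + t) powr \<gamma> \<le> C / t powr \<gamma>"
      using C t \<gamma> by (intro divide_left_mono powr_mono2) auto
    have "sqrt ((norm x)\<^sup>2 + (norm y)\<^sup>2) \<le> a + norm y" unfolding a_def by (rule sqrt_sum_squares_le_sum) auto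
    also have "\<dots> \<le> a + (s + c) * a" using ny by simp
    also have "\<dots> = (1 + s + c) * a" by (simp add: algebra_simps)
    also have "\<dots> \<le> (2 + c) * s * a"
    proof (rule mult_right_mono)
      have "c * 1 \<le> c * s" using c s1 by (intro mult_left_mono) auto
      then show "1 + s + c \<le> (2 + c) * s" using s1 by (simp add: algebra_simps)
    qed (use a in simp)
    finally show "sqrt ((norm x)\<^sup>2 + (norm y)\<^sup>2) \<le> (2 + c) * s * a" .
  qed (use C t in auto)
  also have "\<dots> = (D * u powr (2 - \<gamma>)) * a"
  proof -
    have "t powr \<gamma> = u powr \<gamma> / (2 * c) powr \<gamma>" using u c by (simp add: t_def powr_divide)
    moreover have "s = u powr 2" using u by (simp add: powr_numeral)
    ultimately show ?thesis using u by (simp add: D_def powr_diff)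
  qed
  also have "\<dots> < 1/2 * a" using u0[OF u(3)] a by (intro mult_strict_right_mono) auto
  finally show False by simp
qed

end

section \<open>Decay from a Lyapunov functional\<close>

text \<open>The abstract mechanism of the decay. For \<open>(x, y)\<close> in \<open>A\<close> the number \<open>d\<close> measures the dissipation. The form
  \<open>\<langle>B x, x\<rangle>\<close> changes along orbits with speed \<open>2 \<langle>B y, x\<rangle>\<close>, so the last inequality says that the energy is
  controlled by this speed, by the dissipation, and by a part \<open>N\<close> of the velocity \<open>y\<close> that is itself
  controlled by the dissipation along the orbit of \<open>y\<close>.\<close>

locale coercive_semigroup = c0_semigroup +
  fixes B :: "'a \<Rightarrow> 'a" and N :: "'a \<Rightarrow> real" and \<delta> C :: real
  assumes B: "bounded_linear B" "\<And>x y. inner (B x) y = inner x (B y)"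
    and N: "\<And>x. 0 \<le> N x" "\<And>x. N x \<le> norm x"
    and pos: "\<delta> > 0" "C \<ge> 0"
    and diss: "\<And>x y. (x, y) \<in> A \<Longrightarrow> \<exists>d\<ge>0. inner y x \<le> - \<delta> * d\<^sup>2 \<and> N x \<le> C * d \<and>
        (norm x)\<^sup>2 \<le> - 2 * inner (B y) x + C * d\<^sup>2 + C * d * N y"
begin

lemma dissipative: "(x, y) \<in> A \<Longrightarrow> inner y x \<le> 0"
proof -
  assume "(x, y) \<in> A"
  then obtain d where "inner y x \<le> - \<delta> * d\<^sup>2" using diss by blast
  moreover have "0 \<le> \<delta> * d\<^sup>2" using pos by simp
  ultimately show ?thesis by simp
qed

lemma T_contraction: "0 \<le> t \<Longrightarrow> x \<in> X \<Longrightarrow> norm (T t x) \<le> norm x"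
  by (rule contraction) (rule dissipative)

text \<open>The coercivity inequality, with the dissipation estimated by \<open>\<parallel>x\<parallel> \<parallel>y\<parallel>\<close>, is a quadratic inequality
  for \<open>\<parallel>x\<parallel>\<close> whose other terms are of the form \<open>\<parallel>x\<parallel> \<parallel>y\<parallel>\<close> and \<open>\<parallel>y\<parallel>\<^sup>2\<close>.\<close>

lemma domain_norm_le:
  obtains K where "K \<ge> 0" "\<And>x y. (x, y) \<in> A \<Longrightarrow> norm x \<le> K * norm y"
proof -
  define b where "b = onorm B"
  have b: "b \<ge> 0" "\<And>x. norm (B x) \<le> b * norm x" using onorm_pos_le[OF B(1)] onorm[OF B(1)] by (auto simp: b_def)
  define M where "M = 2 * b + 2 * (C / \<delta>)"
  have M: "M \<ge> 0" using b pos by (simp add: M_def)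
  have "norm x \<le> (M + C + 1) * norm y" if xy: "(x, y) \<in> A" for x y
  proof (rule ccontr)
    assume "\<not> ?thesis"
    then have less: "(M + C + 1) * norm y < norm x" by simp
    obtain d where d: "d \<ge> 0" "inner y x \<le> - \<delta> * d\<^sup>2"
        "(norm x)\<^sup>2 \<le> - 2 * inner (B y) x + C * d\<^sup>2 + C * d * N y"
      using diss[OF xy] by blast
    have "\<delta> * d\<^sup>2 \<le> norm x * norm y"
      using d(2) Cauchy_Schwarz_ineq2[of y x] by (simp add: mult.commute)
    define p where "p = norm x * norm y / \<delta>"
    from \<open>\<delta> * d\<^sup>2 \<le> norm x * norm y\<close> have d2: "d\<^sup>2 \<le> p" using pos by (simp add: p_def field_simps)
    have "\<bar>inner (B y) x\<bar> \<le> norm (B y) * norm x" by (rule Cauchy_Schwarz_ineq2)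
    also have "\<dots> \<le> b * norm y * norm x" by (intro mult_right_mono b) auto
    finally have 1: "- 2 * inner (B y) x \<le> 2 * (b * norm y * norm x)" by linarith
    have "d * N y \<le> d * norm y" using d N by (intro mult_left_mono) auto
    also have "\<dots> \<le> d\<^sup>2 + (norm y)\<^sup>2" by (rule mult_le_sum_squares[OF d(1) norm_ge_zero])
    also have "\<dots> \<le> p + (norm y)\<^sup>2" using d2 by simp
    finally have "C * (d * N y) \<le> C * (p + (norm y)\<^sup>2)" by (rule mult_left_mono[OF _ pos(2)])
    then have 2: "C * d * N y \<le> C * p + C * (norm y)\<^sup>2" by (simp only: mult.assoc distrib_left)
    have 3: "C * d\<^sup>2 \<le> C * p" by (rule mult_left_mono[OF d2 pos(2)])
    have 4: "M * norm x * norm y = 2 * (b * norm y * norm x) + (C * p + C * p)"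
      by (simp add: M_def p_def algebra_simps)
    have "(norm x)\<^sup>2 \<le> 2 * (b * norm y * norm x) + C * p + (C * p + C * (norm y)\<^sup>2)"
      by (rule order_trans[OF d(3)]) (intro add_mono 1 2 3)
    also have "\<dots> = M * norm x * norm y + C * (norm y)\<^sup>2" unfolding 4 by simp
    also have "\<dots> \<le> M * norm x * norm y + C * (norm x * norm y)"
    proof -
      have "1 * norm y \<le> (M + C + 1) * norm y" using M pos by (intro mult_right_mono) auto
      then have "norm y * norm y \<le> norm x * norm y" using less by (intro mult_right_mono) auto
      then show ?thesis using pos by (simp add: power2_eq_square mult_left_mono)
    qed
    also have "\<dots> = (M + C) * norm y * norm x" by (simp add: algebra_simps)
    finally have "norm x * norm x \<le> ((M + C) * norm y) * norm x" by (simp add: power2_eq_square)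
    moreover have "0 \<le> (M + C + 1) * norm y" using M pos by (intro mult_nonneg_nonneg) auto
    then have "norm x > 0" using less by linarith
    ultimately have "norm x \<le> (M + C) * norm y" by simp
    moreover have "(M + C + 1) * norm y = (M + C) * norm y + norm y" by (simp add: algebra_simps)
    ultimately show False using less norm_ge_zero[of y] by linarith
  qed
  then show ?thesis using M pos by (intro that[of "M + C + 1"]) auto
qed

text \<open>The Lyapunov functional is \<open>\<langle>B u, u\<rangle> + k \<parallel>u\<parallel>\<^sup>2 + k \<parallel>v\<parallel>\<^sup>2\<close> for the orbits \<open>u\<close> of \<open>x\<close> and \<open>v\<close> of \<open>A x\<close>. For
  large \<open>k\<close> its derivative is at most \<open>- \<parallel>u\<parallel>\<^sup>2\<close>; since \<open>\<parallel>u\<parallel>\<close> decreases, adding \<open>t \<parallel>u\<parallel>\<^sup>2\<close> keeps it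
  nonincreasing.\<close>

lemma decay_on_domain_of_square:
  obtains K where "K \<ge> 0"
    "\<And>x y z t. (x, y) \<in> A \<Longrightarrow> (y, z) \<in> A \<Longrightarrow> 0 \<le> t \<Longrightarrow> t * (norm (T t x))\<^sup>2 \<le> K * ((norm x)\<^sup>2 + (norm y)\<^sup>2)"
proof -
  define b where "b = onorm B"
  have b: "b \<ge> 0" "\<And>x. norm (B x) \<le> b * norm x" using onorm_pos_le[OF B(1)] onorm[OF B(1)] by (auto simp: b_def)
  have Bx: "\<bar>inner (B x) x\<bar> \<le> b * (norm x)\<^sup>2" for x
  proof -
    have "\<bar>inner (B x) x\<bar> \<le> norm (B x) * norm x" by (rule Cauchy_Schwarz_ineq2)
    also have "\<dots> \<le> b * norm x * norm x" by (intro mult_right_mono b) auto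
    finally show ?thesis by (simp add: power2_eq_square mult.assoc)
  qed
  \<comment> \<open>The first summand absorbs the dissipation terms, the second makes the functional dominate the
      form of \<open>B\<close>.\<close>
  define k where "k = (C + C * C) / (2 * \<delta>) + b"
  have k: "k \<ge> b" "2 * (k * \<delta>) \<ge> C + C * C" "k \<ge> 0" using b pos by (auto simp: k_def field_simps)
  have "t * (norm (T t x))\<^sup>2 \<le> (b + k) * ((norm x)\<^sup>2 + (norm y)\<^sup>2)"
    if xy: "(x, y) \<in> A" and yz: "(y, z) \<in> A" and t: "0 \<le> t" for x y z t
  proof -
    define V where "V = (\<lambda>t. inner (B (T t x)) (T t x) + (k * inner (T t x) (T t x) + k * inner (T t y) (T t y)) + t * inner (T t x) (T t x))"
    define V' where "V' = (\<lambda>t. 2 * inner (B (T t y)) (T t x) + (k * (2 * inner (T t y) (T t x)) + k * (2 * inner (T t z) (T t y)))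
        + (t * (2 * inner (T t y) (T t x)) + 1 * inner (T t x) (T t x)))"
    have "V t \<le> V 0"
    proof (rule nonincreasing_on_nonneg[OF _ _ t])
      fix t :: real assume t: "0 \<le> t"
      note dx = T_norm_derivative[OF xy t] and dy = T_norm_derivative[OF yz t]
      have id: "((\<lambda>t. t) has_vector_derivative 1) (at t within {0..})" by (auto intro!: derivative_eq_intros)
      have "((\<lambda>t. k * inner (T t x) (T t x)) has_vector_derivative k * (2 * inner (T t y) (T t x))) (at t within {0..})"
           "((\<lambda>t. k * inner (T t y) (T t y)) has_vector_derivative k * (2 * inner (T t z) (T t y))) (at t within {0..})"
        using has_vector_derivative_mult_right[OF dx] has_vector_derivative_mult_right[OF dy] by blast+
      then show "(V has_vector_derivative V' t) (at t within {0..})"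
        unfolding V_def V'_def
        by (intro has_vector_derivative_add T_quadratic_form_derivative[OF B xy t]
          has_vector_derivative_mult[OF id dx])
      obtain d where d: "d \<ge> 0" "inner (T t y) (T t x) \<le> - \<delta> * d\<^sup>2"
        "(norm (T t x))\<^sup>2 \<le> - 2 * inner (B (T t y)) (T t x) + C * d\<^sup>2 + C * d * N (T t y)"
        using diss[OF A_invariant[OF xy t]] by blast
      obtain e where e: "e \<ge> 0" "inner (T t z) (T t y) \<le> - \<delta> * e\<^sup>2" "N (T t y) \<le> C * e"
        using diss[OF A_invariant[OF yz t]] by blast
      have "C * d * N (T t y) \<le> C * d * (C * e)" using e d pos by (intro mult_left_mono) auto
      also have "\<dots> = (C * C) * (d * e)" by simp
      also have "\<dots> \<le> (C * C) * (d\<^sup>2 + e\<^sup>2)"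
      proof (rule mult_left_mono)
        show "d * e \<le> d\<^sup>2 + e\<^sup>2" by (rule mult_le_sum_squares[OF d(1) e(1)])
      qed simp
      finally have 1: "(norm (T t x))\<^sup>2 \<le> - 2 * inner (B (T t y)) (T t x) + C * d\<^sup>2 + (C * C) * (d\<^sup>2 + e\<^sup>2)"
        using d(3) by simp
      have 2: "C * d\<^sup>2 + (C * C) * (d\<^sup>2 + e\<^sup>2) \<le> (C + C * C) * (d\<^sup>2 + e\<^sup>2)" using pos by (simp add: algebra_simps)
      have 3: "(C + C * C) * (d\<^sup>2 + e\<^sup>2) \<le> 2 * (k * \<delta>) * (d\<^sup>2 + e\<^sup>2)" by (intro mult_right_mono k) auto
      have 4: "k * (2 * inner (T t y) (T t x)) \<le> k * (2 * (- \<delta> * d\<^sup>2))" using d(2) k by (intro mult_left_mono) auto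
      have 5: "k * (2 * inner (T t z) (T t y)) \<le> k * (2 * (- \<delta> * e\<^sup>2))" using e(2) k by (intro mult_left_mono) auto
      have 6: "t * (2 * inner (T t y) (T t x)) \<le> 0"
        using t dissipative[OF A_invariant[OF xy t]] by (intro mult_nonneg_nonpos) auto
      have 7: "k * (2 * (- \<delta> * d\<^sup>2)) + k * (2 * (- \<delta> * e\<^sup>2)) = - (2 * (k * \<delta>) * (d\<^sup>2 + e\<^sup>2))" by (simp add: algebra_simps)
      show "V' t \<le> 0"
        using 1 2 3 4 5 6 7 unfolding V'_def power2_norm_eq_inner mult_1 by linarith
    qed
    moreover have "t * (norm (T t x))\<^sup>2 \<le> V t"
    proof -
      have "- inner (B (T t x)) (T t x) \<le> k * (norm (T t x))\<^sup>2"
        using Bx[of "T t x"] mult_right_mono[OF k(1), of "(norm (T t x))\<^sup>2"] by simp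
      moreover have "0 \<le> k * inner (T t y) (T t y)" using k by simp
      ultimately show ?thesis unfolding V_def power2_norm_eq_inner by linarith
    qed
    moreover have "V 0 \<le> (b + k) * ((norm x)\<^sup>2 + (norm y)\<^sup>2)"
    proof -
      have "V 0 \<le> b * (norm x)\<^sup>2 + (k * (norm x)\<^sup>2 + k * (norm y)\<^sup>2)"
        unfolding V_def using Bx[of x] A_in[OF xy] A_in[OF yz] by (simp add: T_0 power2_norm_eq_inner)
      also have "\<dots> \<le> (b + k) * ((norm x)\<^sup>2 + (norm y)\<^sup>2)" using b by (simp add: algebra_simps)
      finally show ?thesis .
    qed
    ultimately show ?thesis by linarith
  qed
  then show ?thesis using b k by (intro that[of "b + k"]) auto
qed

text \<open>The time average of \<open>x\<close> lies in the domain of the square of \<open>A\<close>, because \<open>A\<close> maps it to a difference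
  quotient of the orbit of \<open>x\<close>, and the graph norms converge.\<close>

lemma decay_on_domain:
  obtains K where "K \<ge> 0"
    "\<And>x y t. (x, y) \<in> A \<Longrightarrow> 0 \<le> t \<Longrightarrow> t * (norm (T t x))\<^sup>2 \<le> K * ((norm x)\<^sup>2 + (norm y)\<^sup>2)"
proof -
  obtain K where K: "K \<ge> 0" "\<And>x y z t. (x, y) \<in> A \<Longrightarrow> (y, z) \<in> A \<Longrightarrow> 0 \<le> t \<Longrightarrow> t * (norm (T t x))\<^sup>2 \<le> K * ((norm x)\<^sup>2 + (norm y)\<^sup>2)"
    using decay_on_domain_of_square by metis
  have "t * (norm (T t x))\<^sup>2 \<le> K * ((norm x)\<^sup>2 + (norm y)\<^sup>2)" if xy: "(x, y) \<in> A" and t: "0 \<le> t" for x y t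
  proof -
    have x: "x \<in> X" using A_in[OF xy] by simp
    have "((\<lambda>\<epsilon>. t * (norm (T t (P (mean \<epsilon> x))))\<^sup>2) \<longlongrightarrow> t * (norm (T t (P x)))\<^sup>2) (at_right 0)"
      by (intro tendsto_intros bounded_linear.tendsto[OF bounded_linear_T[OF t]] mean_tendsto x)
    moreover have "((\<lambda>\<epsilon>. K * ((norm (mean \<epsilon> x))\<^sup>2 + (norm ((T \<epsilon> x - x) /\<^sub>R \<epsilon>))\<^sup>2)) \<longlongrightarrow> K * ((norm x)\<^sup>2 + (norm y)\<^sup>2)) (at_right 0)"
      by (intro tendsto_intros mean_tendsto x) (use xy in \<open>simp add: A_iff\<close>)
    moreover have "\<forall>\<^sub>F \<epsilon> in at_right 0. t * (norm (T t (P (mean \<epsilon> x))))\<^sup>2 \<le> K * ((norm (mean \<epsilon> x))\<^sup>2 + (norm ((T \<epsilon> x - x) /\<^sub>R \<epsilon>))\<^sup>2)"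
      unfolding eventually_at_right_field
    proof (intro exI[of _ 1] conjI allI impI)
      fix \<epsilon> :: real assume e: "0 < \<epsilon>"
      note m = mean_in_domain[OF x e]
      have "((T \<epsilon> x - x) /\<^sub>R \<epsilon>, (T \<epsilon> y - y) /\<^sub>R \<epsilon>) \<in> A"
        using e by (intro A_scaleR A_diff A_invariant xy) auto
      from K(2)[OF m this t] show "t * (norm (T t (P (mean \<epsilon> x))))\<^sup>2 \<le> K * ((norm (mean \<epsilon> x))\<^sup>2 + (norm ((T \<epsilon> x - x) /\<^sub>R \<epsilon>))\<^sup>2)"
        using P(3)[OF A_in(1)[OF m]] by simp
    qed simp
    ultimately have "t * (norm (T t (P x)))\<^sup>2 \<le> K * ((norm x)\<^sup>2 + (norm y)\<^sup>2)"
      by (intro tendsto_le[OF trivial_limit_at_right_real])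
    then show ?thesis using x by (simp add: P(3))
  qed
  then show ?thesis using K(1) that by blast
qed

text \<open>Splitting the time into two halves and spending one application of \<open>A\<close> on each step of the induction
  multiplies the rates. The lower bound for \<open>A\<close> removes the term \<open>\<parallel>x\<parallel>\<close> from the graph norm, without which
  the induction would not close.\<close>

lemma decay_on_domain_of_power:
  "\<exists>K>0. \<forall>t\<ge>(0::real). \<forall>x\<in>X. \<forall>y. (x, y) \<in> A ^^ k \<longrightarrow> norm (T t x) \<le> K / (1 + t) powr (real k / 2) * norm y"
proof (induction k)
  case 0
  show ?case using T_contraction by (intro exI[of _ 1]) auto
next
  case (Suc k)
  then obtain K where K: "K > 0" "\<And>(t::real) x y. 0 \<le> t \<Longrightarrow> x \<in> X \<Longrightarrow> (x, y) \<in> A ^^ k \<Longrightarrow> norm (T t x) \<le> K / (1 + t) powr (real k / 2) * norm y"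
    by blast
  obtain L where L: "L \<ge> 0" "\<And>x y. (x, y) \<in> A \<Longrightarrow> norm x \<le> L * norm y" using domain_norm_le by metis
  obtain M where M: "M \<ge> 0" "\<And>x y t. (x, y) \<in> A \<Longrightarrow> 0 \<le> t \<Longrightarrow> t * (norm (T t x))\<^sup>2 \<le> M * ((norm x)\<^sup>2 + (norm y)\<^sup>2)"
    using decay_on_domain by metis
  define Q where "Q = sqrt ((M + 1) * (L\<^sup>2 + 1)) + 1"
  have Q: "Q > 0" using M(1) by (simp add: Q_def add_nonneg_pos)
  have one: "norm (T s x) \<le> Q / (1 + s) powr (1/2) * norm y" if xy: "(x, y) \<in> A" and s: "0 \<le> s" for x y s
  proof -
    have "(1 + s) * (norm (T s x))\<^sup>2 = (norm (T s x))\<^sup>2 + s * (norm (T s x))\<^sup>2" by (simp add: algebra_simps)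
    also have "\<dots> \<le> (norm x)\<^sup>2 + M * ((norm x)\<^sup>2 + (norm y)\<^sup>2)"
      using T_contraction[OF s A_in(1)[OF xy]] M(2)[OF xy s] by (intro add_mono power_mono) auto
    also have "\<dots> \<le> (M + 1) * ((norm x)\<^sup>2 + (norm y)\<^sup>2)" by (simp add: algebra_simps)
    also have "\<dots> \<le> (M + 1) * ((L * norm y)\<^sup>2 + (norm y)\<^sup>2)"
      using M(1) L(2)[OF xy] by (intro mult_left_mono add_mono power_mono) auto
    also have "\<dots> = ((M + 1) * (L\<^sup>2 + 1)) * (norm y)\<^sup>2" by (simp add: algebra_simps power_mult_distrib)
    finally have "(norm (T s x))\<^sup>2 \<le> ((M + 1) * (L\<^sup>2 + 1)) * (norm y)\<^sup>2 / (1 + s)" using s by (simp add: field_simps)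
    then have "norm (T s x) \<le> sqrt (((M + 1) * (L\<^sup>2 + 1)) * (norm y)\<^sup>2 / (1 + s))" by (rule real_le_rsqrt)
    also have "\<dots> = sqrt ((M + 1) * (L\<^sup>2 + 1)) / sqrt (1 + s) * norm y" by (simp add: real_sqrt_mult real_sqrt_divide)
    also have "\<dots> \<le> Q / sqrt (1 + s) * norm y" by (intro mult_right_mono divide_right_mono) (auto simp: Q_def s)
    also have "sqrt (1 + s) = (1 + s) powr (1/2)" using s by (simp add: powr_half_sqrt)
    finally show ?thesis .
  qed
  have "norm (T t x) \<le> (Q * K * 2 powr (real (Suc k) / 2)) / (1 + t) powr (real (Suc k) / 2) * norm y"
    if t: "0 \<le> t" and x: "x \<in> X" and xy: "(x, y) \<in> A ^^ Suc k" for t x y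
  proof -
    obtain z where z: "(x, z) \<in> A" "(z, y) \<in> A ^^ k" using xy by (metis relpow_Suc_D2)
    define s where "s = t / 2"
    have s: "0 \<le> s" "t = s + s" using t by (auto simp: s_def)
    have "norm (T t x) = norm (T s (T s x))"
      unfolding s(2) by (simp only: T_plus[OF s(1) s(1) x])
    also have "\<dots> \<le> Q / (1 + s) powr (1/2) * norm (T s z)"
      by (rule one[OF A_invariant[OF z(1) s(1)] s(1)])
    also have "\<dots> \<le> Q / (1 + s) powr (1/2) * (K / (1 + s) powr (real k / 2) * norm y)"
      using Q by (intro mult_left_mono K(2)[OF s(1) A_in(2)[OF z(1)] z(2)]) auto
    also have "\<dots> = Q * K / (1 + s) powr (real (Suc k) / 2) * norm y"
      by (simp add: powr_add[symmetric] add_divide_distrib[symmetric] algebra_simps)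
    also have "\<dots> \<le> Q * K / ((1 + t) / 2) powr (real (Suc k) / 2) * norm y"
      using Q K(1) s t by (intro mult_right_mono divide_left_mono powr_mono2 mult_pos_pos) (auto simp: field_simps)
    also have "((1 + t) / 2) powr (real (Suc k) / 2) = (1 + t) powr (real (Suc k) / 2) / 2 powr (real (Suc k) / 2)"
      using t by (simp add: powr_divide)
    finally show ?thesis by simp
  qed
  then show ?case using Q K(1) by (intro exI[of _ "Q * K * 2 powr (real (Suc k) / 2)"]) auto
qed

lemma polynomial_decay_2: "polynomial_decay X A T 2"
  unfolding polynomial_decay_def
proof (intro allI)
  fix k :: nat
  obtain K where K: "K > 0" "\<And>(t::real) x y. 0 \<le> t \<Longrightarrow> x \<in> X \<Longrightarrow> (x, y) \<in> A ^^ k \<Longrightarrow> norm (T t x) \<le> K / (1 + t) powr (real k / 2) * norm y"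
    using decay_on_domain_of_power[of k] by blast
  show "\<exists>C>0. \<forall>t\<ge>(0::real). \<forall>x\<in>X. \<forall>y. (x, y) \<in> A ^^ k \<longrightarrow>
        norm (T t x) \<le> C / (1 + t) powr (real k / 2) * sqrt ((norm x)\<^sup>2 + (norm y)\<^sup>2)"
  proof (intro exI[of _ K] conjI allI ballI impI)
    fix t :: real and x y assume *: "0 \<le> t" "x \<in> X" "(x, y) \<in> A ^^ k"
    have "norm y \<le> sqrt ((norm x)\<^sup>2 + (norm y)\<^sup>2)" by (rule real_le_rsqrt) simp
    then have "K / (1 + t) powr (real k / 2) * norm y \<le> K / (1 + t) powr (real k / 2) * sqrt ((norm x)\<^sup>2 + (norm y)\<^sup>2)"
      using K(1) by (intro mult_left_mono) auto
    with K(2)[OF *] show "norm (T t x) \<le> K / (1 + t) powr (real k / 2) * sqrt ((norm x)\<^sup>2 + (norm y)\<^sup>2)" by linarith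
  qed (rule K)
qed

end

section \<open>Geometry of the interface triple\<close>

lemma open_bounded_interval_eq:
  fixes U :: "real set"
  assumes "open U" "is_interval U" "bounded U" "U \<noteq> {}"
  obtains a b where "a < b" "U = {a<..<b}"
proof -
  have bdd: "bdd_above U" "bdd_below U"
    by (rule bounded_imp_bdd_above[OF assms(3)], rule bounded_imp_bdd_below[OF assms(3)])
  have sub: "U \<subseteq> {Inf U<..<Sup U}"
  proof
    fix x assume x: "x \<in> U"
    then obtain d where d: "d > 0" "ball x d \<subseteq> U" using assms(1) open_contains_ball by blast
    have "x + d/2 \<in> U" "x - d/2 \<in> U" using d by (auto simp: subset_iff dist_real_def)
    then have "x + d/2 \<le> Sup U" "Inf U \<le> x - d/2" using bdd cSup_upper cInf_lower by blast+
    then show "x \<in> {Inf U<..<Sup U}" using d(1) by auto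
  qed
  have sup: "{Inf U<..<Sup U} \<subseteq> U"
  proof
    fix x assume x: "x \<in> {Inf U<..<Sup U}"
    obtain y where y: "y \<in> U" "y < x" using x cInf_lessD[OF assms(4)] by auto
    obtain z where z: "z \<in> U" "x < z" using x less_cSupD[OF assms(4)] by auto
    show "x \<in> U" using assms(2) y z unfolding is_interval_1 by (meson less_imp_le)
  qed
  have "U = {Inf U<..<Sup U}" using sub sup by blast
  moreover from this have "Inf U < Sup U" using assms(4) by (metis greaterThanLessThan_empty_iff2 not_le greaterThanLessThan_empty)
  ultimately show ?thesis using that by blast
qed

lemma frontier_open_interval: "a < b \<Longrightarrow> frontier {a<..<b::real} = {a, b}"
  by (auto simp: frontier_def interior_open)

text \<open>Two intervals that fill up a third one without overlap share an end point.\<close>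

lemma adjacent_intervals:
  fixes a b c d c' d' :: real
  assumes ab: "a < b" "c < d" "c' < d'" and order: "d \<le> c'"
    and cl: "{a..b} = {c..d} \<union> {c'..d'}"
  shows "a = c \<and> d = c' \<and> b = d'"
proof -
  have m: "\<And>x. a \<le> x \<and> x \<le> b \<longleftrightarrow> c \<le> x \<and> x \<le> d \<or> c' \<le> x \<and> x \<le> d'"
    using cl by (auto simp: set_eq_iff)
  have 1: "a \<le> c" "d' \<le> b" using m[of c] m[of d'] ab by auto
  have 2: "c \<le> a" using m[of a] ab order by auto
  have 3: "b \<le> d'" using m[of b] ab order by auto
  have 4: "d = c'" using m[of "(d + c') / 2"] order ab 1 by (auto simp: field_simps)
  show ?thesis using 1 2 3 4 by auto
qed

text \<open>The wave interval may lie on either side of the interface; naming the end points by their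
  role instead of their order covers both cases at once.\<close>

lemma lipschitz_interface_triple_segments:
  assumes "lipschitz_interface_triple \<Omega> \<Omega>w \<Omega>h"
  obtains e p h where "\<Omega>w = seg e p" "\<Omega>h = seg h p" "e < p \<and> p < h \<or> h < p \<and> p < e"
    "outer_boundary \<Omega> \<Omega>h = {e}" "outer_boundary \<Omega> \<Omega>w = {h}" "interface \<Omega> \<Omega>w \<Omega>h = {p}"
proof -
  note t = assms[unfolded lipschitz_interface_triple_def]
  obtain a b where ab: "a < b" "\<Omega> = {a<..<b}" using open_bounded_interval_eq[of \<Omega>] t by metis
  have bw: "bounded \<Omega>w" "bounded \<Omega>h" using t bounded_subset by blast+
  obtain c d where cd: "c < d" "\<Omega>w = {c<..<d}" using open_bounded_interval_eq[of \<Omega>w] t bw by metis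
  obtain c' d' where cd': "c' < d'" "\<Omega>h = {c'<..<d'}" using open_bounded_interval_eq[of \<Omega>h] t bw by metis
  have cl: "{a..b} = {c..d} \<union> {c'..d'}" using t ab cd cd' by (simp add: closure_Un)
  have disj: "d \<le> c' \<or> d' \<le> c"
  proof (rule ccontr)
    assume "\<not> ?thesis"
    then have "(max c c' + min d d') / 2 \<in> \<Omega>w \<inter> \<Omega>h"
      using cd cd' by (auto simp: max_def min_def field_simps)
    then show False using t by blast
  qed
  then show ?thesis
  proof
    assume o: "d \<le> c'"
    note eq = adjacent_intervals[OF ab(1) cd(1) cd'(1) o cl]
    show ?thesis
    proof (rule that[of c d d'])
      show "\<Omega>w = seg c d" "\<Omega>h = seg d' d" using cd cd' eq by (auto simp: min_def max_def)
      show "c < d \<and> d < d' \<or> d' < d \<and> d < c" using cd cd' eq by auto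
      show ob: "outer_boundary \<Omega> \<Omega>h = {c}" "outer_boundary \<Omega> \<Omega>w = {d'}"
        unfolding outer_boundary_def ab(2) cd(2) cd'(2)
          frontier_open_interval[OF ab(1)] frontier_open_interval[OF cd(1)] frontier_open_interval[OF cd'(1)] using eq cd cd' by auto
      show "interface \<Omega> \<Omega>w \<Omega>h = {d}"
        unfolding interface_def ob cd(2) frontier_open_interval[OF cd(1)] using cd by auto
    qed
  next
    assume o: "d' \<le> c"
    have cl': "{a..b} = {c'..d'} \<union> {c..d}" using cl by blast
    note eq = adjacent_intervals[OF ab(1) cd'(1) cd(1) o cl']
    show ?thesis
    proof (rule that[of d c c'])
      show "\<Omega>w = seg d c" "\<Omega>h = seg c' c" using cd cd' eq by (auto simp: min_def max_def)
      show "d < c \<and> c < c' \<or> c' < c \<and> c < d" using cd cd' eq by auto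
      show ob: "outer_boundary \<Omega> \<Omega>h = {d}" "outer_boundary \<Omega> \<Omega>w = {c'}"
        unfolding outer_boundary_def ab(2) cd(2) cd'(2)
          frontier_open_interval[OF ab(1)] frontier_open_interval[OF cd(1)] frontier_open_interval[OF cd'(1)] using eq cd cd' by auto
      show "interface \<Omega> \<Omega>w \<Omega>h = {c}"
        unfolding interface_def ob cd(2) frontier_open_interval[OF cd(1)] using cd by auto
    qed
  qed
qed

lemma outer_normal_seg: "e \<noteq> p \<Longrightarrow> outer_normal (seg e p) p = of_real (sgn (p - e))"
  by (cases "e < p") (auto simp: outer_normal_def max_def min_def sgn_if)

lemma admissible_coefficient_bounds:
  assumes "admissible_coefficient U S"
  obtains \<delta> M where "\<delta> > 0" "M > 0" "AE x in lebesgue_on U. \<delta> \<le> Re (S x) \<and> cmod (S x) \<le> M"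
proof -
  let ?L = "lebesgue_on U"
  have a: "S \<in> borel_measurable ?L" "esssup ?L (\<lambda>x. ereal (cmod (S x))) < \<infinity>" "essinf ?L (\<lambda>x. ereal (Re (S x))) > 0"
    using assms by (auto simp: admissible_coefficient_def)
  obtain M where M: "esssup ?L (\<lambda>x. ereal (cmod (S x))) \<le> ereal M"
    using a(2) by (cases "esssup ?L (\<lambda>x. ereal (cmod (S x)))") auto
  obtain \<delta> where \<delta>: "0 < ereal \<delta>" "ereal \<delta> < essinf ?L (\<lambda>x. ereal (Re (S x)))"
    using ereal_dense2[OF a(3)] by auto
  have "AE x in ?L. - ereal (Re (S x)) \<le> esssup ?L (\<lambda>x. - ereal (Re (S x)))"
    by (rule esssup_AE)
  moreover have "esssup ?L (\<lambda>x. - ereal (Re (S x))) < - ereal \<delta>"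
    using \<delta>(2) unfolding essinf_def by (metis ereal_less_uminus_reorder)
  ultimately have 1: "AE x in ?L. \<delta> \<le> Re (S x)"
    by (elim eventually_mono) (metis ereal_less_eq(3) ereal_minus_le_minus le_less_trans less_imp_le)
  have "AE x in ?L. ereal (cmod (S x)) \<le> esssup ?L (\<lambda>x. ereal (cmod (S x)))"
    by (rule esssup_AE)
  then have 2: "AE x in ?L. cmod (S x) \<le> max M 1"
    by (elim eventually_mono) (use M in \<open>metis ereal_less_eq(3) le_max_iff_disj order_trans\<close>)
  show ?thesis
    by (rule that[of \<delta> "max M 1"]) (use \<delta>(1) 1 2 in auto)
qed

lemma AE_lebesgue_on_iff:
  "U \<in> sets lebesgue \<Longrightarrow> (AE x in lebesgue_on U. P x) \<longleftrightarrow> (AE x in lebesgue. x \<in> U \<longrightarrow> P x)"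
  by (subst AE_restrict_space_iff) auto

lemma norm_flux_le:
  assumes q: "q \<in> L2_on U" and U: "U \<in> sets lebesgue" and M: "M \<ge> 0"
    and eq: "AE x in lebesgue_on U. rep_L2 q x = S x * rep_L2 g x"
    and b: "AE x in lebesgue_on U. \<delta> \<le> Re (S x) \<and> cmod (S x) \<le> M"
  shows "norm q \<le> M * norm g"
proof -
  have ae: "AE x in lebesgue. cmod (rep_L2 q x) \<le> M * cmod (rep_L2 g x)"
  proof -
    have "AE x in lebesgue. x \<in> U \<longrightarrow> rep_L2 q x = S x * rep_L2 g x"
      "AE x in lebesgue. x \<in> U \<longrightarrow> \<delta> \<le> Re (S x) \<and> cmod (S x) \<le> M"
      using eq b unfolding AE_lebesgue_on_iff[OF U] .
    moreover have "AE x in lebesgue. x \<notin> U \<longrightarrow> rep_L2 q x = 0" using q by (simp add: L2_on_def)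
    ultimately show ?thesis
      by eventually_elim (use M in \<open>auto simp: norm_mult intro!: mult_right_mono\<close>)
  qed
  have "(norm q)\<^sup>2 \<le> (LINT x|lebesgue. M\<^sup>2 * (cmod (rep_L2 g x))\<^sup>2)"
    unfolding norm_L2_eq
  proof (rule integral_mono_AE)
    show "AE x in lebesgue. (cmod (rep_L2 q x))\<^sup>2 \<le> M\<^sup>2 * (cmod (rep_L2 g x))\<^sup>2"
      using ae by eventually_elim (metis norm_ge_zero power_mono power_mult_distrib)
  qed (use square_integrable_rep in \<open>auto simp: square_integrable_def\<close>)
  also have "\<dots> = (M * norm g)\<^sup>2" by (simp add: norm_L2_eq power_mult_distrib)
  finally show ?thesis by (rule power2_le_imp_le) (use M in simp)
qed

text \<open>The lower bound for the real part of \<open>S\<close> is exactly the coercivity of the flux.\<close>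

lemma flux_dissipation:
  assumes g: "g \<in> L2_on U" and U: "U \<in> sets lebesgue"
    and eq: "AE x in lebesgue_on U. rep_L2 q x = S x * rep_L2 g x"
    and b: "AE x in lebesgue_on U. \<delta> \<le> Re (S x) \<and> cmod (S x) \<le> M"
  shows "Re (cinner q g) \<ge> \<delta> * (norm g)\<^sup>2"
proof -
  have i: "integrable lebesgue (\<lambda>x. rep_L2 q x * cnj (rep_L2 g x))"
    by (rule square_integrable_mult) simp_all
  have "\<delta> * (norm g)\<^sup>2 = (LINT x|lebesgue. \<delta> * (cmod (rep_L2 g x))\<^sup>2)" by (simp add: norm_L2_eq)
  also have "\<dots> \<le> (LINT x|lebesgue. Re (rep_L2 q x * cnj (rep_L2 g x)))"
  proof (rule integral_mono_AE)
    have "AE x in lebesgue. x \<in> U \<longrightarrow> rep_L2 q x = S x * rep_L2 g x"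
      "AE x in lebesgue. x \<in> U \<longrightarrow> \<delta> \<le> Re (S x) \<and> cmod (S x) \<le> M"
      using eq b unfolding AE_lebesgue_on_iff[OF U] .
    moreover have "AE x in lebesgue. x \<notin> U \<longrightarrow> rep_L2 g x = 0" using g by (simp add: L2_on_def)
    ultimately show "AE x in lebesgue. \<delta> * (cmod (rep_L2 g x))\<^sup>2 \<le> Re (rep_L2 q x * cnj (rep_L2 g x))"
    proof eventually_elim
      fix x assume *: "x \<in> U \<longrightarrow> rep_L2 q x = S x * rep_L2 g x" "x \<in> U \<longrightarrow> \<delta> \<le> Re (S x) \<and> cmod (S x) \<le> M"
        "x \<notin> U \<longrightarrow> rep_L2 g x = 0"
      show "\<delta> * (cmod (rep_L2 g x))\<^sup>2 \<le> Re (rep_L2 q x * cnj (rep_L2 g x))"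
      proof (cases "x \<in> U")
        case True
        have "Re (rep_L2 q x * cnj (rep_L2 g x)) = Re (S x * of_real ((cmod (rep_L2 g x))\<^sup>2))"
          unfolding complex_norm_square using True * by (simp add: mult.assoc)
        also have "\<dots> = Re (S x) * (cmod (rep_L2 g x))\<^sup>2" by simp
        finally show ?thesis using True * by (simp add: mult_right_mono)
      qed (use * in simp)
    qed
    show "integrable lebesgue (\<lambda>x. Re (rep_L2 q x * cnj (rep_L2 g x)))" using i by (rule integrable_Re)
    show "integrable lebesgue (\<lambda>x. \<delta> * (cmod (rep_L2 g x))\<^sup>2)"
      using square_integrable_rep by (auto simp: square_integrable_def)
  qed
  also have "\<dots> = Re (cinner q g)" unfolding cinner_L2_eq by (rule integral_Re[OF i])
  finally show ?thesis .
qed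

section \<open>The wave-heat operator\<close>

text \<open>The operator in terms of continuous representatives: traces have become point values, and the sign in
  the flux condition has disappeared because the two outer normals at \<open>p\<close> are opposite.\<close>

definition wave_heat_relation ::
  "real \<Rightarrow> real \<Rightarrow> real \<Rightarrow> (real \<Rightarrow> complex) \<Rightarrow> L2 \<times> L2 \<times> L2 \<Rightarrow> L2 \<times> L2 \<times> L2 \<Rightarrow>
    (real \<Rightarrow> complex) \<Rightarrow> (real \<Rightarrow> complex) \<Rightarrow> (real \<Rightarrow> complex) \<Rightarrow> (real \<Rightarrow> complex) \<Rightarrow> L2 \<Rightarrow> L2 \<Rightarrow> bool" where
  "wave_heat_relation e p h S = (\<lambda>(w1, w2, h1) (u1, u2, u3) W1 W2 H Q g q.
     H1_rep e p W1 w1 u2 \<and> H1_rep e p W2 w2 u1 \<and> H1_rep h p H h1 g \<and> H1_rep h p Q q u3 \<and>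
     (AE x in lebesgue_on (seg h p). rep_L2 q x = S x * rep_L2 g x) \<and>
     W1 e = 0 \<and> H h = 0 \<and> W1 p = H p \<and> W2 p = Q p)"

lemma wave_heat_operator_iff:
  assumes seg: "\<Omega>w = seg e p" "\<Omega>h = seg h p" and order: "e < p \<and> p < h \<or> h < p \<and> p < e"
    and bd: "outer_boundary \<Omega> \<Omega>h = {e}" "outer_boundary \<Omega> \<Omega>w = {h}" "interface \<Omega> \<Omega>w \<Omega>h = {p}"
  shows "(x, y) \<in> wave_heat_operator \<Omega> \<Omega>w \<Omega>h S \<longleftrightarrow> (\<exists>W1 W2 H Q g q. wave_heat_relation e p h S x y W1 W2 H Q g q)"
proof -
  obtain w1 w2 h1 where x: "x = (w1, w2, h1)" by (metis prod_cases3)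
  obtain u1 u2 u3 where y: "y = (u1, u2, u3)" by (metis prod_cases3)
  have ep: "e \<noteq> p" and hp: "h \<noteq> p" using order by auto
  have nw: "outer_normal (seg e p) p = of_real (sgn (p - e))" by (rule outer_normal_seg[OF ep])
  have nh: "outer_normal (seg h p) p = - of_real (sgn (p - e))"
    unfolding outer_normal_seg[OF hp] using order by (auto simp: sgn_if)
  have nz: "complex_of_real (sgn (p - e)) \<noteq> 0" using ep by (simp add: sgn_if)
  show ?thesis
  proof
    assume "(x, y) \<in> wave_heat_operator \<Omega> \<Omega>w \<Omega>h S"
    then obtain g q where *: "w1 \<in> H1_vanishing (seg e p) {e}" "h1 \<in> H1_vanishing (seg h p) {h}"
        "has_weak_derivative_on h1 g (seg h p)"
        "AE x in lebesgue_on (seg h p). rep_L2 q x = S x * rep_L2 g x"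
        "trace_at (seg e p) p w1 = trace_at (seg h p) p h1"
        "normal_trace_at (seg e p) p w2 = - normal_trace_at (seg h p) p q"
        "has_weak_derivative_on w2 u1 (seg e p)" "has_weak_derivative_on w1 u2 (seg e p)"
        "has_weak_derivative_on q u3 (seg h p)"
      unfolding wave_heat_operator_def x y mem_Collect_eq prod.case bd seg[symmetric] by auto
    obtain W1 where W1: "H1_rep e p W1 w1 u2" using weak_derivative_imp_H1_rep[OF *(8) ep] by blast
    obtain W2 where W2: "H1_rep e p W2 w2 u1" using weak_derivative_imp_H1_rep[OF *(7) ep] by blast
    obtain H where H: "H1_rep h p H h1 g" using weak_derivative_imp_H1_rep[OF *(3) hp] by blast
    obtain Q where Q: "H1_rep h p Q q u3" using weak_derivative_imp_H1_rep[OF *(9) hp] by blast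
    have "W1 e = 0" using *(1) trace_at_eq[OF W1 ep, of e] by (simp add: H1_vanishing_def)
    moreover have "H h = 0" using *(2) trace_at_eq[OF H hp, of h] by (simp add: H1_vanishing_def)
    moreover have "W1 p = H p" using *(5) trace_at_eq[OF W1 ep, of p] trace_at_eq[OF H hp, of p] by simp
    moreover have "W2 p = Q p"
      using *(6) trace_at_eq[OF W2 ep, of p] trace_at_eq[OF Q hp, of p] nz by (simp add: normal_trace_at_def nw nh)
    ultimately show "\<exists>W1 W2 H Q g q. wave_heat_relation e p h S x y W1 W2 H Q g q"
      using W1 W2 H Q *(4) unfolding x y wave_heat_relation_def prod.case by blast
  next
    assume "\<exists>W1 W2 H Q g q. wave_heat_relation e p h S x y W1 W2 H Q g q"
    then obtain W1 W2 H Q g q where *: "H1_rep e p W1 w1 u2" "H1_rep e p W2 w2 u1" "H1_rep h p H h1 g" "H1_rep h p Q q u3"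
     "AE x in lebesgue_on (seg h p). rep_L2 q x = S x * rep_L2 g x"
     "W1 e = 0" "H h = 0" "W1 p = H p" "W2 p = Q p" unfolding x y wave_heat_relation_def by auto
    note wd = *(1-4)[THEN H1_rep_imp_weak_derivative]
    note tr = trace_at_eq[OF *(1) ep] trace_at_eq[OF *(2) ep] trace_at_eq[OF *(3) hp] trace_at_eq[OF *(4) hp]
    have "w1 \<in> H1_vanishing (seg e p) {e}" "h1 \<in> H1_vanishing (seg h p) {h}"
      "w2 \<in> H1 (seg e p)" "q \<in> H1 (seg h p)"
      using wd tr *(6,7) unfolding H1_vanishing_def H1_def by auto
    moreover have "trace_at (seg e p) p w1 = trace_at (seg h p) p h1" using tr *(8) by simp
    moreover have "normal_trace_at (seg e p) p w2 = - normal_trace_at (seg h p) p q"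
      using tr *(9) by (simp add: normal_trace_at_def nw nh)
    ultimately show "(x, y) \<in> wave_heat_operator \<Omega> \<Omega>w \<Omega>h S"
      unfolding wave_heat_operator_def x y mem_Collect_eq prod.case bd unfolding seg
      using wd *(5) by auto
  qed
qed

text \<open>The self-adjoint operator whose quadratic form is \<open>2 Re \<langle>(x - e) w1, w2\<rangle>\<close>. It exchanges the components
  because the wave equation does.\<close>

definition multiplier_swap :: "real \<Rightarrow> real \<Rightarrow> L2 \<times> L2 \<times> L2 \<Rightarrow> L2 \<times> L2 \<times> L2" where
  "multiplier_swap e p x = (mult_L2 (offset e p) (fst (snd x)), mult_L2 (offset e p) (fst x), 0)"

lemma inner_triple: "inner (a, b, c) (a', b', c') = Re (cinner a a') + Re (cinner b b') + Re (cinner (c::L2) c')"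
  for a b :: L2
  by (simp add: inner_prod_def inner_eq_Re_cinner)

lemma norm_triple: "(norm (a, b, c))\<^sup>2 = (norm a)\<^sup>2 + (norm b)\<^sup>2 + (norm (c::L2))\<^sup>2" for a b :: L2
  by (simp add: norm_prod_def)

lemma Re_cinner_commute: "Re (cinner x y) = Re (cinner y (x::L2))"
  using cinner_commute[of x y] by simp

text \<open>In the energy balance the boundary terms of the wave and the heat part cancel at \<open>p\<close>. The
  multiplier identity, applied to both wave components, expresses the wave energy through the values at
  \<open>p\<close>; by the transmission conditions these are values of \<open>h1\<close> and \<open>q\<close>, to which the trace inequality on
  the heat interval applies. The derivative of \<open>q\<close> is the third component of \<open>y\<close>.\<close>

lemma wave_heat_dissipation:
  assumes R: "wave_heat_relation e p h S x y W1 W2 H Q g q"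
    and order: "e < p \<and> p < h \<or> h < p \<and> p < e"
    and b: "AE x in lebesgue_on (seg h p). \<delta> \<le> Re (S x) \<and> cmod (S x) \<le> M" and M: "M > 0"
  defines "L \<equiv> \<bar>p - e\<bar>" and "l \<equiv> \<bar>p - h\<bar>"
  shows "inner y x \<le> - \<delta> * (norm g)\<^sup>2"
    and "norm (snd (snd x)) \<le> 2 * l * norm g"
    and "(norm x)\<^sup>2 \<le> - 2 * inner (multiplier_swap e p y) x + (8 * L * l + L * M\<^sup>2 / l + 4 * l\<^sup>2) * (norm g)\<^sup>2
           + 2 * L * M * norm g * norm (snd (snd y))"
proof -
  obtain w1 w2 h1 where x: "x = (w1, w2, h1)" by (metis prod_cases3)
  obtain u1 u2 u3 where y: "y = (u1, u2, u3)" by (metis prod_cases3)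
  have *: "H1_rep e p W1 w1 u2" "H1_rep e p W2 w2 u1" "H1_rep h p H h1 g" "H1_rep h p Q q u3"
     "AE x in lebesgue_on (seg h p). rep_L2 q x = S x * rep_L2 g x"
     "W1 e = 0" "H h = 0" "W1 p = H p" "W2 p = Q p" using R unfolding x y wave_heat_relation_def by auto
  have l: "l > 0" "L > 0" using order by (auto simp: l_def L_def)
  have g: "g \<in> L2_on (seg h p)" "q \<in> L2_on (seg h p)" using *(3,4) by (auto simp: H1_rep_def)
  have "Re (cinner u1 w1) + Re (cinner u2 w2) = Re (cinner u1 w1 + cinner w2 u2)"
    by (simp add: Re_cinner_commute)
  also have "\<dots> = Re (of_real (sgn (p - e)) * (Q p * cnj (H p)))"
    unfolding H1_integration_by_parts[OF *(2,1)] using * by simp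
  finally have 1: "Re (cinner u1 w1) + Re (cinner u2 w2) = Re (of_real (sgn (p - e)) * (Q p * cnj (H p)))" .
  have "Re (cinner u3 h1) + Re (cinner q g) = Re (of_real (sgn (p - h)) * (Q p * cnj (H p)))"
    using arg_cong[OF H1_integration_by_parts[OF *(4,3)], of Re] *(7) by simp
  also have "sgn (p - h) = - sgn (p - e)" using order by (auto simp: sgn_if)
  finally have 2: "Re (cinner u3 h1) + Re (cinner q g) = - Re (of_real (sgn (p - e)) * (Q p * cnj (H p)))" by simp
  have 3: "Re (cinner q g) \<ge> \<delta> * (norm g)\<^sup>2" by (rule flux_dissipation[OF g(1) _ *(5) b]) simp
  show "inner y x \<le> - \<delta> * (norm g)\<^sup>2" unfolding x y inner_triple using 1 2 3 by linarith
  have 4: "norm h1 \<le> 2 * l * norm g" unfolding l_def by (rule H1_Poincare[OF *(3,7)])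
  then show "norm (snd (snd x)) \<le> 2 * l * norm g" by (simp add: x)
  have 5: "norm q \<le> M * norm g" by (rule norm_flux_le[OF g(2) _ _ *(5) b]) (use M in auto)
  have 6: "L * (cmod (H p))\<^sup>2 \<le> 8 * L * l * (norm g)\<^sup>2"
  proof -
    have "l * (cmod (H p))\<^sup>2 \<le> (norm h1)\<^sup>2 + 2 * (l * norm g * norm h1)"
      unfolding l_def by (rule H1_trace_bound[OF *(3)])
    also have "\<dots> \<le> (2 * l * norm g)\<^sup>2 + 2 * (l * norm g * (2 * l * norm g))"
      using l 4 by (intro add_mono power_mono mult_left_mono) auto
    also have "\<dots> = l * (8 * l * (norm g)\<^sup>2)" by (simp add: power2_eq_square)
    finally have "(cmod (H p))\<^sup>2 \<le> 8 * l * (norm g)\<^sup>2" using l by simp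
    then have "L * (cmod (H p))\<^sup>2 \<le> L * (8 * l * (norm g)\<^sup>2)" using l by (intro mult_left_mono) auto
    then show ?thesis by (simp only: mult_ac)
  qed
  have 7: "L * (cmod (Q p))\<^sup>2 \<le> L * M\<^sup>2 / l * (norm g)\<^sup>2 + 2 * L * M * norm g * norm u3"
  proof -
    have "l * (cmod (Q p))\<^sup>2 \<le> (norm q)\<^sup>2 + 2 * (l * norm u3 * norm q)"
      unfolding l_def by (rule H1_trace_bound[OF *(4)])
    also have "\<dots> \<le> (M * norm g)\<^sup>2 + 2 * (l * norm u3 * (M * norm g))"
      using l 5 by (intro add_mono power_mono mult_left_mono) auto
    also have "\<dots> = l * (M\<^sup>2 / l * (norm g)\<^sup>2 + 2 * M * norm g * norm u3)"
      using l by (simp add: power2_eq_square algebra_simps)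
    finally have "(cmod (Q p))\<^sup>2 \<le> M\<^sup>2 / l * (norm g)\<^sup>2 + 2 * M * norm g * norm u3" using l by simp
    then have "L * (cmod (Q p))\<^sup>2 \<le> L * (M\<^sup>2 / l * (norm g)\<^sup>2 + 2 * M * norm g * norm u3)" using l by (intro mult_left_mono) auto
    then show ?thesis by (simp add: algebra_simps)
  qed
  have 8: "(norm h1)\<^sup>2 \<le> 4 * l\<^sup>2 * (norm g)\<^sup>2"
    using power_mono[OF 4 norm_ge_zero, of 2] by (simp add: power_mult_distrib)
  have 9: "2 * Re (cinner (mult_L2 (offset e p) u2) w1) + (norm w1)\<^sup>2 = L * (cmod (H p))\<^sup>2"
    unfolding L_def *(8)[symmetric] by (rule H1_multiplier_identity[OF *(1)])
  have 10: "2 * Re (cinner (mult_L2 (offset e p) u1) w2) + (norm w2)\<^sup>2 = L * (cmod (Q p))\<^sup>2"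
    unfolding L_def *(9)[symmetric] by (rule H1_multiplier_identity[OF *(2)])
  have 11: "inner (multiplier_swap e p y) x = Re (cinner (mult_L2 (offset e p) u2) w1) + Re (cinner (mult_L2 (offset e p) u1) w2)"
  proof -
    have "cinner 0 h1 = 0" using cinner_diff_left[of 0 0 h1] by simp
    then show ?thesis unfolding multiplier_swap_def x y fst_conv snd_conv inner_triple by simp
  qed
  have 12: "(8 * L * l + L * M\<^sup>2 / l + 4 * l\<^sup>2) * (norm g)\<^sup>2 = 8 * L * l * (norm g)\<^sup>2 + L * M\<^sup>2 / l * (norm g)\<^sup>2 + 4 * l\<^sup>2 * (norm g)\<^sup>2"
    by (simp add: distrib_right)
  have collect: "X \<le> - 2 * (A + B) + (p1 + p2 + p4) + p3"
    if "X = a + b + c" "P \<le> p1" "R \<le> p2 + p3" "c \<le> p4" "2 * A + a = P" "2 * B + b = R"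
    for X a b c A B P R p1 p2 p3 p4 :: real
  proof -
    have eq: "- 2 * (A + B) = - (2 * A) - 2 * B" by (simp add: algebra_simps)
    show ?thesis unfolding eq using that by linarith
  qed
  have "(norm x)\<^sup>2 = (norm w1)\<^sup>2 + (norm w2)\<^sup>2 + (norm h1)\<^sup>2" unfolding x by (rule norm_triple)
  then show "(norm x)\<^sup>2 \<le> - 2 * inner (multiplier_swap e p y) x + (8 * L * l + L * M\<^sup>2 / l + 4 * l\<^sup>2) * (norm g)\<^sup>2
           + 2 * L * M * norm g * norm (snd (snd y))"
    unfolding 11 12 unfolding y snd_conv by (rule collect) (rule 6 7 8 9 10)+
qed

definition state_projection :: "real set \<Rightarrow> real set \<Rightarrow> L2 \<times> L2 \<times> L2 \<Rightarrow> L2 \<times> L2 \<times> L2" where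
  "state_projection U V x = (mult_L2 (indicator U) (fst x), mult_L2 (indicator U) (fst (snd x)), mult_L2 (indicator V) (snd (snd x)))"

lemma L2_on_scaleC: "f \<in> L2_on U \<Longrightarrow> scaleC c f \<in> L2_on U"
proof -
  assume "f \<in> L2_on U"
  then have "AE x in lebesgue. x \<notin> U \<longrightarrow> rep_L2 f x = 0" by (simp add: L2_on_def)
  then have "AE x in lebesgue. x \<notin> U \<longrightarrow> rep_L2 (scaleC c f) x = 0"
    using rep_L2_scaleC[of c f] by eventually_elim simp
  then show ?thesis by (simp add: L2_on_def)
qed

lemma state_space_c0_semigroup:
  assumes U: "U \<in> sets lebesgue" "V \<in> sets lebesgue" and gen: "generates_on (state_space U V) A T"
  shows "c0_semigroup (state_space U V) A T (state_projection U V)"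
proof (rule c0_semigroup.intro)
  note bl = bounded_linear_mult_L2[OF bounded_multiplier_indicator[OF U(1)]]
    bounded_linear_mult_L2[OF bounded_multiplier_indicator[OF U(2)]]
  show "bounded_linear (state_projection U V)"
    unfolding state_projection_def[abs_def]
    by (intro bounded_linear_Pair bounded_linear_compose[OF bl(1)] bounded_linear_compose[OF bl(2)]
      bounded_linear_fst bounded_linear_compose[OF bounded_linear_fst bounded_linear_snd]
      bounded_linear_compose[OF bounded_linear_snd bounded_linear_snd])
  show "state_projection U V x \<in> state_space U V" for x
    by (simp add: state_projection_def state_space_def mult_indicator_in_L2_on U)
  show "state_projection U V x = x" if "x \<in> state_space U V" for x
    using that L2_on_iff U by (auto simp: state_projection_def state_space_def)
  show "scaleC c x \<in> state_space U V" if "x \<in> state_space U V" for c x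
    using that by (auto simp: state_space_def scaleC_prod_def L2_on_scaleC)
qed (rule gen)

lemma multiplier_swap_bounded_linear: "bounded_linear (multiplier_swap e p)"
proof -
  note bl = bounded_linear_mult_L2[OF bounded_multiplier_offset[of e p]]
  show ?thesis
    unfolding multiplier_swap_def[abs_def]
    by (intro bounded_linear_Pair bounded_linear_compose[OF bl] bounded_linear_fst
      bounded_linear_compose[OF bounded_linear_fst bounded_linear_snd] bounded_linear_zero)
qed

lemma multiplier_swap_self_adjoint: "inner (multiplier_swap e p x) y = inner x (multiplier_swap e p y)"
proof -
  have z: "cinner 0 c = 0" "cinner c 0 = 0" for c :: L2
    using cinner_diff_left[of 0 0 c] cinner_diff_right[of c 0 0] by simp_all
  obtain w1 w2 h1 where x: "x = (w1, w2, h1)" by (metis prod_cases3)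
  obtain u1 u2 u3 where y: "y = (u1, u2, u3)" by (metis prod_cases3)
  note a = cinner_mult_adjoint[OF bounded_multiplier_offset offset_cnj, of e p]
  show ?thesis unfolding x y multiplier_swap_def fst_conv snd_conv inner_triple a z by (simp only: add.commute)
qed

lemma wave_heat_coercive_semigroup:
  assumes seg: "\<Omega>w = seg e p" "\<Omega>h = seg h p" and order: "e < p \<and> p < h \<or> h < p \<and> p < e"
    and bd: "outer_boundary \<Omega> \<Omega>h = {e}" "outer_boundary \<Omega> \<Omega>w = {h}" "interface \<Omega> \<Omega>w \<Omega>h = {p}"
    and b: "AE x in lebesgue_on (seg h p). \<delta> \<le> Re (S x) \<and> cmod (S x) \<le> M" "M > 0" "\<delta> > 0"
    and gen: "generates_on (state_space \<Omega>w \<Omega>h) (wave_heat_operator \<Omega> \<Omega>w \<Omega>h S) T"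
  shows "\<exists>C. coercive_semigroup (state_space \<Omega>w \<Omega>h) (wave_heat_operator \<Omega> \<Omega>w \<Omega>h S) T (state_projection \<Omega>w \<Omega>h)
    (multiplier_swap e p) (\<lambda>x. norm (snd (snd x))) \<delta> C"
proof -
  define L l where "L = \<bar>p - e\<bar>" and "l = \<bar>p - h\<bar>"
  define C1 C2 C3 where "C1 = 8 * L * l + L * M\<^sup>2 / l + 4 * l\<^sup>2" and "C2 = 2 * L * M" and "C3 = 2 * l"
  have nn: "0 \<le> C1" "0 \<le> C2" "0 \<le> C3" using b(2) by (auto simp: C1_def C2_def C3_def L_def l_def)
  define C where "C = C1 + C2 + C3"
  have C: "C1 \<le> C" "C2 \<le> C" "C3 \<le> C" "0 \<le> C" using nn by (auto simp: C_def)
  have sets: "\<Omega>w \<in> sets lebesgue" "\<Omega>h \<in> sets lebesgue" unfolding seg by auto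
  have "coercive_semigroup_axioms (wave_heat_operator \<Omega> \<Omega>w \<Omega>h S) (multiplier_swap e p) (\<lambda>x. norm (snd (snd x))) \<delta> C"
  proof (rule coercive_semigroup_axioms.intro)
    show "norm (snd (snd x)) \<le> norm x" for x :: "L2 \<times> L2 \<times> L2"
      by (cases x) (auto intro: order_trans[OF norm_snd_le norm_snd_le])
    fix x y assume "(x, y) \<in> wave_heat_operator \<Omega> \<Omega>w \<Omega>h S"
    then obtain W1 W2 H Q g q where R: "wave_heat_relation e p h S x y W1 W2 H Q g q"
      using wave_heat_operator_iff[OF seg order bd] by blast
    note D = wave_heat_dissipation[OF R order b(1,2), folded L_def l_def, folded C1_def C2_def C3_def]
    have "norm (snd (snd x)) \<le> C * norm g"
      by (rule order_trans[OF D(2)]) (use C in \<open>auto intro!: mult_right_mono\<close>)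
    moreover have "C1 * (norm g)\<^sup>2 \<le> C * (norm g)\<^sup>2" using C by (intro mult_right_mono) auto
    moreover have "C2 * norm g * norm (snd (snd y)) \<le> C * norm g * norm (snd (snd y))"
      using C by (intro mult_right_mono) auto
    ultimately show "\<exists>d\<ge>0. inner y x \<le> - \<delta> * d\<^sup>2 \<and> norm (snd (snd x)) \<le> C * d \<and>
        (norm x)\<^sup>2 \<le> - 2 * inner (multiplier_swap e p y) x + C * d\<^sup>2 + C * d * norm (snd (snd y))"
      using D(1,3) by (intro exI[of _ "norm g"] conjI norm_ge_zero) linarith+
  qed (use multiplier_swap_bounded_linear multiplier_swap_self_adjoint b(3) C(4) in auto)
  then show ?thesis
    using state_space_c0_semigroup[OF sets gen] by (auto simp: coercive_semigroup_def)
qed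

text \<open>The lower bound for \<open>A\<close> makes its kernel trivial.\<close>

lemma coercive_semigroup_kernel_perp:
  assumes "coercive_semigroup X A T P B N \<delta> C"
  shows "kernel_perp X A = X" "op_restrict A X = A"
proof -
  interpret coercive_semigroup X A T P B N \<delta> C by fact
  obtain K where K: "\<And>x y. (x, y) \<in> A \<Longrightarrow> norm x \<le> K * norm y" using domain_norm_le by metis
  have "cinner x z = 0" if "z \<in> op_kernel A" for x z
  proof -
    have "norm z \<le> K * norm (0::'a)" using K[of z 0] that by (simp add: op_kernel_def)
    then have "z = 0" by simp
    then show ?thesis using cinner_diff_right[of x 0 0] by simp
  qed
  then show "kernel_perp X A = X" by (auto simp: kernel_perp_def)
  show "op_restrict A X = A" using A_in by (auto simp: op_restrict_def)
qed

section \<open>Linear systems with bounded coefficients\<close>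

lemma primitive_on_add:
  assumes "primitive_on l r F f" "primitive_on l r G g"
  shows "primitive_on l r (\<lambda>x. F x + G x) (\<lambda>x. f x + g x)"
  unfolding primitive_on_def
proof (intro conjI allI impI)
  show "set_integrable lebesgue {l..r} (\<lambda>x. f x + g x)"
    using assms by (intro set_integral_add(1)) (auto simp: primitive_on_def)
  fix x y assume xy: "l \<le> x" "x \<le> y" "y \<le> r"
  have "set_integrable lebesgue {x..y} f" "set_integrable lebesgue {x..y} g"
    using assms xy by (auto simp: primitive_on_def intro: set_integrable_subset[of _ "{l..r}"])
  then have "(LINT t:{x..y}|lebesgue. f t + g t) = (LINT t:{x..y}|lebesgue. f t) + (LINT t:{x..y}|lebesgue. g t)"
    by (rule set_integral_add(2))
  moreover have "F y - F x = (LINT t:{x..y}|lebesgue. f t)" "G y - G x = (LINT t:{x..y}|lebesgue. g t)"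
    using assms xy by (auto simp: primitive_on_def)
  ultimately show "F y + G y - (F x + G x) = (LINT t:{x..y}|lebesgue. f t + g t)" by (simp add: algebra_simps)
qed

lemma primitive_on_scale:
  assumes "primitive_on l r F f"
  shows "primitive_on l r (\<lambda>x. c * F x) (\<lambda>x. c * f x)"
  using assms unfolding primitive_on_def
  by (auto simp: right_diff_distrib[symmetric] simp del: right_diff_distrib_numeral)

lemma set_integrable_bounded_mult:
  fixes a u :: "real \<Rightarrow> complex"
  assumes "a \<in> borel_measurable lebesgue" "\<And>x. cmod (a x) \<le> K" "continuous_on {l..r} u"
  shows "set_integrable lebesgue {l..r} (\<lambda>x. a x * u x)"
proof -
  have "set_integrable lebesgue {l..r} u" by (rule absolutely_integrable_continuous_real[OF assms(3)])
  then have "integrable lebesgue (\<lambda>x. (indicat_real {l..r} x *\<^sub>R u x) * a x)"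
    unfolding set_integrable_def by (rule integrable_mult_bounded[OF _ assms(1) assms(2)])
  moreover have "(indicat_real {l..r} x *\<^sub>R u x) * a x = indicat_real {l..r} x *\<^sub>R (a x * u x)" for x by simp
  ultimately show ?thesis unfolding set_integrable_def by (simp only:)
qed

text \<open>Each integration of a power of \<open>x - l\<close> gains one factor of the factorial, which makes the Picard
  series converge for coefficients of any size.\<close>

lemma Volterra_step_bound:
  fixes a u :: "real \<Rightarrow> complex"
  assumes a: "a \<in> borel_measurable lebesgue" "\<And>x. cmod (a x) \<le> K" and u: "continuous_on {l..r} u"
    and b: "\<And>x. x \<in> {l..r} \<Longrightarrow> cmod (u x) \<le> D * (K * (x - l)) ^ n / fact n" and x: "x \<in> {l..r}" and D: "0 \<le> D"
  shows "cmod (LINT t:{l..x}|lebesgue. a t * u t) \<le> D * (K * (x - l)) ^ Suc n / fact (Suc n)"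
proof -
  have K: "0 \<le> K" using a(2)[of 0] norm_ge_zero order_trans by blast
  define \<beta> where "\<beta> = (\<lambda>t. K * (D * (K * (t - l)) ^ n / fact n))"
  have c: "continuous_on {l..x} \<beta>" unfolding \<beta>_def by (intro continuous_intros) auto
  have i: "set_integrable lebesgue {l..x} (\<lambda>t. a t * u t)"
    by (rule set_integrable_bounded_mult[OF a]) (rule continuous_on_subset[OF u], use x in auto)
  have ib: "set_integrable lebesgue {l..x} \<beta>" by (rule absolutely_integrable_continuous_real[OF c])
  have "cmod (LINT t:{l..x}|lebesgue. a t * u t) \<le> (LINT t:{l..x}|lebesgue. cmod (a t * u t))"
    by (rule set_integral_norm_bound[OF i])
  also have "\<dots> \<le> (LINT t:{l..x}|lebesgue. \<beta> t)"
  proof (rule set_integral_mono[OF set_integrable_norm[OF i] ib])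
    fix t assume t: "t \<in> {l..x}"
    then have "cmod (u t) \<le> D * (K * (t - l)) ^ n / fact n" using b x by auto
    then show "cmod (a t * u t) \<le> \<beta> t"
      unfolding norm_mult \<beta>_def using K by (intro mult_mono a) auto
  qed
  also have "\<dots> = integral {l..x} \<beta>" by (rule set_lebesgue_integral_eq_integral(2)[OF ib])
  also have "(\<beta> has_integral (D * (K * (x - l)) ^ Suc n / fact (Suc n) - D * (K * (l - l)) ^ Suc n / fact (Suc n))) {l..x}"
  proof (rule fundamental_theorem_of_calculus)
    fix t assume "t \<in> {l..x}"
    have "((\<lambda>t. D * (K * (t - l)) ^ Suc n / fact (Suc n)) has_real_derivative
        D * (real (Suc n) * (K * (t - l)) ^ n * K) / fact (Suc n)) (at t within {l..x})"
      by (rule derivative_eq_intros refl | simp)+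
    moreover have "D * (real (Suc n) * (K * (t - l)) ^ n * K) / fact (Suc n) = \<beta> t"
      by (simp add: \<beta>_def field_simps del: of_nat_Suc)
    ultimately show "((\<lambda>t. D * (K * (t - l)) ^ Suc n / fact (Suc n)) has_vector_derivative \<beta> t) (at t within {l..x})"
      by (simp add: has_real_derivative_iff_has_vector_derivative)
  qed (use x in auto)
  then have "integral {l..x} \<beta> = D * (K * (x - l)) ^ Suc n / fact (Suc n)" by (simp add: integral_unique)
  finally show ?thesis .
qed

text \<open>The terms of the Picard series of the system \<open>H' = a Q\<close>, \<open>Q' = b H\<close> with initial values \<open>h0\<close>, \<open>q0\<close>
  at \<open>l\<close>. The summand 0 is the initial value of all terms after the first.\<close>

primrec Picard_terms :: "real \<Rightarrow> (real \<Rightarrow> complex) \<Rightarrow> (real \<Rightarrow> complex) \<Rightarrow> complex \<Rightarrow> complex \<Rightarrow> nat \<Rightarrow> (real \<Rightarrow> complex) \<times> (real \<Rightarrow> complex)" where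
  "Picard_terms l a b h0 q0 0 = ((\<lambda>x. h0), (\<lambda>x. q0))"
| "Picard_terms l a b h0 q0 (Suc n) =
     ((\<lambda>x. 0 + (LINT t:{l..x}|lebesgue. a t * snd (Picard_terms l a b h0 q0 n) t)),
      (\<lambda>x. 0 + (LINT t:{l..x}|lebesgue. b t * fst (Picard_terms l a b h0 q0 n) t)))"

lemma primitive_on_suminf:
  fixes v w :: "nat \<Rightarrow> real \<Rightarrow> complex"
  assumes a: "a \<in> borel_measurable lebesgue" "\<And>x. cmod (a x) \<le> K"
    and v0: "\<And>x y. v 0 x = v 0 y"
    and v: "\<And>n. primitive_on l r (v (Suc n)) (\<lambda>x. a x * w n x)"
    and w: "\<And>n. continuous_on {l..r} (w n)"
    and B: "summable B" "\<And>n x. x \<in> {l..r} \<Longrightarrow> cmod (v n x) \<le> B n" "\<And>n x. x \<in> {l..r} \<Longrightarrow> cmod (w n x) \<le> B n"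
  shows "primitive_on l r (\<lambda>x. \<Sum>n. v n x) (\<lambda>x. a x * (\<Sum>n. w n x))"
  unfolding primitive_on_def
proof (intro conjI allI impI)
  have K: "0 \<le> K" using a(2)[of 0] norm_ge_zero order_trans by blast
  have sv: "summable (\<lambda>n. v n x)" and sw: "summable (\<lambda>n. w n x)" if "x \<in> {l..r}" for x
    using B that by (auto intro: summable_comparison_test'[OF B(1)])
  have "uniform_limit {l..r} (\<lambda>n x. \<Sum>i<n. w i x) (\<lambda>x. \<Sum>i. w i x) sequentially"
    by (rule Weierstrass_m_test[OF B(3,1)])
  then have cw: "continuous_on {l..r} (\<lambda>x. \<Sum>n. w n x)"
    by (rule uniform_limit_theorem[rotated]) (simp, intro always_eventually allI continuous_on_sum w)
  show "set_integrable lebesgue {l..r} (\<lambda>x. a x * (\<Sum>n. w n x))"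
    by (rule set_integrable_bounded_mult[OF a cw])
  fix x y assume xy: "l \<le> x" "x \<le> y" "y \<le> r"
  let ?I = "indicat_real {x..y}"
  define f where "f = (\<lambda>n t. ?I t *\<^sub>R (a t * w n t))"
  have fi: "integrable lebesgue (f n)" for n
    using set_integrable_bounded_mult[OF a continuous_on_subset[OF w[of n]], of x y] xy
    by (auto simp: f_def set_integrable_def)
  have fb: "norm (f n t) \<le> (K * B n) * ?I t" for n t
    using xy by (auto simp: f_def indicator_def norm_mult intro!: mult_mono a B K)
  have sf: "summable (\<lambda>n. norm (f n t))" for t
    by (rule summable_comparison_test'[where g="\<lambda>n. (K * B n) * ?I t"])
      (use fb in \<open>auto intro!: summable_mult summable_mult2 B\<close>)
  have sfi: "summable (\<lambda>n. LINT t|lebesgue. norm (f n t))"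
  proof (rule summable_comparison_test'[where g="\<lambda>n. (K * B n) * (y - x)"])
    show "summable (\<lambda>n. (K * B n) * (y - x))" by (intro summable_mult summable_mult2 B)
    fix n :: nat
    have "(LINT t|lebesgue. norm (f n t)) \<le> (LINT t|lebesgue. (K * B n) * ?I t)"
      by (rule integral_mono[OF integrable_norm[OF fi]])
        (use fb xy in \<open>auto simp: integrable_indicator_iff emeasure_lborel_Icc_eq\<close>)
    also have "\<dots> = (K * B n) * (y - x)" using xy by simp
    finally show "norm (LINT t|lebesgue. norm (f n t)) \<le> (K * B n) * (y - x)" by simp
  qed
  have fsum: "(\<Sum>n. f n t) = ?I t *\<^sub>R (a t * (\<Sum>n. w n t))" for t
  proof (cases "t \<in> {x..y}")
    case True
    then show ?thesis using suminf_mult[OF sw, of t "a t"] xy by (simp add: f_def)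
  qed (simp add: f_def)
  have "(LINT t:{x..y}|lebesgue. a t * (\<Sum>n. w n t)) = (LINT t|lebesgue. (\<Sum>n. f n t))"
    by (simp add: set_lebesgue_integral_def fsum)
  also have "\<dots> = (\<Sum>n. LINT t|lebesgue. f n t)"
    by (rule integral_suminf[OF fi AE_I2 sfi]) (rule sf)
  also have "\<dots> = (\<Sum>n. v (Suc n) y - v (Suc n) x)"
    using v xy by (intro suminf_cong) (auto simp: primitive_on_def f_def set_lebesgue_integral_def)
  also have "\<dots> = (\<Sum>n. v (Suc n) y) - (\<Sum>n. v (Suc n) x)"
  proof (rule suminf_diff[symmetric])
    have "summable (\<lambda>n. v (Suc n) t)" if "t \<in> {l..r}" for t
      by (rule summable_Suc_iff[THEN iffD2, OF sv[OF that]])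
    then show "summable (\<lambda>n. v (Suc n) y)" "summable (\<lambda>n. v (Suc n) x)" using xy by auto
  qed
  also have "\<dots> = (\<Sum>n. v n y) - (\<Sum>n. v n x)"
    using suminf_split_head[OF sv, of y] suminf_split_head[OF sv, of x] xy v0[of x y] by simp
  finally show "(\<Sum>n. v n y) - (\<Sum>n. v n x) = (LINT t:{x..y}|lebesgue. a t * (\<Sum>n. w n t))" by simp
qed

lemma linear_system_solution:
  fixes a b :: "real \<Rightarrow> complex"
  assumes lr: "l \<le> r"
    and a: "a \<in> borel_measurable lebesgue" "\<And>x. cmod (a x) \<le> K"
    and b: "b \<in> borel_measurable lebesgue" "\<And>x. cmod (b x) \<le> K"
  shows "\<exists>H Q. primitive_on l r H (\<lambda>x. a x * Q x) \<and> primitive_on l r Q (\<lambda>x. b x * H x) \<and> H l = h0 \<and> Q l = q0"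
proof -
  have K: "0 \<le> K" using a(2)[of 0] norm_ge_zero order_trans by blast
  define u where "u = (\<lambda>n. fst (Picard_terms l a b h0 q0 n))"
  define v where "v = (\<lambda>n. snd (Picard_terms l a b h0 q0 n))"
  have u0: "u 0 x = h0" and v0: "v 0 x = q0" for x by (simp_all add: u_def v_def)
  have uS: "u (Suc n) = (\<lambda>x. 0 + (LINT t:{l..x}|lebesgue. a t * v n t))"
    and vS: "v (Suc n) = (\<lambda>x. 0 + (LINT t:{l..x}|lebesgue. b t * u n t))" for n
    by (simp_all add: u_def v_def)
  have pu: "primitive_on l r (u (Suc n)) (\<lambda>x. a x * v n x)" if "continuous_on {l..r} (v n)" for n
    unfolding uS by (intro primitive_on_indefinite_integral set_integrable_bounded_mult[OF a] that)
  have pv: "primitive_on l r (v (Suc n)) (\<lambda>x. b x * u n x)" if "continuous_on {l..r} (u n)" for n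
    unfolding vS by (intro primitive_on_indefinite_integral set_integrable_bounded_mult[OF b] that)
  have c: "continuous_on {l..r} (u n) \<and> continuous_on {l..r} (v n)" for n
  proof (induction n)
    case 0
    have "u 0 = (\<lambda>x. h0)" "v 0 = (\<lambda>x. q0)" using u0 v0 by auto
    then show ?case by simp
  next
    case (Suc n)
    then show ?case using pu pv primitive_on_continuous by blast
  qed
  define D where "D = max (cmod h0) (cmod q0)"
  have D: "0 \<le> D" by (simp add: D_def le_max_iff_disj)
  have bound: "\<forall>x\<in>{l..r}. cmod (u n x) \<le> D * (K * (x - l)) ^ n / fact n \<and> cmod (v n x) \<le> D * (K * (x - l)) ^ n / fact n" for n
  proof (induction n)
    case 0
    show ?case by (simp add: u0 v0 D_def)
  next
    case (Suc n)
    show ?case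
    proof (intro ballI conjI)
      fix x assume x: "x \<in> {l..r}"
      show "cmod (u (Suc n) x) \<le> D * (K * (x - l)) ^ Suc n / fact (Suc n)"
        unfolding uS add_0 by (rule Volterra_step_bound[OF a _ _ x D]) (use c Suc in auto)
      show "cmod (v (Suc n) x) \<le> D * (K * (x - l)) ^ Suc n / fact (Suc n)"
        unfolding vS add_0 by (rule Volterra_step_bound[OF b _ _ x D]) (use c Suc in auto)
    qed
  qed
  define B where "B = (\<lambda>n. D * ((K * (r - l)) ^ n / fact n))"
  have B: "summable B"
    unfolding B_def using summable_exp[of "K * (r - l)"] by (intro summable_mult) (simp add: divide_inverse mult.commute)
  have mono: "D * (K * (x - l)) ^ n / fact n \<le> B n" if "x \<in> {l..r}" for x n
    unfolding B_def times_divide_eq_right using that K D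
    by (intro divide_right_mono mult_left_mono power_mono) auto
  have uB: "cmod (u n x) \<le> B n" and vB: "cmod (v n x) \<le> B n" if "x \<in> {l..r}" for n x
    using bound[of n] mono[OF that, of n] that order_trans by blast+
  have "primitive_on l r (\<lambda>x. \<Sum>n. u n x) (\<lambda>x. a x * (\<Sum>n. v n x))"
    by (rule primitive_on_suminf[OF a _ pu _ B uB vB]) (use c u0 in auto)
  moreover have "primitive_on l r (\<lambda>x. \<Sum>n. v n x) (\<lambda>x. b x * (\<Sum>n. u n x))"
    by (rule primitive_on_suminf[OF b _ pv _ B vB uB]) (use c v0 in auto)
  moreover have "(\<Sum>n. u n l) = h0" "(\<Sum>n. v n l) = q0"
  proof -
    have "u (Suc n) l = 0" "v (Suc n) l = 0" for n
      using bspec[OF bound[of "Suc n"], of l] lr by simp_all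
    then have "u n l = (if n = 0 then h0 else 0)" "v n l = (if n = 0 then q0 else 0)" for n
      by (cases n; simp add: u0 v0)+
    then show "(\<Sum>n. u n l) = h0" "(\<Sum>n. v n l) = q0"
      using suminf_finite[of "{0}" "\<lambda>n. u n l"] suminf_finite[of "{0}" "\<lambda>n. v n l"] by auto
  qed
  ultimately show ?thesis
    by (intro exI[of _ "\<lambda>x. \<Sum>n. u n x"] exI[of _ "\<lambda>x. \<Sum>n. v n x"]) simp
qed

text \<open>If the solution with \<open>H l = 0\<close> does not vanish at \<open>z\<close>, it is used to correct the value at \<open>z\<close> of the
  solution with \<open>H l = 1\<close>. Nontriviality is recorded at \<open>l\<close>, where the initial values are known.\<close>

lemma linear_system_boundary_solution:
  fixes a b :: "real \<Rightarrow> complex"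
  assumes lr: "l \<le> r" and z: "z = l \<or> z = r"
    and a: "a \<in> borel_measurable lebesgue" "\<And>x. cmod (a x) \<le> K"
    and b: "b \<in> borel_measurable lebesgue" "\<And>x. cmod (b x) \<le> K"
  shows "\<exists>H Q. primitive_on l r H (\<lambda>x. a x * Q x) \<and> primitive_on l r Q (\<lambda>x. b x * H x) \<and> H z = 0 \<and> (H l \<noteq> 0 \<or> Q l \<noteq> 0)"
proof -
  obtain H1 Q1 where 1: "primitive_on l r H1 (\<lambda>x. a x * Q1 x)" "primitive_on l r Q1 (\<lambda>x. b x * H1 x)" "H1 l = 1" "Q1 l = 0"
    using linear_system_solution[OF lr a b] by metis
  obtain H2 Q2 where 2: "primitive_on l r H2 (\<lambda>x. a x * Q2 x)" "primitive_on l r Q2 (\<lambda>x. b x * H2 x)" "H2 l = 0" "Q2 l = 1"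
    using linear_system_solution[OF lr a b] by metis
  show ?thesis
  proof (cases "H2 z = 0")
    case True
    then show ?thesis using 2 by (intro exI[of _ H2] exI[of _ Q2]) auto
  next
    case False
    let ?c = "H2 z" and ?d = "- H1 z"
    let ?H = "\<lambda>x. ?c * H1 x + ?d * H2 x" and ?Q = "\<lambda>x. ?c * Q1 x + ?d * Q2 x"
    have "primitive_on l r ?H (\<lambda>x. ?c * (a x * Q1 x) + ?d * (a x * Q2 x))"
      by (intro primitive_on_add primitive_on_scale 1 2)
    then have "primitive_on l r ?H (\<lambda>x. a x * ?Q x)" by (simp add: algebra_simps)
    moreover have "primitive_on l r ?Q (\<lambda>x. ?c * (b x * H1 x) + ?d * (b x * H2 x))"
      by (intro primitive_on_add primitive_on_scale 1 2)
    then have "primitive_on l r ?Q (\<lambda>x. b x * ?H x)" by (simp add: algebra_simps)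
    moreover have "?H z = 0" by simp
    moreover have "?H l \<noteq> 0" using 1(3) 2(3) False by simp
    ultimately show ?thesis by (intro exI[of _ ?H] exI[of _ ?Q]) simp
  qed
qed

section \<open>Restricting functions to a segment\<close>

definition L2_restrict :: "real \<Rightarrow> real \<Rightarrow> (real \<Rightarrow> complex) \<Rightarrow> L2" where
  "L2_restrict e p f = abs_L2 (\<lambda>x. indicator (seg e p) x * f x)"

definition bounded_on_seg :: "real \<Rightarrow> real \<Rightarrow> (real \<Rightarrow> complex) \<Rightarrow> real \<Rightarrow> bool" where
  "bounded_on_seg e p f B \<longleftrightarrow> set_integrable lebesgue (seg e p) f \<and> (\<forall>x\<in>seg e p. cmod (f x) \<le> B)"

lemma bounded_on_seg_indicator:
  assumes "bounded_on_seg e p f B"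
  shows "(\<lambda>x. indicator (seg e p) x * f x) \<in> borel_measurable lebesgue"
    "integrable lebesgue (\<lambda>x. B\<^sup>2 * indicat_real (seg e p) x)"
    "(cmod (indicator (seg e p) x * f x))\<^sup>2 \<le> B\<^sup>2 * indicat_real (seg e p) x"
proof -
  have "(\<lambda>x. indicat_real (seg e p) x *\<^sub>R f x) \<in> borel_measurable lebesgue"
    using assms unfolding bounded_on_seg_def set_integrable_def by auto
  moreover have "indicat_real (seg e p) x *\<^sub>R f x = indicator (seg e p) x * f x" for x by (auto simp: indicator_def)
  ultimately show "(\<lambda>x. indicator (seg e p) x * f x) \<in> borel_measurable lebesgue" by (simp only:)
  show "integrable lebesgue (\<lambda>x. B\<^sup>2 * indicat_real (seg e p) x)"
    by (intro integrable_mult_right) (simp add: integrable_indicator_iff emeasure_lborel_Ioo)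
  show "(cmod (indicator (seg e p) x * f x))\<^sup>2 \<le> B\<^sup>2 * indicat_real (seg e p) x"
    using assms by (cases "x \<in> seg e p") (auto simp: bounded_on_seg_def intro!: power_mono)
qed

lemma square_integrable_L2_restrict:
  assumes "bounded_on_seg e p f B"
  shows "square_integrable (\<lambda>x. indicator (seg e p) x * f x)"
  unfolding square_integrable_def
proof
  note * = bounded_on_seg_indicator[OF assms]
  show "(\<lambda>x. indicator (seg e p) x * f x) \<in> borel_measurable lebesgue" by (rule *(1))
  show "integrable lebesgue (\<lambda>x. (cmod (indicator (seg e p) x * f x))\<^sup>2)"
  proof (rule Bochner_Integration.integrable_bound[OF *(2)])
    show "(\<lambda>x. (cmod (indicator (seg e p) x * f x))\<^sup>2) \<in> borel_measurable lebesgue"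
      by (intro borel_measurable_power measurable_compose[OF *(1)] borel_measurable_continuous_onI continuous_intros)
    show "AE x in lebesgue. norm ((cmod (indicator (seg e p) x * f x))\<^sup>2) \<le> norm (B\<^sup>2 * indicat_real (seg e p) x)"
      using *(3) by (intro AE_I2) (simp add: indicator_def)
  qed
qed

lemma rep_L2_restrict:
  "bounded_on_seg e p f B \<Longrightarrow> AE x in lebesgue. rep_L2 (L2_restrict e p f) x = indicator (seg e p) x * f x"
  unfolding L2_restrict_def by (rule rep_abs_L2[OF square_integrable_L2_restrict])

lemma norm_L2_restrict_le:
  assumes b: "bounded_on_seg e p f B"
  shows "(norm (L2_restrict e p f))\<^sup>2 \<le> B\<^sup>2 * \<bar>p - e\<bar>"
proof -
  note * = bounded_on_seg_indicator[OF b]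
  have "(norm (L2_restrict e p f))\<^sup>2 \<le> (LINT x|lebesgue. B\<^sup>2 * indicat_real (seg e p) x)"
    unfolding norm_L2_eq
  proof (rule integral_mono_AE[OF _ *(2)])
    show "AE x in lebesgue. (cmod (rep_L2 (L2_restrict e p f) x))\<^sup>2 \<le> B\<^sup>2 * indicat_real (seg e p) x"
      using rep_L2_restrict[OF b] by eventually_elim (use *(3) in simp)
  qed (use square_integrable_rep in \<open>auto simp: square_integrable_def\<close>)
  also have "\<dots> = B\<^sup>2 * \<bar>p - e\<bar>" by (auto simp: max_def min_def)
  finally show ?thesis .
qed

lemma bounded_on_seg_continuous:
  assumes "continuous_on {min e p..max e p} f"
  obtains B where "bounded_on_seg e p f B"
proof -
  obtain B where "\<forall>y\<in>f ` {min e p..max e p}. norm y \<le> B"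
    using compact_imp_bounded[OF compact_continuous_image[OF assms compact_Icc]] unfolding bounded_iff by blast
  moreover have "set_integrable lebesgue (seg e p) f"
    by (rule set_integrable_subset[OF absolutely_integrable_continuous_real[OF assms]]) auto
  ultimately have "bounded_on_seg e p f B" unfolding bounded_on_seg_def by auto
  then show ?thesis by (rule that)
qed

lemma H1_rep_L2_restrict:
  assumes F: "primitive_on (min e p) (max e p) F f" and f: "bounded_on_seg e p f B"
  shows "H1_rep e p F (L2_restrict e p F) (L2_restrict e p f)"
proof -
  obtain B' where B': "bounded_on_seg e p F B'"
    using bounded_on_seg_continuous[OF primitive_on_continuous[OF F]] by metis
  note r = rep_L2_restrict[OF f] and R = rep_L2_restrict[OF B']
  show ?thesis unfolding H1_rep_def L2_on_def mem_Collect_eq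
  proof (intro conjI)
    show "AE x in lebesgue. x \<notin> seg e p \<longrightarrow> rep_L2 (L2_restrict e p F) x = 0" using R by eventually_elim simp
    show "AE x in lebesgue. x \<notin> seg e p \<longrightarrow> rep_L2 (L2_restrict e p f) x = 0" using r by eventually_elim simp
    show "AE x in lebesgue. x \<in> seg e p \<longrightarrow> rep_L2 (L2_restrict e p F) x = F x" using R by eventually_elim simp
    show "primitive_on (min e p) (max e p) F (rep_L2 (L2_restrict e p f))"
    proof (rule primitive_on_cong_AE[OF F])
      show "AE x in lebesgue. x \<in> seg e p \<longrightarrow> rep_L2 (L2_restrict e p f) x = f x" using r by eventually_elim simp
      show "set_integrable lebesgue {min e p..max e p} (rep_L2 (L2_restrict e p f))"
        by (rule square_integrable_imp_set_integrable) simp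
    qed
  qed
qed

lemma L2_restrict_scale_diff:
  assumes f: "bounded_on_seg e p f B" and g: "bounded_on_seg e p g B'" and k: "bounded_on_seg e p k B''"
    and eq: "\<And>x. c * f x - g x = k x"
  shows "scaleC c (L2_restrict e p f) - L2_restrict e p g = L2_restrict e p k"
  unfolding L2_eq_iff
  using rep_L2_restrict[OF f] rep_L2_restrict[OF g] rep_L2_restrict[OF k] rep_L2_scaleC[of c "L2_restrict e p f"]
    rep_L2_diff[of "scaleC c (L2_restrict e p f)" "L2_restrict e p g"]
  by eventually_elim (use eq in \<open>auto simp: indicator_def\<close>)

section \<open>Heat modes at purely imaginary frequency\<close>

text \<open>Where the almost sure bounds on \<open>S\<close> fail, the inverse is replaced by zero, so that it is bounded
  everywhere.\<close>

lemma coefficient_inverse: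
  assumes S: "S \<in> borel_measurable (lebesgue_on U)" and U: "U \<in> sets lebesgue" and \<delta>: "\<delta> > 0"
    and b: "AE x in lebesgue_on U. \<delta> \<le> Re (S x) \<and> cmod (S x) \<le> M"
  obtains a where "a \<in> borel_measurable lebesgue" "\<And>x. cmod (a x) \<le> 1 / \<delta>"
    "AE x in lebesgue. x \<in> U \<longrightarrow> S x * a x = 1"
proof -
  define S0 where "S0 = (\<lambda>x. if x \<in> U then S x else 0)"
  have S0: "S0 \<in> borel_measurable lebesgue"
    unfolding S0_def by (rule borel_measurable_if_I[OF S U])
  define a where "a = (\<lambda>x. if \<delta> \<le> Re (S0 x) then inverse (S0 x) else 0)"
  have Re: "Re \<in> borel_measurable borel" by (intro borel_measurable_continuous_onI continuous_intros)
  note [measurable] = S0 Re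
  have "a \<in> borel_measurable lebesgue" unfolding a_def by measurable
  moreover have "cmod (a x) \<le> 1 / \<delta>" for x
  proof (cases "\<delta> \<le> Re (S0 x)")
    case True
    then have "\<delta> \<le> cmod (S0 x)" using complex_Re_le_cmod order_trans by blast
    then show ?thesis using True \<delta> by (simp add: a_def norm_inverse divide_inverse le_imp_inverse_le)
  qed (use \<delta> in \<open>simp add: a_def\<close>)
  moreover have "AE x in lebesgue. x \<in> U \<longrightarrow> S x * a x = 1"
    using b[unfolded AE_lebesgue_on_iff[OF U]]
  proof eventually_elim
    fix x assume *: "x \<in> U \<longrightarrow> \<delta> \<le> Re (S x) \<and> cmod (S x) \<le> M"
    show "x \<in> U \<longrightarrow> S x * a x = 1"
    proof
      assume x: "x \<in> U"
      then have "S x \<noteq> 0" using * \<delta> by auto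
      then show "S x * a x = 1" using x * by (simp add: a_def S0_def)
    qed
  qed
  ultimately show ?thesis by (rule that)
qed

lemma bounded_on_seg_mult:
  assumes a: "a \<in> borel_measurable lebesgue" "\<And>x. cmod (a x) \<le> K" and u: "continuous_on {min e p..max e p} u"
  obtains B where "bounded_on_seg e p (\<lambda>x. a x * u x) B"
proof -
  obtain B where B: "bounded_on_seg e p u B" using bounded_on_seg_continuous[OF u] by metis
  have K: "0 \<le> K" using a(2)[of 0] norm_ge_zero order_trans by blast
  have "set_integrable lebesgue (seg e p) (\<lambda>x. a x * u x)"
    by (rule set_integrable_subset[OF set_integrable_bounded_mult[OF a u]]) auto
  then have "bounded_on_seg e p (\<lambda>x. a x * u x) (K * B)"
    using B K by (auto simp: bounded_on_seg_def norm_mult intro!: mult_mono a)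
  then show ?thesis by (rule that)
qed

text \<open>The system \<open>h1' = q / S\<close>, \<open>q' = \<i> s h1\<close> with \<open>h1 = 0\<close> at the outer end has a nontrivial solution. Its
  energy identity reads \<open>\<i> s \<parallel>h1\<parallel>\<^sup>2 + \<langle>q, g\<rangle> = \<plusminus> q(p) cnj (h1(p))\<close>. The real part bounds \<open>\<parallel>g\<parallel>\<^sup>2\<close>, the
  imaginary part \<open>s \<parallel>h1\<parallel>\<^sup>2\<close>, both by \<open>\<bar>q(p)\<bar> \<bar>h1(p)\<bar>\<close>; inserting this into \<open>\<bar>h1(p)\<bar>\<^sup>2 \<le> 4 \<parallel>g\<parallel> \<parallel>h1\<parallel>\<close>
  gains the factor \<open>1 / sqrt s\<close>.\<close>

lemma heat_mode:
  assumes S: "S \<in> borel_measurable (lebesgue_on (seg h p))" and hp: "h \<noteq> p" and \<delta>: "\<delta> > 0" and M: "M > 0"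
    and b: "AE x in lebesgue_on (seg h p). \<delta> \<le> Re (S x) \<and> cmod (S x) \<le> M" and s: "s > 0"
  shows "\<exists>H Q h1 g q. H1_rep h p H h1 g \<and> H1_rep h p Q q (scaleC (\<i> * of_real s) h1) \<and>
    (AE x in lebesgue_on (seg h p). rep_L2 q x = S x * rep_L2 g x) \<and> H h = 0 \<and> Q p \<noteq> 0 \<and>
    s * (cmod (H p))\<^sup>2 \<le> 16 * (1 + M / \<delta>) / \<delta> * (cmod (Q p))\<^sup>2"
proof -
  let ?U = "seg h p" and ?l = "min h p" and ?r = "max h p"
  have U: "?U \<in> sets lebesgue" by simp
  obtain a where a: "a \<in> borel_measurable lebesgue" "\<And>x. cmod (a x) \<le> 1 / \<delta>"
    "AE x in lebesgue. x \<in> ?U \<longrightarrow> S x * a x = 1"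
    using coefficient_inverse[OF S U \<delta> b] by metis
  define K where "K = max (1 / \<delta>) s"
  have aK: "cmod (a x) \<le> K" for x using a(2)[of x] by (simp add: K_def le_max_iff_disj)
  have sK: "cmod (\<i> * complex_of_real s) \<le> K" using s by (simp add: K_def norm_mult)
  have "?l \<le> ?r" "h = ?l \<or> h = ?r" by auto
  from linear_system_boundary_solution[OF this a(1) aK borel_measurable_const sK]
  obtain H Q where HQ: "primitive_on ?l ?r H (\<lambda>x. a x * Q x)" "primitive_on ?l ?r Q (\<lambda>x. \<i> * complex_of_real s * H x)"
    "H h = 0" "H ?l \<noteq> 0 \<or> Q ?l \<noteq> 0" by blast
  have cH: "continuous_on {?l..?r} H" and cQ: "continuous_on {?l..?r} Q"
    using HQ primitive_on_continuous by blast+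
  obtain B1 where B1: "bounded_on_seg h p (\<lambda>x. a x * Q x) B1" using bounded_on_seg_mult[OF a(1,2) cQ] by metis
  obtain B2 where B2: "bounded_on_seg h p (\<lambda>x. \<i> * complex_of_real s * H x) B2"
    using bounded_on_seg_mult[OF borel_measurable_const sK cH] by metis
  obtain B3 where B3: "bounded_on_seg h p H B3" using bounded_on_seg_continuous[OF cH] by metis
  obtain B4 where B4: "bounded_on_seg h p Q B4" using bounded_on_seg_continuous[OF cQ] by metis
  define h1 g q where "h1 = L2_restrict h p H" and "g = L2_restrict h p (\<lambda>x. a x * Q x)" and "q = L2_restrict h p Q"
  have u3: "L2_restrict h p (\<lambda>x. \<i> * complex_of_real s * H x) = scaleC (\<i> * of_real s) h1"
    unfolding L2_eq_iff h1_def
    using rep_L2_restrict[OF B2] rep_L2_restrict[OF B3] rep_L2_scaleC[of "\<i> * of_real s" "L2_restrict h p H"] by eventually_elim simp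
  have rH: "H1_rep h p H h1 g" unfolding h1_def g_def by (rule H1_rep_L2_restrict[OF HQ(1) B1])
  have rQ: "H1_rep h p Q q (scaleC (\<i> * of_real s) h1)" unfolding u3[symmetric] q_def by (rule H1_rep_L2_restrict[OF HQ(2) B2])
  have flux: "AE x in lebesgue_on ?U. rep_L2 q x = S x * rep_L2 g x"
    unfolding AE_lebesgue_on_iff[OF U] q_def g_def
    using rep_L2_restrict[OF B4] rep_L2_restrict[OF B1] a(3) by eventually_elim (auto simp flip: mult.assoc)
  define l where "l = \<bar>p - h\<bar>"
  have l: "l > 0" using hp by (simp add: l_def)
  have gq: "g \<in> L2_on ?U" "q \<in> L2_on ?U" using rH rQ by (auto simp: H1_rep_def)
  have diss: "\<delta> * (norm g)\<^sup>2 \<le> Re (cinner q g)" by (rule flux_dissipation[OF gq(1) U flux b])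
  have nq: "norm q \<le> M * norm g" by (rule norm_flux_le[OF gq(2) U _ flux b]) (use M in simp)
  have nh: "norm h1 \<le> 2 * l * norm g" unfolding l_def by (rule H1_Poincare[OF rH HQ(3)])
  have energy: "\<i> * of_real (s * (norm h1)\<^sup>2) + cinner q g = of_real (sgn (p - h)) * (Q p * cnj (H p))"
    using H1_integration_by_parts[OF rQ rH] HQ(3) by (simp add: cinner_scaleC_left cinner_self mult.assoc)
  have sg: "cmod (of_real (sgn (p - h)) * (Q p * cnj (H p))) = cmod (Q p) * cmod (H p)"
    using hp by (simp add: norm_mult sgn_if)
  define Y where "Y = cmod (Q p) * cmod (H p)"
  have "Re (cinner q g) = Re (of_real (sgn (p - h)) * (Q p * cnj (H p)))"
    using arg_cong[OF energy, of Re] by simp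
  also have "\<dots> \<le> Y" unfolding Y_def sg[symmetric] by (rule complex_Re_le_cmod)
  finally have g2: "\<delta> * (norm g)\<^sup>2 \<le> Y" using diss by linarith
  then have g2': "(norm g)\<^sup>2 \<le> Y / \<delta>" using \<delta> by (simp add: field_simps)
  have Qp: "Q p \<noteq> 0"
  proof
    assume "Q p = 0"
    then have "\<delta> * (norm g)\<^sup>2 \<le> 0" using g2 by (simp add: Y_def)
    then have "norm g = 0" using \<delta> by (simp add: mult_le_0_iff)
    then have z: "norm h1 = 0" "norm q = 0" using nh nq norm_ge_zero[of h1] norm_ge_zero[of q] by auto
    have "l * (cmod (H p))\<^sup>2 \<le> 0" using H1_trace_bound[OF rH] z by (simp add: l_def)
    then have "H p = 0" using l by (simp add: mult_le_0_iff)
    have "\<bar>h - p\<bar> * (cmod (Q h))\<^sup>2 \<le> 0"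
      using H1_trace_bound[OF rQ[unfolded H1_rep_commute[of h]]] z by simp
    then have "Q h = 0" using hp by (simp add: mult_le_0_iff)
    have "?l = h \<or> ?l = p" by auto
    then show False using HQ(3,4) \<open>H p = 0\<close> \<open>Q h = 0\<close> \<open>Q p = 0\<close> by auto
  qed
  have "s * (norm h1)\<^sup>2 = Im (of_real (sgn (p - h)) * (Q p * cnj (H p))) - Im (cinner q g)"
    using arg_cong[OF energy, of Im] by simp
  also have "\<dots> \<le> Y + norm q * norm g"
  proof -
    have "Im (of_real (sgn (p - h)) * (Q p * cnj (H p))) \<le> Y"
      unfolding Y_def sg[symmetric] using abs_Im_le_cmod abs_le_D1 by blast
    moreover have "- Im (cinner q g) \<le> norm q * norm g"
      using abs_Im_le_cmod[of "cinner q g"] cinner_Cauchy_Schwarz[of q g] by linarith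
    ultimately show ?thesis by linarith
  qed
  also have "norm q * norm g \<le> M * (norm g)\<^sup>2"
    using mult_right_mono[OF nq norm_ge_zero[of g]] by (simp add: power2_eq_square mult.assoc)
  also have "M * (norm g)\<^sup>2 \<le> M * (Y / \<delta>)" using g2' M by (intro mult_left_mono) auto
  finally have h2: "s * (norm h1)\<^sup>2 \<le> (1 + M / \<delta>) * Y" by (simp add: algebra_simps)
  have "l * (cmod (H p))\<^sup>2 \<le> norm h1 * norm h1 + 2 * (l * norm g * norm h1)"
    using H1_trace_bound[OF rH] by (simp add: l_def power2_eq_square)
  also have "\<dots> \<le> (2 * l * norm g) * norm h1 + 2 * (l * norm g * norm h1)"
    using nh by (intro add_right_mono mult_right_mono) auto
  also have "\<dots> = l * (4 * (norm g * norm h1))" by simp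
  finally have "(cmod (H p))\<^sup>2 \<le> 4 * (norm g * norm h1)" using l by simp
  then have "((cmod (H p))\<^sup>2)\<^sup>2 \<le> (4 * (norm g * norm h1))\<^sup>2" by (intro power_mono) auto
  then have "s * ((cmod (H p))\<^sup>2)\<^sup>2 \<le> s * (4 * (norm g * norm h1))\<^sup>2" using s by (intro mult_left_mono) auto
  also have "\<dots> = 16 * ((norm g)\<^sup>2 * (s * (norm h1)\<^sup>2))" by (simp add: power_mult_distrib)
  also have "\<dots> \<le> 16 * ((Y / \<delta>) * ((1 + M / \<delta>) * Y))"
    by (rule mult_left_mono[OF mult_mono[OF g2' h2]]) (use s order_trans[OF zero_le_power2 g2'] in auto)
  also have "\<dots> = (16 * (1 + M / \<delta>) / \<delta> * (cmod (Q p))\<^sup>2) * (cmod (H p))\<^sup>2"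
    by (simp add: Y_def power2_eq_square)
  finally have "s * (cmod (H p))\<^sup>2 * (cmod (H p))\<^sup>2 \<le> (16 * (1 + M / \<delta>) / \<delta> * (cmod (Q p))\<^sup>2) * (cmod (H p))\<^sup>2"
    by (simp add: power2_eq_square)
  then have "s * (cmod (H p))\<^sup>2 \<le> 16 * (1 + M / \<delta>) / \<delta> * (cmod (Q p))\<^sup>2"
    using \<delta> M by (cases "H p = 0") (auto intro: mult_right_le_imp_le)
  then show ?thesis using rH rQ flux HQ(3) Qp by blast
qed

section \<open>Quasimodes of the wave-heat system\<close>

text \<open>The first terms of \<open>W1\<close> and \<open>W2\<close> solve the wave equation at frequency \<open>s\<close> exactly. The terms with \<open>\<beta>\<close>
  adjust the value at \<open>p\<close> without changing the resonant frequency; they grow linearly in space, and only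
  the derivative of the factor \<open>x - e\<close> is left as residual, so its size does not depend on \<open>s\<close>.\<close>

lemma wave_quasimode:
  fixes \<alpha> \<beta> :: complex and e p s :: real
  defines "W1 \<equiv> (\<lambda>x. \<alpha> * of_real (sin (s * (x - e))) + \<beta> * (of_real (x - e) * of_real (cos (s * (x - e)))))"
    and "W2 \<equiv> (\<lambda>x. - \<i> * \<alpha> * of_real (cos (s * (x - e))) + \<i> * \<beta> * (of_real (x - e) * of_real (sin (s * (x - e)))))"
  shows "\<exists>w1 w2 u1 u2. H1_rep e p W1 w1 u2 \<and> H1_rep e p W2 w2 u1 \<and>
    (norm (scaleC (\<i> * of_real s) w1 - u1))\<^sup>2 \<le> (cmod \<beta>)\<^sup>2 * \<bar>p - e\<bar> \<and>
    (norm (scaleC (\<i> * of_real s) w2 - u2))\<^sup>2 \<le> (cmod \<beta>)\<^sup>2 * \<bar>p - e\<bar>"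
proof -
  define V1 where "V1 = (\<lambda>x. \<alpha> * of_real (s * cos (s * (x - e))) + \<beta> * (of_real (cos (s * (x - e))) - of_real (x - e) * of_real (s * sin (s * (x - e)))))"
  define V2 where "V2 = (\<lambda>x. \<i> * \<alpha> * of_real (s * sin (s * (x - e))) + \<i> * \<beta> * (of_real (sin (s * (x - e))) + of_real (x - e) * of_real (s * cos (s * (x - e)))))"
  define R1 where "R1 = (\<lambda>x. - \<i> * \<beta> * of_real (sin (s * (x - e))))"
  define R2 where "R2 = (\<lambda>x. - \<beta> * of_real (cos (s * (x - e))))"
  have "((\<lambda>x. sin (s * (x - e))) has_real_derivative s * cos (s * (x - e))) (at x)"
    "((\<lambda>x. cos (s * (x - e))) has_real_derivative - (s * sin (s * (x - e)))) (at x)"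
    "((\<lambda>x. x - e) has_real_derivative 1) (at x)" for x
    by (auto intro!: derivative_eq_intros)
  note this[THEN has_vector_derivative_of_real]
  note sd = this(1) and cd = this(2) and xd = this(3)
  have d1: "(W1 has_vector_derivative V1 x) (at x)" for x
  proof -
    have "((\<lambda>x. \<alpha> * of_real (sin (s * (x - e))) + \<beta> * (of_real (x - e) * of_real (cos (s * (x - e))))) has_vector_derivative
      (\<alpha> * of_real (s * cos (s * (x - e))) + \<beta> * (of_real (x - e) * of_real (- (s * sin (s * (x - e)))) + of_real 1 * of_real (cos (s * (x - e)))))) (at x)"
      by (intro has_vector_derivative_add has_vector_derivative_mult_right has_vector_derivative_mult sd cd xd)
    then show ?thesis unfolding W1_def V1_def by (simp add: algebra_simps)
  qed
  have d2: "(W2 has_vector_derivative V2 x) (at x)" for x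
  proof -
    have "((\<lambda>x. (- \<i> * \<alpha>) * of_real (cos (s * (x - e))) + (\<i> * \<beta>) * (of_real (x - e) * of_real (sin (s * (x - e))))) has_vector_derivative
      ((- \<i> * \<alpha>) * of_real (- (s * sin (s * (x - e)))) + (\<i> * \<beta>) * (of_real (x - e) * of_real (s * cos (s * (x - e))) + of_real 1 * of_real (sin (s * (x - e)))))) (at x)"
      by (intro has_vector_derivative_add has_vector_derivative_mult_right has_vector_derivative_mult sd cd xd)
    then show ?thesis unfolding W2_def V2_def by (simp add: algebra_simps)
  qed
  have c: "continuous_on A W1" "continuous_on A W2" "continuous_on A V1" "continuous_on A V2" "continuous_on A R1" "continuous_on A R2" for A
    unfolding W1_def W2_def V1_def V2_def R1_def R2_def by (intro continuous_intros)+
  obtain B1 where B1: "bounded_on_seg e p W1 B1" using bounded_on_seg_continuous[OF c(1)] by metis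
  obtain B2 where B2: "bounded_on_seg e p W2 B2" using bounded_on_seg_continuous[OF c(2)] by metis
  obtain C1 where C1: "bounded_on_seg e p V1 C1" using bounded_on_seg_continuous[OF c(3)] by metis
  obtain C2 where C2: "bounded_on_seg e p V2 C2" using bounded_on_seg_continuous[OF c(4)] by metis
  have "set_integrable lebesgue (seg e p) R1" "set_integrable lebesgue (seg e p) R2"
    by (rule set_integrable_subset[OF absolutely_integrable_continuous_real[OF c(5)], of _ "min e p" "max e p"],
        simp, force simp: subset_iff less_imp_le,
        rule set_integrable_subset[OF absolutely_integrable_continuous_real[OF c(6)], of _ "min e p" "max e p"],
        simp, force simp: subset_iff less_imp_le)
  moreover have "cmod (R1 x) \<le> cmod \<beta>" "cmod (R2 x) \<le> cmod \<beta>" for x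
    by (simp_all add: R1_def R2_def norm_mult mult_left_le)
  ultimately have R: "bounded_on_seg e p R1 (cmod \<beta>)" "bounded_on_seg e p R2 (cmod \<beta>)"
    by (auto simp: bounded_on_seg_def)
  have "H1_rep e p W1 (L2_restrict e p W1) (L2_restrict e p V1)" by (rule H1_rep_L2_restrict[OF primitive_on_C1[OF d1 c(3)] C1])
  moreover have "H1_rep e p W2 (L2_restrict e p W2) (L2_restrict e p V2)" by (rule H1_rep_L2_restrict[OF primitive_on_C1[OF d2 c(4)] C2])
  moreover have "scaleC (\<i> * of_real s) (L2_restrict e p W1) - L2_restrict e p V2 = L2_restrict e p R1"
    by (rule L2_restrict_scale_diff[OF B1 C2 R(1)]) (simp add: W1_def V2_def R1_def algebra_simps)
  moreover have "scaleC (\<i> * of_real s) (L2_restrict e p W2) - L2_restrict e p V1 = L2_restrict e p R2"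
    by (rule L2_restrict_scale_diff[OF B2 C1 R(2)]) (simp add: W2_def V1_def R2_def algebra_simps)
  ultimately show ?thesis using norm_L2_restrict_le[OF R(1)] norm_L2_restrict_le[OF R(2)] by metis
qed

lemma mult_L2_scaleC:
  assumes m: "bounded_multiplier m B"
  shows "mult_L2 m (scaleC c f) = scaleC c (mult_L2 m f)"
  unfolding L2_eq_iff
  using rep_mult_L2[OF m, of "scaleC c f"] rep_mult_L2[OF m, of f] rep_L2_scaleC[of c f] rep_L2_scaleC[of c "mult_L2 m f"]
  by eventually_elim simp

text \<open>For a state with \<open>\<i> s x - A x = r\<close>, the frequency enters the multiplier form only through an imaginary
  part, which cancels between the two wave components.\<close>

lemma offset_residual:
  fixes w v :: L2
  assumes "u = scaleC (\<i> * of_real s) v - r"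
  shows "Re (cinner (mult_L2 (offset e p) u) w) = - s * Im (cinner (mult_L2 (offset e p) v) w) - Re (cinner (mult_L2 (offset e p) r) w)"
proof -
  note m = bounded_multiplier_offset[of e p]
  have "mult_L2 (offset e p) u = scaleC (\<i> * of_real s) (mult_L2 (offset e p) v) - mult_L2 (offset e p) r"
    unfolding assms mult_L2_scaleC[OF m, symmetric]
    by (rule linear_diff[OF bounded_linear.linear[OF bounded_linear_mult_L2[OF m]]])
  then show ?thesis by (simp add: cinner_diff_left cinner_scaleC_left)
qed

text \<open>The frequencies \<open>n \<pi> / L\<close> are those for which the sine vanishes at both ends of the wave interval. Then
  the values of \<open>W1\<close> and \<open>W2\<close> at \<open>p\<close> are governed separately by \<open>\<beta>\<close> and \<open>\<alpha>\<close>, which are chosen to match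
  \<open>h1(p)\<close> and \<open>q(p)\<close>. The residual is of order \<open>\<bar>h1(p)\<bar>\<close>, hence at most of order \<open>\<bar>q(p)\<bar> / sqrt s\<close>, while
  the multiplier identity bounds \<open>\<bar>q(p)\<bar>\<close> by the norm of the state and the residual.\<close>

lemma wave_heat_quasimodes:
  assumes seg: "\<Omega>w = seg e p" "\<Omega>h = seg h p" and order: "e < p \<and> p < h \<or> h < p \<and> p < e"
    and bd: "outer_boundary \<Omega> \<Omega>h = {e}" "outer_boundary \<Omega> \<Omega>w = {h}" "interface \<Omega> \<Omega>w \<Omega>h = {p}"
    and S: "S \<in> borel_measurable (lebesgue_on (seg h p))"
    and b: "AE x in lebesgue_on (seg h p). \<delta> \<le> Re (S x) \<and> cmod (S x) \<le> M" and M: "M > 0" and \<delta>: "\<delta> > 0"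
  shows "\<exists>c>0. \<forall>s0. \<exists>s\<ge>s0. \<exists>x y. (x, y) \<in> wave_heat_operator \<Omega> \<Omega>w \<Omega>h S \<and> x \<noteq> 0 \<and>
    norm (scaleC (\<i> * of_real s) x - y) \<le> c / sqrt s * norm x"
proof -
  define L where "L = \<bar>p - e\<bar>"
  have L: "L > 0" and hp: "h \<noteq> p" using order by (auto simp: L_def)
  define K where "K = 16 * (1 + M / \<delta>) / \<delta>"
  have K: "K > 0" using M \<delta> by (simp add: K_def add_pos_pos)
  define c where "c = sqrt (2 * K / L\<^sup>2 * (1 + 4 * L))"
  have c: "c > 0" "c\<^sup>2 = 2 * K / L\<^sup>2 * (1 + 4 * L)" using K L by (auto simp: c_def)
  have "\<exists>s\<ge>s0. \<exists>x y. (x, y) \<in> wave_heat_operator \<Omega> \<Omega>w \<Omega>h S \<and> x \<noteq> 0 \<and>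
    norm (scaleC (\<i> * of_real s) x - y) \<le> c / sqrt s * norm x" for s0
  proof -
    \<comment> \<open>Beyond \<open>c\<^sup>2\<close> the residual can no longer exceed the norm of the quasimode.\<close>
    obtain n :: nat where n: "real n > (\<bar>s0\<bar> + c\<^sup>2) * L / pi" using reals_Archimedean2 by blast
    define s where "s = real n * pi / L"
    have s: "s > \<bar>s0\<bar> + c\<^sup>2" using n L by (simp add: s_def field_simps)
    then have s': "s > 0" "s > c\<^sup>2" "s \<ge> s0" using zero_le_power2[of c] by linarith+
    have "p - e = L \<or> p - e = - L" by (auto simp: L_def abs_if)
    then have "s * (p - e) = real n * pi \<or> s * (p - e) = - (real n * pi)" using L by (auto simp: s_def)
    then have sin0: "sin (s * (p - e)) = 0" by (metis sin_minus sin_npi neg_equal_0_iff_equal)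
    define \<kappa> where "\<kappa> = cos (s * (p - e))"
    have \<kappa>: "\<kappa>\<^sup>2 = 1" using sin_cos_squared_add[of "s * (p - e)"] sin0 by (simp add: \<kappa>_def)
    then have \<kappa>0: "\<kappa> \<noteq> 0" and \<kappa>a: "\<bar>\<kappa>\<bar> = 1" by (auto simp: power2_eq_1_iff)
    obtain H Q h1 g q where heat: "H1_rep h p H h1 g" "H1_rep h p Q q (scaleC (\<i> * of_real s) h1)"
      "AE x in lebesgue_on (seg h p). rep_L2 q x = S x * rep_L2 g x" "H h = 0" "Q p \<noteq> 0"
      "s * (cmod (H p))\<^sup>2 \<le> K * (cmod (Q p))\<^sup>2"
      using heat_mode[OF S hp \<delta> M b s'(1)] unfolding K_def by blast
    define \<alpha> \<beta> where "\<alpha> = \<i> * of_real \<kappa> * Q p" and "\<beta> = H p / of_real ((p - e) * \<kappa>)"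
    define W1 where "W1 = (\<lambda>x. \<alpha> * of_real (sin (s * (x - e))) + \<beta> * (of_real (x - e) * of_real (cos (s * (x - e)))))"
    define W2 where "W2 = (\<lambda>x. - \<i> * \<alpha> * of_real (cos (s * (x - e))) + \<i> * \<beta> * (of_real (x - e) * of_real (sin (s * (x - e)))))"
    obtain w1 w2 u1 u2 where wave: "H1_rep e p W1 w1 u2" "H1_rep e p W2 w2 u1"
      "(norm (scaleC (\<i> * of_real s) w1 - u1))\<^sup>2 \<le> (cmod \<beta>)\<^sup>2 * L"
      "(norm (scaleC (\<i> * of_real s) w2 - u2))\<^sup>2 \<le> (cmod \<beta>)\<^sup>2 * L"
      using wave_quasimode[of e p \<alpha> s \<beta>] unfolding W1_def W2_def L_def by blast
    have W1p: "W1 p = H p" "W1 e = 0"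
      using L \<kappa>0 by (auto simp: W1_def \<beta>_def sin0 L_def simp flip: \<kappa>_def)
    have W2p: "W2 p = Q p"
    proof -
      have "W2 p = (- \<i> * \<alpha>) * of_real \<kappa>" unfolding W2_def sin0 \<kappa>_def by simp
      also have "- \<i> * \<alpha> = of_real \<kappa> * Q p" unfolding \<alpha>_def by (simp flip: mult.assoc)
      finally have "W2 p = of_real (\<kappa>\<^sup>2) * Q p" by (simp add: power2_eq_square)
      then show ?thesis by (simp add: \<kappa>)
    qed
    define x y where "x = (w1, w2, h1)" and "y = (u1, u2, scaleC (\<i> * of_real s) h1)"
    have "wave_heat_relation e p h S x y W1 W2 H Q g q"
      unfolding wave_heat_relation_def x_def y_def prod.case using wave heat W1p W2p by simp
    then have xy: "(x, y) \<in> wave_heat_operator \<Omega> \<Omega>w \<Omega>h S"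
      using wave_heat_operator_iff[OF seg order bd] by blast
    define r1 r2 where "r1 = scaleC (\<i> * of_real s) w1 - u1" and "r2 = scaleC (\<i> * of_real s) w2 - u2"
    define a \<rho> where "a = norm x" and "\<rho> = norm (scaleC (\<i> * of_real s) x - y)"
    have nn: "0 \<le> a" "0 \<le> \<rho>" by (auto simp: a_def \<rho>_def)
    have res: "scaleC (\<i> * of_real s) x - y = (r1, r2, 0)"
      by (simp add: x_def y_def scaleC_prod_def r1_def r2_def)
    have \<rho>2: "\<rho>\<^sup>2 = (norm r1)\<^sup>2 + (norm r2)\<^sup>2" unfolding \<rho>_def res norm_triple by simp
    have a2: "a\<^sup>2 = (norm w1)\<^sup>2 + (norm w2)\<^sup>2 + (norm h1)\<^sup>2" unfolding a_def x_def by (rule norm_triple)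
    have le: "norm r1 \<le> \<rho>" "norm r2 \<le> \<rho>" "norm w1 \<le> a" "norm w2 \<le> a"
      by (rule power2_le_imp_le[OF _ nn(2)], simp add: \<rho>2, rule power2_le_imp_le[OF _ nn(2)], simp add: \<rho>2,
          rule power2_le_imp_le[OF _ nn(1)], simp add: a2, rule power2_le_imp_le[OF _ nn(1)], simp add: a2)
    have "(cmod \<beta>)\<^sup>2 * L = (cmod (H p))\<^sup>2 / L"
    proof -
      have "cmod \<beta> = cmod (H p) / L" by (simp add: \<beta>_def norm_divide norm_mult \<kappa>a L_def flip: of_real_diff)
      then show ?thesis using L by (simp add: power_divide power2_eq_square)
    qed
    then have "\<rho>\<^sup>2 \<le> 2 / L * (cmod (H p))\<^sup>2"
      using wave(3,4) unfolding r1_def[symmetric] r2_def[symmetric] \<rho>2 by simp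
    then have "s * \<rho>\<^sup>2 \<le> s * (2 / L * (cmod (H p))\<^sup>2)" using s'(1) by (intro mult_left_mono) auto
    also have "\<dots> = 2 / L * (s * (cmod (H p))\<^sup>2)" by simp
    also have "\<dots> \<le> 2 / L * (K * (cmod (Q p))\<^sup>2)" using heat(6) L by (intro mult_left_mono) auto
    also have "\<dots> = 2 * K / L\<^sup>2 * (L * (cmod (Q p))\<^sup>2)" using L by (simp add: power2_eq_square)
    finally have s\<rho>: "s * \<rho>\<^sup>2 \<le> 2 * K / L\<^sup>2 * (L * (cmod (Q p))\<^sup>2)" .
    have LQ: "L * (cmod (Q p))\<^sup>2 \<le> a\<^sup>2 + 4 * (L * \<rho> * a)"
    proof -
      let ?m = "mult_L2 (offset e p)"
      have u: "u1 = scaleC (\<i> * of_real s) w1 - r1" "u2 = scaleC (\<i> * of_real s) w2 - r2"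
        by (simp_all add: r1_def r2_def)
      have "cinner (?m w1) w2 = cnj (cinner (?m w2) w1)"
        using cinner_mult_adjoint[OF bounded_multiplier_offset offset_cnj, of e p w1 w2] cinner_commute[of w1 "?m w2"] by simp
      then have im: "Im (cinner (?m w1) w2) = - Im (cinner (?m w2) w1)" by simp
      have bound: "\<bar>Re (cinner (?m r) w)\<bar> \<le> L * \<rho> * a" if "norm r \<le> \<rho>" "norm w \<le> a" for r w
      proof -
        have "\<bar>Re (cinner (?m r) w)\<bar> \<le> L * norm r * norm w" unfolding L_def by (rule norm_offset_cinner_le)
        also have "\<dots> \<le> L * \<rho> * a" using that L nn by (intro mult_mono) auto
        finally show ?thesis .
      qed
      have "2 * Re (cinner (?m u2) w1) + (norm w1)\<^sup>2 = L * (cmod (H p))\<^sup>2"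
        using H1_multiplier_identity[OF wave(1)] unfolding L_def W1p .
      moreover have "2 * Re (cinner (?m u1) w2) + (norm w2)\<^sup>2 = L * (cmod (Q p))\<^sup>2"
        using H1_multiplier_identity[OF wave(2)] unfolding L_def W2p .
      moreover have "Re (cinner (?m u2) w1) = - s * Im (cinner (?m w2) w1) - Re (cinner (?m r2) w1)"
        by (rule offset_residual[OF u(2)])
      moreover have "Re (cinner (?m u1) w2) = s * Im (cinner (?m w2) w1) - Re (cinner (?m r1) w2)"
        using offset_residual[OF u(1), of e p w2] by (simp add: im)
      moreover have "0 \<le> L * (cmod (H p))\<^sup>2" "0 \<le> (norm h1)\<^sup>2" using L by auto
      ultimately show ?thesis
        using bound[OF le(2,3)] bound[OF le(1,4)] unfolding a2 mult_minus_left by linarith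
    qed
    have "x \<noteq> 0"
    proof
      assume "x = 0"
      then have "L * (cmod (Q p))\<^sup>2 \<le> 0" using LQ by (simp add: a_def)
      then show False using L heat(5) by (simp add: mult_le_0_iff)
    qed
    moreover have "\<rho> \<le> c / sqrt s * a"
    proof -
      have *: "s * \<rho>\<^sup>2 \<le> 2 * K / L\<^sup>2 * (a\<^sup>2 + 4 * (L * \<rho> * a))"
        by (rule order_trans[OF s\<rho>]) (use K LQ in \<open>intro mult_left_mono, auto\<close>)
      show ?thesis
      proof (cases "\<rho> \<le> a")
        case True
        have "a\<^sup>2 + 4 * (L * \<rho> * a) \<le> a\<^sup>2 + 4 * (L * a * a)"
          using True L nn by (intro add_left_mono mult_left_mono mult_right_mono) auto
        also have "\<dots> = (1 + 4 * L) * a\<^sup>2" by (simp add: power2_eq_square algebra_simps)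
        finally have "2 * K / L\<^sup>2 * (a\<^sup>2 + 4 * (L * \<rho> * a)) \<le> 2 * K / L\<^sup>2 * ((1 + 4 * L) * a\<^sup>2)"
          using K by (intro mult_left_mono) auto
        then have "s * \<rho>\<^sup>2 \<le> c\<^sup>2 * a\<^sup>2" using * unfolding c(2) by (simp only: mult.assoc)
        then have "\<rho>\<^sup>2 \<le> c\<^sup>2 * a\<^sup>2 / s" using s'(1) by (simp add: field_simps)
        also have "\<dots> = (c / sqrt s * a)\<^sup>2" using s'(1) by (simp add: power_mult_distrib power_divide)
        finally show ?thesis by (rule power2_le_imp_le) (use c(1) s'(1) nn in simp)
      next
        case False
        have "a\<^sup>2 + 4 * (L * \<rho> * a) \<le> \<rho>\<^sup>2 + 4 * (L * \<rho> * \<rho>)"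
          using False L nn by (intro add_mono power_mono mult_left_mono) auto
        also have "\<dots> = (1 + 4 * L) * \<rho>\<^sup>2" by (simp add: power2_eq_square algebra_simps)
        finally have "2 * K / L\<^sup>2 * (a\<^sup>2 + 4 * (L * \<rho> * a)) \<le> 2 * K / L\<^sup>2 * ((1 + 4 * L) * \<rho>\<^sup>2)"
          using K by (intro mult_left_mono) auto
        then have "s * \<rho>\<^sup>2 \<le> c\<^sup>2 * \<rho>\<^sup>2" using * unfolding c(2) by (simp only: mult.assoc)
        moreover have "\<rho>\<^sup>2 > 0" using False nn by simp
        ultimately have "s \<le> c\<^sup>2" by simp
        then show ?thesis using s'(2) by simp
      qed
    qed
    ultimately show ?thesis using xy s'(3) unfolding a_def \<rho>_def by blast
  qed
  then show ?thesis using c(1) by blast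
qed

section \<open>Decay of the wave-heat system\<close>

theorem corollary5p4:
  fixes \<Omega> \<Omega>w \<Omega>h :: "real set" and S :: "real \<Rightarrow> complex"
    and T :: "real \<Rightarrow> L2 \<times> L2 \<times> L2 \<Rightarrow> L2 \<times> L2 \<times> L2"
  assumes triple: "lipschitz_interface_triple \<Omega> \<Omega>w \<Omega>h"
    and coeff: "admissible_coefficient \<Omega>h S"
    and semigroup: "generates_on (state_space \<Omega>w \<Omega>h) (wave_heat_operator \<Omega> \<Omega>w \<Omega>h S) T"
  shows "wave_heat_perp_decay \<Omega> \<Omega>w \<Omega>h S T 2 \<and>
    \<not> (\<forall>S' T'. admissible_coefficient \<Omega>h S' \<and>
          generates_on (state_space \<Omega>w \<Omega>h) (wave_heat_operator \<Omega> \<Omega>w \<Omega>h S') T' \<longrightarrow>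
          (\<exists>d>0. 1 / d > 2 \<and> wave_heat_perp_decay \<Omega> \<Omega>w \<Omega>h S' T' d))"
proof -
  let ?A = "wave_heat_operator \<Omega> \<Omega>w \<Omega>h S" and ?X = "state_space \<Omega>w \<Omega>h"
  obtain e p h where seg: "\<Omega>w = seg e p" "\<Omega>h = seg h p" and order: "e < p \<and> p < h \<or> h < p \<and> p < e"
    and bd: "outer_boundary \<Omega> \<Omega>h = {e}" "outer_boundary \<Omega> \<Omega>w = {h}" "interface \<Omega> \<Omega>w \<Omega>h = {p}"
    using lipschitz_interface_triple_segments[OF triple] by metis
  obtain \<delta> M where \<delta>: "\<delta> > 0" and M: "M > 0" and b: "AE x in lebesgue_on \<Omega>h. \<delta> \<le> Re (S x) \<and> cmod (S x) \<le> M"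
    using admissible_coefficient_bounds[OF coeff] by metis
  have S: "S \<in> borel_measurable (lebesgue_on \<Omega>h)" using coeff by (simp add: admissible_coefficient_def)
  note b' = b[unfolded seg] and S' = S[unfolded seg]
  obtain C where co: "coercive_semigroup ?X ?A T (state_projection \<Omega>w \<Omega>h) (multiplier_swap e p) (\<lambda>x. norm (snd (snd x))) \<delta> C"
    using wave_heat_coercive_semigroup[OF seg order bd b' M \<delta> semigroup] by blast
  interpret coercive_semigroup ?X ?A T "state_projection \<Omega>w \<Omega>h" "multiplier_swap e p" "\<lambda>x. norm (snd (snd x))" \<delta> C
    by (rule co)
  have perp: "wave_heat_perp_decay \<Omega> \<Omega>w \<Omega>h S T d \<longleftrightarrow> polynomial_decay ?X ?A T d" for d
    by (simp add: wave_heat_perp_decay_def coercive_semigroup_kernel_perp[OF co])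
  obtain c where c: "c > 0" "\<And>s0. \<exists>s\<ge>s0. \<exists>x y. (x, y) \<in> ?A \<and> x \<noteq> 0 \<and>
      norm (scaleC (\<i> * of_real s) x - y) \<le> c / sqrt s * norm x"
    using wave_heat_quasimodes[OF seg order bd S' b' M \<delta>] by blast
  have "\<not> wave_heat_perp_decay \<Omega> \<Omega>w \<Omega>h S T d" if "1 / d > 2" for d
    unfolding perp by (rule quasimodes_exclude_fast_decay[OF T_contraction c that])
  then show ?thesis using perp polynomial_decay_2 coeff semigroup by blast
qed

end
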